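(* Let $\mathcal{L}$ be a left Hopf algebroid over $B$ and $P$ a left $\mathcal{L}$-comodule algebra with $N={}^{co\mathcal{L}}P$. Then $N\subseteq P$ is a cleft extension if and only if $N\subseteq P$ is a left $\mathcal{L}$-Galois extension and $P$ has the left normal basis property.
   Context: $k$ is a field, $B$ a unital $k$-algebra, $\overline B$ its opposite algebra with canonical anti-isomorphism $B\to\overline B$, $b\mapsto\bar b$, and $B^e=B\otimes\overline B$. $M\diamond_B N:=M\otimes N/\langle \bar bm\otimes n-m\otimes bn\rangle$; $M\times_BN:=\{\sum m_i\otimes n_i\in M\diamond_BN:\ \sum m_i\bar a\otimes n_i=\sum m_i\otimes n_ia\ \forall a\in B\}$. A $B$-ring is an algebra $P$ with an algebra map $B\to P$. A left bialgebroid over $B$ is an algebra $\mathcal{L}$ with algebra maps $s:B\to\mathcal{L}$, $t:\overline B\to\mathcal{L}$ with commuting images (one writes $b,\bar b$ for $s(b),t(\bar b)$), with left $B^e$-module maps $\Delta:\mathcal{L}\to\mathcal{L}\times_B\mathcal{L}$, $\Delta(X)=X_{(1)}\otimes X_{(2)}$ (so $\Delta(b\bar cX)=bX_{(1)}\otimes\bar cX_{(2)}$) and $\varepsilon:\mathcal{L}\to B$ (so $\varepsilon(b\bar cX)=b\varepsilon(X)c$), coassociative and counital ($\varepsilon(X_{(1)})X_{(2)}=\overline{\varepsilon(X_{(2)})}X_{(1)}=X$), such that $\Delta$ is an algebra map (componentwise product on $\mathcal{L}\times_B\mathcal{L}$), $\varepsilon(1)=1$ and $\varepsilon(X\varepsilon(Y))=\varepsilon(XY)=\varepsilon(X\overline{\varepsilon(Y)})$.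 Standing assumption: all $B$-module and $\overline B$-module structures are faithfully flat. $\mathcal{L}$ is a left Hopf algebroid if $\lambda:\mathcal{L}\otimes_{\overline B}\mathcal{L}\to\mathcal{L}\diamond_B\mathcal{L}$, $\lambda(X\otimes Y)=X_{(1)}\otimes X_{(2)}Y$, is bijective. A left $\mathcal{L}$-comodule is a $B$-bimodule $P$ with a coassociative, counital ($\varepsilon(p_{(-1)})p_{(0)}=p$) map $P\to\mathcal{L}\times_BP$, $p\mapsto p_{(-1)}\otimes p_{(0)}$, with $bpb'\mapsto bp_{(-1)}b'\otimes p_{(0)}$. A left $\mathcal{L}$-comodule algebra is a $B$-ring $P$ that is a left $\mathcal{L}$-comodule (with the $B$-bimodule structure of the $B$-ring) whose coaction $P\to\mathcal{L}\times_BP$ is a map of $B$-rings; $N={}^{co\mathcal{L}}P=\{p: p_{(-1)}\otimes p_{(0)}=1\otimes p\}$. $N\subseteq P$ is a left $\mathcal{L}$-Galois extension if $P\otimes_NP\to\mathcal{L}\diamond_BP$, $p\otimes q\mapsto p_{(-1)}\otimes p_{(0)}q$, is bijective. Cleft extension: $\overline B\subseteq N$ (there is an inclusion of algebras $\overline B\to N$, so that $P$ is a $\overline B$-ring) and there is a unital left $\mathcal{L}$-comodule map $\gamma:\mathcal{L}\to P$ (cleaving map; $\mathcal{L}$ is a left comodule via $\Delta$) which is $\overline B$-bilinear, $\gamma(\bar aX\bar b)=\bar a\gamma(X)\bar b$, such that $j:\mathcal{L}\otimes_{\overline B}P\to\mathcal{L}\diamond_BP$, $j(X\otimes p)=X_{(1)}\otimes\gamma(X_{(2)})p$,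 is bijective. Left normal basis property: $\overline B\subseteq N$ and $P\simeq\mathcal{L}\otimes_{\overline B}N$ as left $\mathcal{L}$-comodules, left $\overline B$-modules and right $N$-modules, where $\mathcal{L}\otimes_{\overline B}N$ has coaction $X\otimes n\mapsto X_{(1)}\otimes(X_{(2)}\otimes n)$ with $B$-bimodule structure $b(X\otimes n)b'=bXb'\otimes n$, left $\overline B$-action $\bar b(X\otimes n)=\bar bX\otimes n$, and right $N$-action on the second factor; on $P$ the left $\overline B$-action is left multiplication via $\overline B\subseteq N\subseteq P$. *)

theory Defs
  imports "HOL-Algebra.Module" "HOL-Algebra.Generated_Groups" "HOL-Algebra.Free_Abelian_Groups"
begin

section \<open>Algebras and modules\<close>

text \<open>The library locale \<open>algebra\<close> is restricted to commutative algebras.\<close>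

definition k_algebra :: "('k, 'x) ring_scheme \<Rightarrow> ('k, 'a, 'y) module_scheme \<Rightarrow> bool" where
  "k_algebra K A \<longleftrightarrow> field K \<and> module K A \<and> ring A \<and>
     (\<forall>c\<in>carrier K. \<forall>x\<in>carrier A. \<forall>y\<in>carrier A.
        (c \<odot>\<^bsub>A\<^esub> x) \<otimes>\<^bsub>A\<^esub> y = c \<odot>\<^bsub>A\<^esub> (x \<otimes>\<^bsub>A\<^esub> y) \<and>
        x \<otimes>\<^bsub>A\<^esub> (c \<odot>\<^bsub>A\<^esub> y) = c \<odot>\<^bsub>A\<^esub> (x \<otimes>\<^bsub>A\<^esub> y))"

definition alg_hom ::
    "('k, 'x) ring_scheme \<Rightarrow> ('k, 'a, 'y) module_scheme \<Rightarrow> ('k, 'c, 'z) module_scheme \<Rightarrow> ('a \<Rightarrow> 'c) set" where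
  "alg_hom K A C = {f \<in> ring_hom A C.
     \<forall>c\<in>carrier K. \<forall>x\<in>carrier A. f (c \<odot>\<^bsub>A\<^esub> x) = c \<odot>\<^bsub>C\<^esub> f x}"

text \<open>The opposite algebra has the same underlying set, so the canonical anti-isomorphism
  \<open>b \<mapsto> \<bar>b\<close> is the identity.\<close>

definition opp :: "('a, 'x) ring_scheme \<Rightarrow> ('a, 'x) ring_scheme" where
  "opp A = A\<lparr>mult := \<lambda>x y. y \<otimes>\<^bsub>A\<^esub> x\<rparr>"

text \<open>Modules over a not necessarily commutative ring; the library locale \<open>module\<close> requires a
  commutative one. A right \<open>R\<close>-module is a left module over \<open>opp R\<close>, so \<open>r \<odot> m\<close> then
  stands for \<open>m r\<close>.\<close>

locale left_module = R?: ring R + M?: abelian_group M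
  for R (structure) and M (structure) +
  assumes smult_closed: "\<lbrakk>a \<in> carrier R; x \<in> carrier M\<rbrakk> \<Longrightarrow> a \<odot>\<^bsub>M\<^esub> x \<in> carrier M"
    and smult_l_distr: "\<lbrakk>a \<in> carrier R; b \<in> carrier R; x \<in> carrier M\<rbrakk> \<Longrightarrow>
      (a \<oplus> b) \<odot>\<^bsub>M\<^esub> x = a \<odot>\<^bsub>M\<^esub> x \<oplus>\<^bsub>M\<^esub> b \<odot>\<^bsub>M\<^esub> x"
    and smult_r_distr: "\<lbrakk>a \<in> carrier R; x \<in> carrier M; y \<in> carrier M\<rbrakk> \<Longrightarrow>
      a \<odot>\<^bsub>M\<^esub> (x \<oplus>\<^bsub>M\<^esub> y) = a \<odot>\<^bsub>M\<^esub> x \<oplus>\<^bsub>M\<^esub> a \<odot>\<^bsub>M\<^esub> y"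
    and smult_assoc: "\<lbrakk>a \<in> carrier R; b \<in> carrier R; x \<in> carrier M\<rbrakk> \<Longrightarrow>
      (a \<otimes> b) \<odot>\<^bsub>M\<^esub> x = a \<odot>\<^bsub>M\<^esub> (b \<odot>\<^bsub>M\<^esub> x)"
    and smult_one: "x \<in> carrier M \<Longrightarrow> \<one> \<odot>\<^bsub>M\<^esub> x = x"

abbreviation right_module ::
    "('r, 'x) ring_scheme \<Rightarrow> ('r, 'a, 'y) module_scheme \<Rightarrow> bool" where
  "right_module R M \<equiv> left_module (opp R) M"

definition additive_maps :: "('a, 'x) ring_scheme \<Rightarrow> ('c, 'y) ring_scheme \<Rightarrow> ('a \<Rightarrow> 'c) set" where
  "additive_maps M M' = {f \<in> carrier M \<rightarrow> carrier M'.
     \<forall>x\<in>carrier M. \<forall>y\<in>carrier M. f (x \<oplus>\<^bsub>M\<^esub> y) = f x \<oplus>\<^bsub>M'\<^esub> f y}"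

definition linear_maps ::
    "('r, 'x) ring_scheme \<Rightarrow> ('r, 'a, 'y) module_scheme \<Rightarrow> ('r, 'c, 'z) module_scheme \<Rightarrow> ('a \<Rightarrow> 'c) set" where
  "linear_maps R M M' = {f \<in> additive_maps M M'.
     \<forall>r\<in>carrier R. \<forall>x\<in>carrier M. f (r \<odot>\<^bsub>M\<^esub> x) = r \<odot>\<^bsub>M'\<^esub> f x}"

text \<open>The module structures on a ring \<open>A\<close> obtained from left, respectively right,
  multiplication along a map \<open>f\<close> into \<open>A\<close>.\<close>

definition left_mult :: "('a, 'x) ring_scheme \<Rightarrow> ('r \<Rightarrow> 'a) \<Rightarrow> ('r, 'a) module" where
  "left_mult A f = \<lparr>carrier = carrier A, mult = mult A, one = one A,
     ring.zero = ring.zero A, ring.add = ring.add A,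
     smult = \<lambda>r x. f r \<otimes>\<^bsub>A\<^esub> x\<rparr>"

definition right_mult :: "('a, 'x) ring_scheme \<Rightarrow> ('r \<Rightarrow> 'a) \<Rightarrow> ('r, 'a) module" where
  "right_mult A f = \<lparr>carrier = carrier A, mult = mult A, one = one A,
     ring.zero = ring.zero A, ring.add = ring.add A,
     smult = \<lambda>r x. x \<otimes>\<^bsub>A\<^esub> f r\<rparr>"

record ('r, 'a) bimodule = "('r, 'a) module" +
  rsmult :: "'a \<Rightarrow> 'r \<Rightarrow> 'a"

definition right_part :: "('r, 'a, 'x) bimodule_scheme \<Rightarrow> ('r, 'a) module" where
  "right_part M = \<lparr>carrier = carrier M, mult = mult M, one = one M,
     ring.zero = ring.zero M, ring.add = ring.add M,
     smult = \<lambda>r x. rsmult M x r\<rparr>"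

text \<open>Bimodules over a \<open>k\<close>-algebra are understood over \<open>k\<close>: the last clause says that the two
  induced \<open>k\<close>-actions coincide.\<close>

definition is_bimodule ::
    "('k, 'x) ring_scheme \<Rightarrow> ('k, 'b, 'y) module_scheme \<Rightarrow> ('b, 'a, 'z) bimodule_scheme \<Rightarrow> bool" where
  "is_bimodule K B M \<longleftrightarrow> left_module B M \<and> right_module B (right_part M) \<and>
     (\<forall>b\<in>carrier B. \<forall>b'\<in>carrier B. \<forall>x\<in>carrier M.
        rsmult M (b \<odot>\<^bsub>M\<^esub> x) b' = b \<odot>\<^bsub>M\<^esub> rsmult M x b') \<and>
     (\<forall>c\<in>carrier K. \<forall>x\<in>carrier M. (c \<odot>\<^bsub>B\<^esub> \<one>\<^bsub>B\<^esub>) \<odot>\<^bsub>M\<^esub> x = rsmult M x (c \<odot>\<^bsub>B\<^esub> \<one>\<^bsub>B\<^esub>))"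

definition ring_bimodule :: "('a, 'x) ring_scheme \<Rightarrow> ('r \<Rightarrow> 'a) \<Rightarrow> ('r, 'a) bimodule" where
  "ring_bimodule A f = \<lparr>carrier = carrier A, mult = mult A, one = one A,
     ring.zero = ring.zero A, ring.add = ring.add A,
     smult = \<lambda>r x. f r \<otimes>\<^bsub>A\<^esub> x, rsmult = \<lambda>x r. x \<otimes>\<^bsub>A\<^esub> f r\<rparr>"


section \<open>Tensor products\<close>

text \<open>\<open>tensor R M V\<close> is \<open>M \<otimes>\<^sub>R V\<close> for a right \<open>R\<close>-module \<open>M\<close> and a left \<open>R\<close>-module \<open>V\<close>: the free
  abelian group on the pairs modulo biadditivity and \<open>R\<close>-balancedness. When \<open>R\<close> is a
  \<open>k\<close>-algebra, \<open>k\<close> acts through \<open>R\<close>, so this is also the quotient of \<open>M \<otimes>\<^sub>k V\<close> by the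
  \<open>R\<close>-balancedness relations.\<close>

definition tensor_relations ::
    "('r, 'x) ring_scheme \<Rightarrow> ('r, 'm, 'y) module_scheme \<Rightarrow> ('r, 'v, 'z) module_scheme \<Rightarrow>
     ('m \<times> 'v \<Rightarrow>\<^sub>0 int) set" where
  "tensor_relations R M V = generate (free_Abelian_group (carrier M \<times> carrier V))
     ({frag_of (m \<oplus>\<^bsub>M\<^esub> m', v) - frag_of (m, v) - frag_of (m', v) | m m' v.
         m \<in> carrier M \<and> m' \<in> carrier M \<and> v \<in> carrier V} \<union>
      {frag_of (m, v \<oplus>\<^bsub>V\<^esub> v') - frag_of (m, v) - frag_of (m, v') | m v v'.
         m \<in> carrier M \<and> v \<in> carrier V \<and> v' \<in> carrier V} \<union>
      {frag_of (r \<odot>\<^bsub>M\<^esub> m, v) - frag_of (m, r \<odot>\<^bsub>V\<^esub> v) | r m v.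
         r \<in> carrier R \<and> m \<in> carrier M \<and> v \<in> carrier V})"

definition tensor ::
    "('r, 'x) ring_scheme \<Rightarrow> ('r, 'm, 'y) module_scheme \<Rightarrow> ('r, 'v, 'z) module_scheme \<Rightarrow>
     ('m \<times> 'v \<Rightarrow>\<^sub>0 int) set ring" where
  "tensor R M V =
    (let Q = free_Abelian_group (carrier M \<times> carrier V) Mod tensor_relations R M V
     in \<lparr>carrier = carrier Q, mult = undefined, one = undefined,
         ring.zero = one Q, ring.add = mult Q\<rparr>)"

definition pure_tensor ::
    "('r, 'x) ring_scheme \<Rightarrow> ('r, 'm, 'y) module_scheme \<Rightarrow> ('r, 'v, 'z) module_scheme \<Rightarrow>
     'm \<Rightarrow> 'v \<Rightarrow> ('m \<times> 'v \<Rightarrow>\<^sub>0 int) set" where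
  "pure_tensor R M V m v =
     tensor_relations R M V #>\<^bsub>free_Abelian_group (carrier M \<times> carrier V)\<^esub> frag_of (m, v)"

text \<open>\<open>tensor_lift G f\<close> is the map \<open>\<Sum> m\<^sub>i \<otimes> v\<^sub>i \<mapsto> \<Sum> f m\<^sub>i v\<^sub>i\<close> from a tensor product to the abelian
  group \<open>G\<close>. It evaluates the sum on a chosen representative, hence it is meaningful only for
  balanced biadditive \<open>f\<close>, where it is the induced additive map (or, more generally, on elements
  for which the sum is independent of the representative).\<close>

definition tensor_lift ::
    "('c, 'x) ring_scheme \<Rightarrow> ('m \<Rightarrow> 'v \<Rightarrow> 'c) \<Rightarrow> ('m \<times> 'v \<Rightarrow>\<^sub>0 int) set \<Rightarrow> 'c" where
  "tensor_lift G f z = (let w = (SOME w. w \<in> z) in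
     \<Oplus>\<^bsub>G\<^esub>q\<in>Poly_Mapping.keys w. [Poly_Mapping.lookup w q] \<cdot>\<^bsub>G\<^esub> f (fst q) (snd q))"


section \<open>Faithful flatness\<close>

definition exact_at ::
    "('a, 'x) ring_scheme \<Rightarrow> ('a \<Rightarrow> 'c) \<Rightarrow> ('c, 'y) ring_scheme \<Rightarrow> ('c \<Rightarrow> 'd) \<Rightarrow> ('d, 'z) ring_scheme \<Rightarrow> bool" where
  "exact_at V1 f V2 g V3 \<longleftrightarrow> f ` carrier V1 = {x \<in> carrier V2. g x = \<zero>\<^bsub>V3\<^esub>}"

definition tensor_map ::
    "('r, 'x) ring_scheme \<Rightarrow> ('r, 'm, 'y) module_scheme \<Rightarrow> ('r, 'v, 'z) module_scheme \<Rightarrow>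
     ('u \<Rightarrow> 'v) \<Rightarrow> ('m \<times> 'u \<Rightarrow>\<^sub>0 int) set \<Rightarrow> ('m \<times> 'v \<Rightarrow>\<^sub>0 int) set" where
  "tensor_map R M V f = tensor_lift (tensor R M V) (\<lambda>m u. pure_tensor R M V m (f u))"

text \<open>A right \<open>R\<close>-module \<open>M\<close> is faithfully flat if a sequence of left \<open>R\<close>-modules is exact iff it is
  exact after applying \<open>M \<otimes>\<^sub>R -\<close>. The test modules have to live on a fixed type \<open>'u\<close>. The
  restriction is harmless as soon as the cyclic modules \<open>R/I\<close> and the left ideals \<open>I\<close> have copies
  on \<open>'u\<close>: flatness can be tested on the inclusions \<open>I \<subseteq> R\<close>, and a flat \<open>M\<close> is faithfully flat iff
  \<open>M \<otimes>\<^sub>R R/I = 0\<close> implies \<open>R/I = 0\<close>.\<close>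

definition right_faithfully_flat ::
    "'u itself \<Rightarrow> ('r, 'x) ring_scheme \<Rightarrow> ('r, 'm, 'y) module_scheme \<Rightarrow> bool" where
  "right_faithfully_flat U R M \<longleftrightarrow> right_module R M \<and>
     (\<forall>(V1 :: ('r, 'u) module) (V2 :: ('r, 'u) module) (V3 :: ('r, 'u) module) f g.
        left_module R V1 \<and> left_module R V2 \<and> left_module R V3 \<and>
        f \<in> linear_maps R V1 V2 \<and> g \<in> linear_maps R V2 V3 \<longrightarrow>
        (exact_at V1 f V2 g V3 \<longleftrightarrow>
         exact_at (tensor R M V1) (tensor_map R M V2 f) (tensor R M V2)
           (tensor_map R M V3 g) (tensor R M V3)))"

definition left_faithfully_flat ::
    "'u itself \<Rightarrow> ('r, 'x) ring_scheme \<Rightarrow> ('r, 'm, 'y) module_scheme \<Rightarrow> bool" where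
  "left_faithfully_flat U R M \<longleftrightarrow> right_faithfully_flat U (opp R) M"

text \<open>A type large enough for the test modules: besides the quotients of the base ring \<open>B\<close>, it has
  room for the quotients of free abelian groups on tuples of elements of \<open>B\<close>, \<open>L\<close> and \<open>P\<close>.\<close>

type_synonym ('b, 'l, 'p) test_type = "(('b + 'l + 'p) list \<Rightarrow>\<^sub>0 int) set"


section \<open>Left bialgebroids and Hopf algebroids\<close>

record ('k, 'b, 'l) bialgebroid = "('k, 'l) module" +
  src :: "'b \<Rightarrow> 'l"
  tgt :: "'b \<Rightarrow> 'l"
  comult :: "'l \<Rightarrow> ('l \<times> 'l \<Rightarrow>\<^sub>0 int) set"
  counit :: "'l \<Rightarrow> 'b"

text \<open>\<open>diamond B L M\<close> is \<open>L \<diamondop>\<^sub>B M\<close>, with relations \<open>\<bar>b x \<otimes> m = x \<otimes> b m\<close>, as a left \<open>B\<close>-module via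
  \<open>b (x \<otimes> m) = b x \<otimes> m\<close>.\<close>

abbreviation diamond_pure ::
    "('b, 'x) ring_scheme \<Rightarrow> ('k, 'b, 'l, 'y) bialgebroid_scheme \<Rightarrow> ('b, 'm, 'z) module_scheme \<Rightarrow>
     'l \<Rightarrow> 'm \<Rightarrow> ('l \<times> 'm \<Rightarrow>\<^sub>0 int) set" where
  "diamond_pure B L M \<equiv> pure_tensor B (left_mult L (tgt L)) M"

definition diamond ::
    "('b, 'x) ring_scheme \<Rightarrow> ('k, 'b, 'l, 'y) bialgebroid_scheme \<Rightarrow> ('b, 'm, 'z) module_scheme \<Rightarrow>
     ('b, ('l \<times> 'm \<Rightarrow>\<^sub>0 int) set) module" where
  "diamond B L M = (let T = tensor B (left_mult L (tgt L)) M
     in \<lparr>carrier = carrier T, mult = mult T, one = one T,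
         ring.zero = ring.zero T, ring.add = ring.add T,
         smult = \<lambda>b. tensor_lift T (\<lambda>x m. diamond_pure B L M (src L b \<otimes>\<^bsub>L\<^esub> x) m)\<rparr>)"

definition takeuchi ::
    "('b, 'x) ring_scheme \<Rightarrow> ('k, 'b, 'l, 'y) bialgebroid_scheme \<Rightarrow> ('b, 'm, 'z) bimodule_scheme \<Rightarrow>
     ('l \<times> 'm \<Rightarrow>\<^sub>0 int) set set" where
  "takeuchi B L M = {z \<in> carrier (diamond B L M). \<forall>a\<in>carrier B.
     tensor_lift (diamond B L M) (\<lambda>x m. diamond_pure B L M (x \<otimes>\<^bsub>L\<^esub> tgt L a) m) z =
     tensor_lift (diamond B L M) (\<lambda>x m. diamond_pure B L M x (rsmult M m a)) z}"

text \<open>The componentwise product of \<open>L \<times>\<^sub>B A\<close> for a \<open>B\<close>-ring \<open>f : B \<rightarrow> A\<close>. The order of the two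
  summations matters: for fixed \<open>x'\<close>, \<open>y'\<close> the inner sum is well defined on all of \<open>L \<diamondop>\<^sub>B A\<close>,
  and the outer one is well defined because the left factor \<open>z\<close> is in the Takeuchi product.\<close>

definition takeuchi_mult ::
    "('b, 'x) ring_scheme \<Rightarrow> ('k, 'b, 'l, 'y) bialgebroid_scheme \<Rightarrow> ('a, 'z) ring_scheme \<Rightarrow> ('b \<Rightarrow> 'a) \<Rightarrow>
     ('l \<times> 'a \<Rightarrow>\<^sub>0 int) set \<Rightarrow> ('l \<times> 'a \<Rightarrow>\<^sub>0 int) set \<Rightarrow> ('l \<times> 'a \<Rightarrow>\<^sub>0 int) set" where
  "takeuchi_mult B L A f z w =
    (let A' = ring_bimodule A f; D = diamond B L A'
     in tensor_lift D (\<lambda>x' y'. tensor_lift D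
          (\<lambda>x y. diamond_pure B L A' (x \<otimes>\<^bsub>L\<^esub> x') (y \<otimes>\<^bsub>A\<^esub> y')) z) w)"

text \<open>For \<open>d : M \<rightarrow> L \<diamondop>\<^sub>B M\<close> this is \<open>(\<Delta> \<otimes> id) \<circ> d = (id \<otimes> d) \<circ> d\<close>, with
  \<open>(L \<diamondop>\<^sub>B L) \<diamondop>\<^sub>B M\<close> identified with \<open>L \<diamondop>\<^sub>B (L \<diamondop>\<^sub>B M)\<close>.\<close>

definition coassociative ::
    "('b, 'x) ring_scheme \<Rightarrow> ('k, 'b, 'l, 'y) bialgebroid_scheme \<Rightarrow> ('b, 'm, 'z) module_scheme \<Rightarrow>
     ('m \<Rightarrow> ('l \<times> 'm \<Rightarrow>\<^sub>0 int) set) \<Rightarrow> bool" where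
  "coassociative B L M d \<longleftrightarrow>
    (let D = diamond B L M; DD = diamond B L D
     in \<forall>m\<in>carrier M.
          tensor_lift DD (\<lambda>x m'. tensor_lift DD
            (\<lambda>x1 x2. diamond_pure B L D x1 (diamond_pure B L M x2 m')) (comult L x)) (d m) =
          tensor_lift DD (\<lambda>x m'. diamond_pure B L D x (d m')) (d m))"

definition left_bialgebroid ::
    "('k, 'x) ring_scheme \<Rightarrow> ('k, 'b, 'y) module_scheme \<Rightarrow> ('k, 'b, 'l, 'z) bialgebroid_scheme \<Rightarrow> bool" where
  "left_bialgebroid K B L \<longleftrightarrow>
    (let s = src L; t = tgt L; \<Delta> = comult L; \<epsilon> = counit L;
         L' = ring_bimodule L (src L); D = diamond B L L'; pur = diamond_pure B L L'
     in k_algebra K B \<and> k_algebra K L \<and>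
        s \<in> alg_hom K B L \<and> t \<in> alg_hom K (opp B) L \<and>
        (\<forall>b\<in>carrier B. \<forall>c\<in>carrier B. s b \<otimes>\<^bsub>L\<^esub> t c = t c \<otimes>\<^bsub>L\<^esub> s b) \<and>
        \<Delta> \<in> carrier L \<rightarrow> takeuchi B L L' \<and> \<Delta> \<in> additive_maps L D \<and>
        (\<forall>b\<in>carrier B. \<forall>c\<in>carrier B. \<forall>x\<in>carrier L.
           \<Delta> (s b \<otimes>\<^bsub>L\<^esub> t c \<otimes>\<^bsub>L\<^esub> x) =
           tensor_lift D (\<lambda>x1 x2. pur (s b \<otimes>\<^bsub>L\<^esub> x1) (t c \<otimes>\<^bsub>L\<^esub> x2)) (\<Delta> x)) \<and>
        \<epsilon> \<in> additive_maps L B \<and>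
        (\<forall>b\<in>carrier B. \<forall>c\<in>carrier B. \<forall>x\<in>carrier L.
           \<epsilon> (s b \<otimes>\<^bsub>L\<^esub> t c \<otimes>\<^bsub>L\<^esub> x) = b \<otimes>\<^bsub>B\<^esub> \<epsilon> x \<otimes>\<^bsub>B\<^esub> c) \<and>
        coassociative B L L' \<Delta> \<and>
        (\<forall>x\<in>carrier L.
           tensor_lift L (\<lambda>x1 x2. s (\<epsilon> x1) \<otimes>\<^bsub>L\<^esub> x2) (\<Delta> x) = x \<and>
           tensor_lift L (\<lambda>x1 x2. t (\<epsilon> x2) \<otimes>\<^bsub>L\<^esub> x1) (\<Delta> x) = x) \<and>
        (\<forall>x\<in>carrier L. \<forall>y\<in>carrier L. \<Delta> (x \<otimes>\<^bsub>L\<^esub> y) = takeuchi_mult B L L s (\<Delta> x) (\<Delta> y)) \<and>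
        \<Delta> \<one>\<^bsub>L\<^esub> = pur \<one>\<^bsub>L\<^esub> \<one>\<^bsub>L\<^esub> \<and>
        \<epsilon> \<one>\<^bsub>L\<^esub> = \<one>\<^bsub>B\<^esub> \<and>
        (\<forall>x\<in>carrier L. \<forall>y\<in>carrier L.
           \<epsilon> (x \<otimes>\<^bsub>L\<^esub> s (\<epsilon> y)) = \<epsilon> (x \<otimes>\<^bsub>L\<^esub> y) \<and> \<epsilon> (x \<otimes>\<^bsub>L\<^esub> y) = \<epsilon> (x \<otimes>\<^bsub>L\<^esub> t (\<epsilon> y))))"

text \<open>The tensor product \<open>L \<otimes>\<^bsub>\<bar>B\<^esub> V\<close>, with relations \<open>x \<bar>b \<otimes> v = x \<otimes> \<bar>b v\<close>, for a left
  \<open>opp B\<close>-module \<open>V\<close>.\<close>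

abbreviation tensor_opp ::
    "('b, 'x) ring_scheme \<Rightarrow> ('k, 'b, 'l, 'y) bialgebroid_scheme \<Rightarrow> ('b, 'v, 'z) module_scheme \<Rightarrow>
     ('l \<times> 'v \<Rightarrow>\<^sub>0 int) set ring" where
  "tensor_opp B L V \<equiv> tensor (opp B) (right_mult L (tgt L)) V"

abbreviation tensor_opp_pure ::
    "('b, 'x) ring_scheme \<Rightarrow> ('k, 'b, 'l, 'y) bialgebroid_scheme \<Rightarrow> ('b, 'v, 'z) module_scheme \<Rightarrow>
     'l \<Rightarrow> 'v \<Rightarrow> ('l \<times> 'v \<Rightarrow>\<^sub>0 int) set" where
  "tensor_opp_pure B L V \<equiv> pure_tensor (opp B) (right_mult L (tgt L)) V"

definition left_Hopf_algebroid ::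
    "('k, 'x) ring_scheme \<Rightarrow> ('k, 'b, 'y) module_scheme \<Rightarrow> ('k, 'b, 'l, 'z) bialgebroid_scheme \<Rightarrow> bool" where
  "left_Hopf_algebroid K B L \<longleftrightarrow> left_bialgebroid K B L \<and>
    (let L' = ring_bimodule L (src L); D = diamond B L L'
     in bij_betw
          (tensor_lift D (\<lambda>x y. tensor_lift D
             (\<lambda>x1 x2. diamond_pure B L L' x1 (x2 \<otimes>\<^bsub>L\<^esub> y)) (comult L x)))
          (carrier (tensor_opp B L (left_mult L (tgt L))))
          (carrier D))"


section \<open>Comodules and comodule algebras\<close>

definition left_comodule ::
    "('k, 'x) ring_scheme \<Rightarrow> ('k, 'b, 'y) module_scheme \<Rightarrow> ('k, 'b, 'l, 'z) bialgebroid_scheme \<Rightarrow>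
     ('b, 'm, 'w) bimodule_scheme \<Rightarrow> ('m \<Rightarrow> ('l \<times> 'm \<Rightarrow>\<^sub>0 int) set) \<Rightarrow> bool" where
  "left_comodule K B L M d \<longleftrightarrow> is_bimodule K B M \<and>
     d \<in> carrier M \<rightarrow> takeuchi B L M \<and> d \<in> additive_maps M (diamond B L M) \<and>
     (\<forall>b\<in>carrier B. \<forall>b'\<in>carrier B. \<forall>m\<in>carrier M.
        d (b \<odot>\<^bsub>M\<^esub> rsmult M m b') =
        tensor_lift (diamond B L M)
          (\<lambda>x m'. diamond_pure B L M (src L b \<otimes>\<^bsub>L\<^esub> x \<otimes>\<^bsub>L\<^esub> src L b') m') (d m)) \<and>
     coassociative B L M d \<and>
     (\<forall>m\<in>carrier M. tensor_lift M (\<lambda>x m'. counit L x \<odot>\<^bsub>M\<^esub> m') (d m) = m)"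

definition comodule_maps ::
    "('b, 'x) ring_scheme \<Rightarrow> ('k, 'b, 'l, 'y) bialgebroid_scheme \<Rightarrow>
     ('b, 'm, 'z) bimodule_scheme \<Rightarrow> ('m \<Rightarrow> ('l \<times> 'm \<Rightarrow>\<^sub>0 int) set) \<Rightarrow>
     ('b, 'n, 'w) bimodule_scheme \<Rightarrow> ('n \<Rightarrow> ('l \<times> 'n \<Rightarrow>\<^sub>0 int) set) \<Rightarrow> ('m \<Rightarrow> 'n) set" where
  "comodule_maps B L M d M' d' = {f \<in> additive_maps M M'.
     (\<forall>b\<in>carrier B. \<forall>b'\<in>carrier B. \<forall>m\<in>carrier M.
        f (b \<odot>\<^bsub>M\<^esub> rsmult M m b') = b \<odot>\<^bsub>M'\<^esub> rsmult M' (f m) b') \<and>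
     (\<forall>m\<in>carrier M.
        d' (f m) = tensor_lift (diamond B L M') (\<lambda>x m'. diamond_pure B L M' x (f m')) (d m))}"

text \<open>The data of a comodule algebra: the algebra, the map \<open>B \<rightarrow> P\<close> making it a \<open>B\<close>-ring, and
  the coaction.\<close>

record ('k, 'b, 'l, 'p) comodule_algebra = "('k, 'p) module" +
  base :: "'b \<Rightarrow> 'p"
  coact :: "'p \<Rightarrow> ('l \<times> 'p \<Rightarrow>\<^sub>0 int) set"

abbreviation base_bimodule :: "('k, 'b, 'l, 'p, 'x) comodule_algebra_scheme \<Rightarrow> ('b, 'p) bimodule" where
  "base_bimodule P \<equiv> ring_bimodule P (base P)"

text \<open>The \<open>B\<close>-ring structure of \<open>L \<times>\<^sub>B P\<close> is \<open>b \<mapsto> b \<otimes> 1\<close>.\<close>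

definition left_comodule_algebra ::
    "('k, 'x) ring_scheme \<Rightarrow> ('k, 'b, 'y) module_scheme \<Rightarrow> ('k, 'b, 'l, 'z) bialgebroid_scheme \<Rightarrow>
     ('k, 'b, 'l, 'p, 'w) comodule_algebra_scheme \<Rightarrow> bool" where
  "left_comodule_algebra K B L P \<longleftrightarrow>
     k_algebra K P \<and> base P \<in> alg_hom K B P \<and>
     left_comodule K B L (base_bimodule P) (coact P) \<and>
     (\<forall>p\<in>carrier P. \<forall>q\<in>carrier P.
        coact P (p \<otimes>\<^bsub>P\<^esub> q) = takeuchi_mult B L P (base P) (coact P p) (coact P q)) \<and>
     coact P \<one>\<^bsub>P\<^esub> = diamond_pure B L (base_bimodule P) \<one>\<^bsub>L\<^esub> \<one>\<^bsub>P\<^esub> \<and>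
     (\<forall>b\<in>carrier B. coact P (base P b) = diamond_pure B L (base_bimodule P) (src L b) \<one>\<^bsub>P\<^esub>)"

definition coinvariants ::
    "('b, 'y) ring_scheme \<Rightarrow> ('k, 'b, 'l, 'z) bialgebroid_scheme \<Rightarrow>
     ('k, 'b, 'l, 'p, 'w) comodule_algebra_scheme \<Rightarrow> 'p set" where
  "coinvariants B L P =
     {p \<in> carrier P. coact P p = diamond_pure B L (base_bimodule P) \<one>\<^bsub>L\<^esub> p}"


section \<open>Galois extensions, cleft extensions and normal bases\<close>

text \<open>In this section the subalgebra \<open>N\<close> is always \<open>coinvariants B L P\<close>.\<close>

definition left_Galois_extension ::
    "('b, 'y) ring_scheme \<Rightarrow> ('k, 'b, 'l, 'z) bialgebroid_scheme \<Rightarrow>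
     ('k, 'b, 'l, 'p, 'w) comodule_algebra_scheme \<Rightarrow> bool" where
  "left_Galois_extension B L P \<longleftrightarrow>
    (let N = coinvariants B L P; P' = base_bimodule P; D = diamond B L P'
     in bij_betw
          (tensor_lift D (\<lambda>p q. tensor_lift D
             (\<lambda>x p'. diamond_pure B L P' x (p' \<otimes>\<^bsub>P\<^esub> q)) (coact P p)))
          (carrier (tensor (P\<lparr>carrier := N\<rparr>) (right_mult P id) (left_mult P id)))
          (carrier D))"

definition standing_flatness ::
    "('b, 'y) ring_scheme \<Rightarrow> ('k, 'b, 'l, 'z) bialgebroid_scheme \<Rightarrow>
     ('k, 'b, 'l, 'p, 'w) comodule_algebra_scheme \<Rightarrow> bool" where
  "standing_flatness B L P \<longleftrightarrow>
    (let U = TYPE(('b, 'l, 'p) test_type)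
     in left_faithfully_flat U B (left_mult L (src L)) \<and>
        right_faithfully_flat U B (right_mult L (src L)) \<and>
        left_faithfully_flat U (opp B) (left_mult L (tgt L)) \<and>
        right_faithfully_flat U (opp B) (right_mult L (tgt L)) \<and>
        left_faithfully_flat U B (left_mult P (base P)) \<and>
        right_faithfully_flat U B (right_mult P (base P)))"

text \<open>\<open>\<iota>\<close> realises an inclusion of the opposite algebra of \<open>B\<close> into \<open>N\<close>. The flatness clauses are
  the standing assumption on module structures, for the structures over the opposite algebra that
  \<open>N\<close> and \<open>P\<close> acquire through \<open>\<iota>\<close>.\<close>

definition opp_inclusion ::
    "('k, 'x) ring_scheme \<Rightarrow> ('k, 'b, 'y) module_scheme \<Rightarrow> ('k, 'b, 'l, 'z) bialgebroid_scheme \<Rightarrow>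
     ('k, 'b, 'l, 'p, 'w) comodule_algebra_scheme \<Rightarrow> ('b \<Rightarrow> 'p) \<Rightarrow> bool" where
  "opp_inclusion K B L P \<iota> \<longleftrightarrow>
    (let N = coinvariants B L P; U = TYPE(('b, 'l, 'p) test_type)
     in \<iota> \<in> alg_hom K (opp B) P \<and> \<iota> ` carrier B \<subseteq> N \<and> inj_on \<iota> (carrier B) \<and>
        left_faithfully_flat U (opp B) (left_mult P \<iota>) \<and>
        right_faithfully_flat U (opp B) (right_mult P \<iota>) \<and>
        left_faithfully_flat U (opp B) ((left_mult P \<iota>)\<lparr>carrier := N\<rparr>) \<and>
        right_faithfully_flat U (opp B) ((right_mult P \<iota>)\<lparr>carrier := N\<rparr>))"

definition cleaving_map ::
    "('b, 'y) ring_scheme \<Rightarrow> ('k, 'b, 'l, 'z) bialgebroid_scheme \<Rightarrow>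
     ('k, 'b, 'l, 'p, 'w) comodule_algebra_scheme \<Rightarrow> ('b \<Rightarrow> 'p) \<Rightarrow> ('l \<Rightarrow> 'p) \<Rightarrow> bool" where
  "cleaving_map B L P \<iota> \<gamma> \<longleftrightarrow>
    (let P' = base_bimodule P; D = diamond B L P'
     in \<gamma> \<in> comodule_maps B L (ring_bimodule L (src L)) (comult L) P' (coact P) \<and>
        \<gamma> \<one>\<^bsub>L\<^esub> = \<one>\<^bsub>P\<^esub> \<and>
        (\<forall>a\<in>carrier B. \<forall>b\<in>carrier B. \<forall>x\<in>carrier L.
           \<gamma> (tgt L a \<otimes>\<^bsub>L\<^esub> x \<otimes>\<^bsub>L\<^esub> tgt L b) = \<iota> a \<otimes>\<^bsub>P\<^esub> \<gamma> x \<otimes>\<^bsub>P\<^esub> \<iota> b) \<and>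
        bij_betw
          (tensor_lift D (\<lambda>x p. tensor_lift D
             (\<lambda>x1 x2. diamond_pure B L P' x1 (\<gamma> x2 \<otimes>\<^bsub>P\<^esub> p)) (comult L x)))
          (carrier (tensor_opp B L (left_mult P \<iota>)))
          (carrier D))"

definition cleft_via ::
    "('k, 'x) ring_scheme \<Rightarrow> ('k, 'b, 'y) module_scheme \<Rightarrow> ('k, 'b, 'l, 'z) bialgebroid_scheme \<Rightarrow>
     ('k, 'b, 'l, 'p, 'w) comodule_algebra_scheme \<Rightarrow> ('b \<Rightarrow> 'p) \<Rightarrow> bool" where
  "cleft_via K B L P \<iota> \<longleftrightarrow> opp_inclusion K B L P \<iota> \<and> (\<exists>\<gamma>. cleaving_map B L P \<iota> \<gamma>)"

definition cleft_extension ::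
    "('k, 'x) ring_scheme \<Rightarrow> ('k, 'b, 'y) module_scheme \<Rightarrow> ('k, 'b, 'l, 'z) bialgebroid_scheme \<Rightarrow>
     ('k, 'b, 'l, 'p, 'w) comodule_algebra_scheme \<Rightarrow> bool" where
  "cleft_extension K B L P \<longleftrightarrow> (\<exists>\<iota>. cleft_via K B L P \<iota>)"

text \<open>\<open>normal_bimodule\<close> is \<open>L \<otimes>\<^bsub>\<bar>B\<^esub> N\<close> with the bimodule structure \<open>b (x \<otimes> n) b' = b x b' \<otimes> n\<close>,
  and \<open>normal_coact\<close> is its coaction \<open>x \<otimes> n \<mapsto> x\<^sub>1 \<otimes> (x\<^sub>2 \<otimes> n)\<close>.\<close>

abbreviation coinvariants_module ::
    "('b, 'y) ring_scheme \<Rightarrow> ('k, 'b, 'l, 'z) bialgebroid_scheme \<Rightarrow>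
     ('k, 'b, 'l, 'p, 'w) comodule_algebra_scheme \<Rightarrow> ('b \<Rightarrow> 'p) \<Rightarrow> ('b, 'p) module" where
  "coinvariants_module B L P \<iota> \<equiv> (left_mult P \<iota>)\<lparr>carrier := coinvariants B L P\<rparr>"

definition normal_bimodule ::
    "('b, 'y) ring_scheme \<Rightarrow> ('k, 'b, 'l, 'z) bialgebroid_scheme \<Rightarrow>
     ('k, 'b, 'l, 'p, 'w) comodule_algebra_scheme \<Rightarrow> ('b \<Rightarrow> 'p) \<Rightarrow>
     ('b, ('l \<times> 'p \<Rightarrow>\<^sub>0 int) set) bimodule" where
  "normal_bimodule B L P \<iota> =
    (let N' = coinvariants_module B L P \<iota>; T = tensor_opp B L N'; pur = tensor_opp_pure B L N'
     in \<lparr>carrier = carrier T, mult = mult T, one = one T,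
         ring.zero = ring.zero T, ring.add = ring.add T,
         smult = \<lambda>b. tensor_lift T (\<lambda>x n. pur (src L b \<otimes>\<^bsub>L\<^esub> x) n),
         rsmult = \<lambda>z b. tensor_lift T (\<lambda>x n. pur (x \<otimes>\<^bsub>L\<^esub> src L b) n) z\<rparr>)"

definition normal_coact ::
    "('b, 'y) ring_scheme \<Rightarrow> ('k, 'b, 'l, 'z) bialgebroid_scheme \<Rightarrow>
     ('k, 'b, 'l, 'p, 'w) comodule_algebra_scheme \<Rightarrow> ('b \<Rightarrow> 'p) \<Rightarrow>
     ('l \<times> 'p \<Rightarrow>\<^sub>0 int) set \<Rightarrow> ('l \<times> ('l \<times> 'p \<Rightarrow>\<^sub>0 int) set \<Rightarrow>\<^sub>0 int) set" where
  "normal_coact B L P \<iota> =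
    (let N' = coinvariants_module B L P \<iota>; M = normal_bimodule B L P \<iota>; D = diamond B L M
     in tensor_lift D (\<lambda>x n. tensor_lift D
          (\<lambda>x1 x2. diamond_pure B L M x1 (tensor_opp_pure B L N' x2 n)) (comult L x)))"

definition normal_basis_via ::
    "('k, 'x) ring_scheme \<Rightarrow> ('k, 'b, 'y) module_scheme \<Rightarrow> ('k, 'b, 'l, 'z) bialgebroid_scheme \<Rightarrow>
     ('k, 'b, 'l, 'p, 'w) comodule_algebra_scheme \<Rightarrow> ('b \<Rightarrow> 'p) \<Rightarrow> bool" where
  "normal_basis_via K B L P \<iota> \<longleftrightarrow> opp_inclusion K B L P \<iota> \<and>
    (let N = coinvariants B L P; N' = coinvariants_module B L P \<iota>; M = normal_bimodule B L P \<iota>;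
         pur = tensor_opp_pure B L N'
     in \<exists>\<phi>. bij_betw \<phi> (carrier M) (carrier P) \<and>
          \<phi> \<in> comodule_maps B L M (normal_coact B L P \<iota>) (base_bimodule P) (coact P) \<and>
          (\<forall>b\<in>carrier B. \<forall>z\<in>carrier M.
             \<phi> (tensor_lift M (\<lambda>x n. pur (tgt L b \<otimes>\<^bsub>L\<^esub> x) n) z) = \<iota> b \<otimes>\<^bsub>P\<^esub> \<phi> z) \<and>
          (\<forall>n'\<in>N. \<forall>z\<in>carrier M.
             \<phi> (tensor_lift M (\<lambda>x n. pur x (n \<otimes>\<^bsub>P\<^esub> n')) z) = \<phi> z \<otimes>\<^bsub>P\<^esub> n'))"

definition left_normal_basis_property ::
    "('k, 'x) ring_scheme \<Rightarrow> ('k, 'b, 'y) module_scheme \<Rightarrow> ('k, 'b, 'l, 'z) bialgebroid_scheme \<Rightarrow>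
     ('k, 'b, 'l, 'p, 'w) comodule_algebra_scheme \<Rightarrow> bool" where
  "left_normal_basis_property K B L P \<longleftrightarrow> (\<exists>\<iota>. normal_basis_via K B L P \<iota>)"

end

theory Submission
  imports Defs
begin

text \<open>
  Let \<open>N\<close> be the coinvariants of the comodule algebra \<open>P\<close>, and let \<open>\<gamma>\<close> be a colinear map from the left
  Hopf algebroid \<open>L\<close> to \<open>P\<close> that is bilinear over the opposite of \<open>B\<close>. It gives rise to the maps
  \<open>phi : L \<otimes> N \<rightarrow> P\<close>, \<open>x \<otimes> n \<mapsto> \<gamma> x n\<close>, and \<open>theta : L \<otimes> P \<rightarrow> P \<otimes>\<^sub>N P\<close>, \<open>x \<otimes> p \<mapsto> \<gamma> x \<otimes> p\<close>, where an unadorned \<open>\<otimes>\<close>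
  is over the opposite of \<open>B\<close>. If \<open>kappa : P \<otimes>\<^sub>N P \<rightarrow> L \<diamondop> P\<close> denotes the Galois map, then the map
  \<open>J = kappa theta\<close> is \<open>x \<otimes> p \<mapsto> x\<^sub>1 \<otimes> \<gamma> x\<^sub>2 p\<close>, which is the map that has to be bijective for a cleaving
  map \<open>\<gamma>\<close>. The theorem compares the bijectivity of \<open>phi\<close>, \<open>kappa\<close> and \<open>J\<close>.

  Suppose \<open>\<gamma>\<close> is a cleaving map. On \<open>L \<otimes> N\<close> the map \<open>J\<close> agrees with \<open>phi\<close> followed by the coaction
  (\<open>coact_phi\<close>); as \<open>L\<close> is flat, \<open>L \<otimes> N\<close> embeds into \<open>L \<otimes> P\<close>, and \<open>phi\<close> is injective. For surjectivity
  (\<open>phi_surj\<close>) one shows that the preimage under \<open>J\<close> of the coaction of \<open>p\<close> lies in \<open>L \<otimes> N\<close>. Since \<open>N\<close> is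
  the equaliser of the coaction and \<open>p \<mapsto> 1 \<otimes> p\<close>, this is by flatness an equation in \<open>L \<otimes> (L \<diamondop> P)\<close>, and it
  becomes coassociativity under the injective map \<open>twist\<close>, which combines \<open>J\<close> with the canonical map of
  the Hopf algebroid (\<open>untwist_twist\<close>). Once \<open>phi\<close> is bijective, \<open>theta\<close> is surjective, and \<open>kappa\<close> is
  bijective along with \<open>J\<close> (\<open>kappa_bij\<close>).

  Conversely, a normal basis isomorphism is \<open>phi\<close> for \<open>\<gamma> x\<close> defined as the image of \<open>x \<otimes> 1\<close>
  (\<open>colin_of_normal_basis\<close>), and \<open>J = kappa theta\<close> is bijective because \<open>theta\<close> and \<open>kappa\<close> are. This
  \<open>\<gamma>\<close> need not be unital, but \<open>u = \<gamma> 1\<close> is a unit of \<open>N\<close>: the Hopf condition expresses \<open>1 \<otimes> 1\<close> through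
  elements \<open>x \<otimes> u n\<close>, and by faithful flatness left multiplication by \<open>u\<close> is bijective on \<open>N\<close> (\<open>u_resolution\<close>,
  \<open>u_surj\<close>, \<open>u_cancel\<close>). Then \<open>x \<mapsto> \<gamma> x u\<^sup>-\<^sup>1\<close> is a cleaving map (\<open>ex_cleaving_map\<close>).

  Sums in Sweedler notation are rendered as lifts of balanced functions along tensor products. Two
  devices make them manageable: an additive map may be moved under such a sum (\<open>tensor_lift_comp_eq\<close>),
  and faithful flatness may be applied to modules on any type that embeds into the one on which it is
  assumed (\<open>flat_exact_iff\<close>).\<close>

section \<open>Additive and balanced maps\<close>

lemma additive_mapsI:
  assumes "\<And>x. x \<in> carrier M \<Longrightarrow> f x \<in> carrier M'"
    and "\<And>x y. x \<in> carrier M \<Longrightarrow> y \<in> carrier M \<Longrightarrow> f (x \<oplus>\<^bsub>M\<^esub> y) = f x \<oplus>\<^bsub>M'\<^esub> f y"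
  shows "f \<in> additive_maps M M'"
  using assms by (auto simp: additive_maps_def)

lemma additive_maps_closed: "f \<in> additive_maps M M' \<Longrightarrow> x \<in> carrier M \<Longrightarrow> f x \<in> carrier M'"
  by (auto simp: additive_maps_def)

lemma additive_maps_add:
  "f \<in> additive_maps M M' \<Longrightarrow> x \<in> carrier M \<Longrightarrow> y \<in> carrier M \<Longrightarrow> f (x \<oplus>\<^bsub>M\<^esub> y) = f x \<oplus>\<^bsub>M'\<^esub> f y"
  by (auto simp: additive_maps_def)

lemma additive_maps_comp:
  "f \<in> additive_maps M M' \<Longrightarrow> g \<in> additive_maps M' M'' \<Longrightarrow> (\<lambda>x. g (f x)) \<in> additive_maps M M''"
  by (auto simp: additive_maps_def Pi_def)

lemma additive_maps_hom:
  "f \<in> additive_maps M M' \<longleftrightarrow> f \<in> hom (add_monoid M) (add_monoid M')"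
  by (auto simp: additive_maps_def hom_def)

lemma additive_maps_zero:
  assumes "abelian_group M" "abelian_group M'" "f \<in> additive_maps M M'"
  shows "f \<zero>\<^bsub>M\<^esub> = \<zero>\<^bsub>M'\<^esub>"
  using hom_one[of f "add_monoid M" "add_monoid M'"] assms
  by (simp add: additive_maps_hom abelian_group.a_group)

lemma additive_maps_uminus:
  assumes "abelian_group M" "abelian_group M'" "f \<in> additive_maps M M'" "x \<in> carrier M"
  shows "f (\<ominus>\<^bsub>M\<^esub> x) = \<ominus>\<^bsub>M'\<^esub> f x"
proof -
  interpret group_hom "add_monoid M" "add_monoid M'" f
    by (rule group_hom.intro) (use assms in \<open>auto simp: group_hom_axioms_def additive_maps_hom abelian_group.a_group\<close>)
  show ?thesis using hom_inv[of x] assms(4) by (simp add: a_inv_def)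
qed

lemma additive_maps_inj_onI:
  assumes "abelian_group M" "abelian_group M'" "f \<in> additive_maps M M'"
    and "\<And>x. x \<in> carrier M \<Longrightarrow> f x = \<zero>\<^bsub>M'\<^esub> \<Longrightarrow> x = \<zero>\<^bsub>M\<^esub>"
  shows "inj_on f (carrier M)"
proof -
  interpret group_hom "add_monoid M" "add_monoid M'" f
    by (rule group_hom.intro) (use assms in \<open>auto simp: group_hom_axioms_def additive_maps_hom abelian_group.a_group\<close>)
  show ?thesis using assms(4) inj_on_one_iff by auto
qed

lemma additive_maps_inv_into:
  assumes "abelian_group M" "f \<in> additive_maps M M'" "bij_betw f (carrier M) (carrier M')"
  shows "inv_into (carrier M) f \<in> additive_maps M' M"
proof (rule additive_mapsI)
  interpret abelian_group M by fact
  have im: "f ` carrier M = carrier M'" and inj: "inj_on f (carrier M)"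
    using assms(3) by (auto simp: bij_betw_def)
  show cl: "inv_into (carrier M) f x \<in> carrier M" if "x \<in> carrier M'" for x
    using that im by (auto intro: inv_into_into)
  fix x y assume x: "x \<in> carrier M'" and y: "y \<in> carrier M'"
  have "f (inv_into (carrier M) f x \<oplus>\<^bsub>M\<^esub> inv_into (carrier M) f y) = x \<oplus>\<^bsub>M'\<^esub> y"
    using x y im cl by (simp add: additive_maps_add[OF assms(2)] f_inv_into_f)
  then show "inv_into (carrier M) f (x \<oplus>\<^bsub>M'\<^esub> y)
      = inv_into (carrier M) f x \<oplus>\<^bsub>M\<^esub> inv_into (carrier M) f y"
    using inv_into_f_f[OF inj, of "inv_into (carrier M) f x \<oplus>\<^bsub>M\<^esub> inv_into (carrier M) f y"] x y cl by simp
qed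

lemma additive_maps_zero_map: "abelian_group M' \<Longrightarrow> (\<lambda>x. \<zero>\<^bsub>M'\<^esub>) \<in> additive_maps M M'"
  by (auto simp: additive_maps_def abelian_group.axioms abelian_monoid.l_zero abelian_monoid.zero_closed)

lemma additive_maps_plus:
  assumes "abelian_group M'" "f \<in> additive_maps M M'" "g \<in> additive_maps M M'"
  shows "(\<lambda>x. f x \<oplus>\<^bsub>M'\<^esub> g x) \<in> additive_maps M M'"
proof -
  interpret abelian_group M' by fact
  show ?thesis using assms(2,3) by (auto simp: additive_maps_def Pi_def a_ac)
qed

definition balanced ::
    "('r, 'x) ring_scheme \<Rightarrow> ('r, 'm, 'y) module_scheme \<Rightarrow> ('r, 'v, 'z) module_scheme \<Rightarrow>
     ('c, 'w) ring_scheme \<Rightarrow> ('m \<Rightarrow> 'v \<Rightarrow> 'c) \<Rightarrow> bool" where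
  "balanced R M V G f \<longleftrightarrow>
     (\<forall>m\<in>carrier M. f m \<in> additive_maps V G) \<and>
     (\<forall>v\<in>carrier V. (\<lambda>m. f m v) \<in> additive_maps M G) \<and>
     (\<forall>r\<in>carrier R. \<forall>m\<in>carrier M. \<forall>v\<in>carrier V. f (r \<odot>\<^bsub>M\<^esub> m) v = f m (r \<odot>\<^bsub>V\<^esub> v))"

lemma balancedI:
  assumes "\<And>m v. m \<in> carrier M \<Longrightarrow> v \<in> carrier V \<Longrightarrow> f m v \<in> carrier G"
    and "\<And>m m' v. m \<in> carrier M \<Longrightarrow> m' \<in> carrier M \<Longrightarrow> v \<in> carrier V \<Longrightarrow>
      f (m \<oplus>\<^bsub>M\<^esub> m') v = f m v \<oplus>\<^bsub>G\<^esub> f m' v"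
    and "\<And>m v v'. m \<in> carrier M \<Longrightarrow> v \<in> carrier V \<Longrightarrow> v' \<in> carrier V \<Longrightarrow>
      f m (v \<oplus>\<^bsub>V\<^esub> v') = f m v \<oplus>\<^bsub>G\<^esub> f m v'"
    and "\<And>r m v. r \<in> carrier R \<Longrightarrow> m \<in> carrier M \<Longrightarrow> v \<in> carrier V \<Longrightarrow>
      f (r \<odot>\<^bsub>M\<^esub> m) v = f m (r \<odot>\<^bsub>V\<^esub> v)"
  shows "balanced R M V G f"
  using assms by (auto simp: balanced_def additive_maps_def)

lemma balancedI_additive:
  assumes "\<And>m. m \<in> carrier M \<Longrightarrow> f m \<in> additive_maps V G"
    and "\<And>v. v \<in> carrier V \<Longrightarrow> (\<lambda>m. f m v) \<in> additive_maps M G"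
    and "\<And>r m v. r \<in> carrier R \<Longrightarrow> m \<in> carrier M \<Longrightarrow> v \<in> carrier V \<Longrightarrow>
      f (r \<odot>\<^bsub>M\<^esub> m) v = f m (r \<odot>\<^bsub>V\<^esub> v)"
  shows "balanced R M V G f"
  using assms by (auto simp: balanced_def)

lemma balancedD:
  assumes "balanced R M V G f"
  shows "\<And>m v. m \<in> carrier M \<Longrightarrow> v \<in> carrier V \<Longrightarrow> f m v \<in> carrier G"
    and "\<And>m m' v. m \<in> carrier M \<Longrightarrow> m' \<in> carrier M \<Longrightarrow> v \<in> carrier V \<Longrightarrow>
      f (m \<oplus>\<^bsub>M\<^esub> m') v = f m v \<oplus>\<^bsub>G\<^esub> f m' v"
    and "\<And>m v v'. m \<in> carrier M \<Longrightarrow> v \<in> carrier V \<Longrightarrow> v' \<in> carrier V \<Longrightarrow>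
      f m (v \<oplus>\<^bsub>V\<^esub> v') = f m v \<oplus>\<^bsub>G\<^esub> f m v'"
    and "\<And>r m v. r \<in> carrier R \<Longrightarrow> m \<in> carrier M \<Longrightarrow> v \<in> carrier V \<Longrightarrow>
      f (r \<odot>\<^bsub>M\<^esub> m) v = f m (r \<odot>\<^bsub>V\<^esub> v)"
  using assms by (auto simp: balanced_def additive_maps_def)

lemma balanced_additive_right: "balanced R M V G f \<Longrightarrow> m \<in> carrier M \<Longrightarrow> f m \<in> additive_maps V G"
  by (simp add: balanced_def)

lemma balanced_additive_left: "balanced R M V G f \<Longrightarrow> v \<in> carrier V \<Longrightarrow> (\<lambda>m. f m v) \<in> additive_maps M G"
  by (simp add: balanced_def)

lemma balanced_compose:
  "balanced R M V G f \<Longrightarrow> h \<in> additive_maps G G' \<Longrightarrow> balanced R M V G' (\<lambda>m v. h (f m v))"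
  unfolding balanced_def by (auto intro: additive_maps_comp)

section \<open>The universal property of the tensor product\<close>

text \<open>The parameter \<open>T\<close> shares carrier, zero and addition with the tensor product. It makes \<open>L \<diamondop>\<^sub>B M\<close>, a
tensor product with a \<open>B\<close>-action on top, an instance as it stands.\<close>

locale tensor_pair =
  fixes R :: "('r, 'x) ring_scheme" and M :: "('r, 'm, 'y) module_scheme"
    and V :: "('r, 'v, 'z) module_scheme" and T :: "(('m \<times> 'v \<Rightarrow>\<^sub>0 int) set, 'w) ring_scheme"
  assumes group_M: "abelian_group M" and group_V: "abelian_group V"
    and act_M: "r \<in> carrier R \<Longrightarrow> m \<in> carrier M \<Longrightarrow> r \<odot>\<^bsub>M\<^esub> m \<in> carrier M"
    and act_V: "r \<in> carrier R \<Longrightarrow> v \<in> carrier V \<Longrightarrow> r \<odot>\<^bsub>V\<^esub> v \<in> carrier V"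
    and carrier_T: "carrier T = carrier (tensor R M V)"
    and add_T: "ring.add T = ring.add (tensor R M V)"
    and zero_T: "ring.zero T = ring.zero (tensor R M V)"
begin

abbreviation "S \<equiv> carrier M \<times> carrier V"
abbreviation "FA \<equiv> free_Abelian_group S"
abbreviation "rel \<equiv> tensor_relations R M V"
abbreviation "pur \<equiv> pure_tensor R M V"

definition gens where "gens =
     {frag_of (m \<oplus>\<^bsub>M\<^esub> m', v) - frag_of (m, v) - frag_of (m', v) | m m' v.
         m \<in> carrier M \<and> m' \<in> carrier M \<and> v \<in> carrier V} \<union>
      {frag_of (m, v \<oplus>\<^bsub>V\<^esub> v') - frag_of (m, v) - frag_of (m, v') | m v v'.
         m \<in> carrier M \<and> v \<in> carrier V \<and> v' \<in> carrier V} \<union>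
      {frag_of (r \<odot>\<^bsub>M\<^esub> m, v) - frag_of (m, r \<odot>\<^bsub>V\<^esub> v) | r m v.
         r \<in> carrier R \<and> m \<in> carrier M \<and> v \<in> carrier V}"

lemma rel_gens: "rel = generate FA gens"
  by (simp add: tensor_relations_def gens_def)


lemma frag_of_diff_in_FA:
  "a \<in> S \<Longrightarrow> b \<in> S \<Longrightarrow> frag_of a - frag_of b \<in> carrier FA"
  using keys_diff[of "frag_of a" "frag_of b"] by (auto simp: keys_frag_of)

lemma frag_of_diff3_in_FA:
  "a \<in> S \<Longrightarrow> b \<in> S \<Longrightarrow> c \<in> S \<Longrightarrow> frag_of a - frag_of b - frag_of c \<in> carrier FA"
  using keys_diff[of "frag_of a - frag_of b" "frag_of c"] frag_of_diff_in_FA[of a b]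
  by (auto simp: keys_frag_of)

lemma gens_subset: "gens \<subseteq> carrier FA"
proof -
  interpret M: abelian_group M by (rule group_M)
  interpret V: abelian_group V by (rule group_V)
  show ?thesis
    unfolding gens_def
    by (auto simp del: carrier_free_Abelian_group_iff
        intro!: frag_of_diff_in_FA frag_of_diff3_in_FA act_M act_V)
qed

lemma subgroup_rel: "subgroup rel FA"
  unfolding rel_gens by (rule group.generate_is_subgroup) (use gens_subset in auto)

lemma normal_rel: "rel \<lhd> FA"
  by (rule comm_group.subgroup_imp_normal[OF abelian_free_Abelian_group subgroup_rel])

lemma carrier_T_eq: "carrier T = rcosets\<^bsub>FA\<^esub> rel"
  by (simp add: carrier_T tensor_def FactGroup_def)

lemma add_T_eq: "x \<oplus>\<^bsub>T\<^esub> y = x <#>\<^bsub>FA\<^esub> y"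
  by (simp add: add_T tensor_def)

lemma zero_T_eq: "\<zero>\<^bsub>T\<^esub> = rel"
  by (simp add: zero_T tensor_def)

lemma group_T: "abelian_group T"
proof -
  interpret Q: comm_group "FA Mod rel"
    by (rule comm_group.abelian_FactGroup[OF abelian_free_Abelian_group subgroup_rel])
  have c: "carrier (FA Mod rel) = carrier T" by (simp add: carrier_T_eq FactGroup_def)
  have a: "x \<otimes>\<^bsub>FA Mod rel\<^esub> y = x \<oplus>\<^bsub>T\<^esub> y" for x y by (simp add: add_T_eq)
  have z: "\<one>\<^bsub>FA Mod rel\<^esub> = \<zero>\<^bsub>T\<^esub>" by (simp add: zero_T_eq)
  show ?thesis
    by (rule abelian_groupI)
      (use Q.m_closed Q.m_assoc Q.m_comm Q.l_one Q.l_inv_ex Q.one_closed in \<open>simp_all only: c a z\<close>)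
qed

lemma coset_in_T: "w \<in> carrier FA \<Longrightarrow> rel #>\<^bsub>FA\<^esub> w \<in> carrier T"
  unfolding carrier_T_eq by (auto simp: RCOSETS_def)

lemma coset_add:
  "w \<in> carrier FA \<Longrightarrow> w' \<in> carrier FA \<Longrightarrow>
    rel #>\<^bsub>FA\<^esub> (w + w') = (rel #>\<^bsub>FA\<^esub> w) \<oplus>\<^bsub>T\<^esub> (rel #>\<^bsub>FA\<^esub> w')"
  using normal.rcos_sum[OF normal_rel, of w w'] by (simp add: add_T_eq)

lemma coset_eqI:
  assumes "w \<in> carrier FA" "w' \<in> carrier FA" "w - w' \<in> rel"
  shows "rel #>\<^bsub>FA\<^esub> w = rel #>\<^bsub>FA\<^esub> w'"
proof -
  have "w \<in> rel #>\<^bsub>FA\<^esub> w'"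
    unfolding r_coset_def using assms(3) by (auto intro!: bexI[of _ "w - w'"])
  then show ?thesis
    using group.repr_independence[OF group_free_Abelian_group _ _ subgroup_rel] assms by blast
qed

lemma pure_in_T: "m \<in> carrier M \<Longrightarrow> v \<in> carrier V \<Longrightarrow> pur m v \<in> carrier T"
  unfolding pure_tensor_def by (rule coset_in_T) auto

lemma frag_of_in_FA: "m \<in> carrier M \<Longrightarrow> v \<in> carrier V \<Longrightarrow> frag_of (m, v) \<in> carrier FA"
  by simp

lemma FA_add_closed: "w \<in> carrier FA \<Longrightarrow> w' \<in> carrier FA \<Longrightarrow> w + w' \<in> carrier FA"
  using monoid.m_closed[OF group.is_monoid[OF group_free_Abelian_group], of w S w'] by simp

lemma pure_add_left:
  assumes "m \<in> carrier M" "m' \<in> carrier M" "v \<in> carrier V"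
  shows "pur (m \<oplus>\<^bsub>M\<^esub> m') v = pur m v \<oplus>\<^bsub>T\<^esub> pur m' v"
proof -
  interpret M: abelian_group M by (rule group_M)
  have "rel #>\<^bsub>FA\<^esub> frag_of (m \<oplus>\<^bsub>M\<^esub> m', v) = rel #>\<^bsub>FA\<^esub> (frag_of (m, v) + frag_of (m', v))"
  proof (rule coset_eqI)
    have "frag_of (m \<oplus>\<^bsub>M\<^esub> m', v) - frag_of (m, v) - frag_of (m', v) \<in> gens"
      unfolding gens_def using assms by blast
    then show "frag_of (m \<oplus>\<^bsub>M\<^esub> m', v) - (frag_of (m, v) + frag_of (m', v)) \<in> rel"
      unfolding rel_gens by (metis diff_diff_eq generate.incl)
  qed (use assms in \<open>auto intro!: FA_add_closed simp del: carrier_free_Abelian_group_iff simp add: frag_of_in_FA\<close>)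
  then show ?thesis
    unfolding pure_tensor_def using assms by (simp add: coset_add)
qed

lemma pure_add_right:
  assumes "m \<in> carrier M" "v \<in> carrier V" "v' \<in> carrier V"
  shows "pur m (v \<oplus>\<^bsub>V\<^esub> v') = pur m v \<oplus>\<^bsub>T\<^esub> pur m v'"
proof -
  interpret V: abelian_group V by (rule group_V)
  have "rel #>\<^bsub>FA\<^esub> frag_of (m, v \<oplus>\<^bsub>V\<^esub> v') = rel #>\<^bsub>FA\<^esub> (frag_of (m, v) + frag_of (m, v'))"
  proof (rule coset_eqI)
    have "frag_of (m, v \<oplus>\<^bsub>V\<^esub> v') - frag_of (m, v) - frag_of (m, v') \<in> gens"
      unfolding gens_def using assms by blast
    then show "frag_of (m, v \<oplus>\<^bsub>V\<^esub> v') - (frag_of (m, v) + frag_of (m, v')) \<in> rel"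
      unfolding rel_gens by (metis diff_diff_eq generate.incl)
  qed (use assms in \<open>auto intro!: FA_add_closed simp del: carrier_free_Abelian_group_iff simp add: frag_of_in_FA\<close>)
  then show ?thesis
    unfolding pure_tensor_def using assms by (simp add: coset_add)
qed

lemma pure_smult:
  assumes "r \<in> carrier R" "m \<in> carrier M" "v \<in> carrier V"
  shows "pur (r \<odot>\<^bsub>M\<^esub> m) v = pur m (r \<odot>\<^bsub>V\<^esub> v)"
  unfolding pure_tensor_def
proof (rule coset_eqI)
  have "frag_of (r \<odot>\<^bsub>M\<^esub> m, v) - frag_of (m, r \<odot>\<^bsub>V\<^esub> v) \<in> gens"
    unfolding gens_def using assms by blast
  then show "frag_of (r \<odot>\<^bsub>M\<^esub> m, v) - frag_of (m, r \<odot>\<^bsub>V\<^esub> v) \<in> rel"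
    unfolding rel_gens by (rule generate.incl)
qed (use assms act_M act_V in auto)

lemma balanced_pure: "balanced R M V T pur"
  by (rule balancedI) (simp_all add: pure_in_T pure_add_left pure_add_right pure_smult)

text \<open>Additive inverses need no clause of their own, because \<open>-(m \<otimes> v) = (-m) \<otimes> v\<close>. The induction on the
free abelian group therefore carries the claim for the class of \<open>x\<close> and for that of \<open>-x\<close> along.\<close>

lemma tensor_induct [consumes 1, case_names pure add]:
  assumes z: "z \<in> carrier T"
    and pure: "\<And>m v. m \<in> carrier M \<Longrightarrow> v \<in> carrier V \<Longrightarrow> Q (pur m v)"
    and add: "\<And>x y. x \<in> carrier T \<Longrightarrow> y \<in> carrier T \<Longrightarrow> Q x \<Longrightarrow> Q y \<Longrightarrow> Q (x \<oplus>\<^bsub>T\<^esub> y)"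
  shows "Q z"
proof -
  interpret M: abelian_group M by (rule group_M)
  interpret V: abelian_group V by (rule group_V)
  interpret T: abelian_group T by (rule group_T)
  have zero: "pur m \<zero>\<^bsub>V\<^esub> = \<zero>\<^bsub>T\<^esub>" if "m \<in> carrier M" for m
    using additive_maps_zero[OF group_V group_T balanced_additive_right[OF balanced_pure that]] .
  have neg: "\<ominus>\<^bsub>T\<^esub> (pur m v) = pur (\<ominus>\<^bsub>M\<^esub> m) v" if "m \<in> carrier M" "v \<in> carrier V" for m v
    using additive_maps_uminus[OF group_M group_T balanced_additive_left[OF balanced_pure that(2)] that(1)] by simp
  obtain w where w: "w \<in> carrier FA" "z = rel #>\<^bsub>FA\<^esub> w"
    using z unfolding carrier_T_eq by (auto simp: RCOSETS_def)
  have "rel #>\<^bsub>FA\<^esub> w \<in> carrier T \<and> Q (rel #>\<^bsub>FA\<^esub> w) \<and> Q (\<ominus>\<^bsub>T\<^esub> (rel #>\<^bsub>FA\<^esub> w))"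
  proof (rule free_Abelian_group_induct[where S = S and x = w])
    show "Poly_Mapping.keys w \<subseteq> S" using w by simp
    have 0: "rel #>\<^bsub>FA\<^esub> 0 = \<zero>\<^bsub>T\<^esub>"
      using group.coset_mult_one[OF group_free_Abelian_group subgroup.subset[OF subgroup_rel]]
      by (simp add: zero_T_eq)
    have "Q \<zero>\<^bsub>T\<^esub>" using pure[of "\<zero>\<^bsub>M\<^esub>" "\<zero>\<^bsub>V\<^esub>"] by (simp add: zero)
    moreover have mz: "\<ominus>\<^bsub>T\<^esub> \<zero>\<^bsub>T\<^esub> = \<zero>\<^bsub>T\<^esub>"
      by (metis T.r_neg T.l_zero T.a_inv_closed T.zero_closed)
    ultimately show "rel #>\<^bsub>FA\<^esub> 0 \<in> carrier T \<and> Q (rel #>\<^bsub>FA\<^esub> 0) \<and> Q (\<ominus>\<^bsub>T\<^esub> (rel #>\<^bsub>FA\<^esub> 0))"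
      unfolding 0 mz by simp
  next
    fix x y
    assume k: "Poly_Mapping.keys x \<subseteq> S" "Poly_Mapping.keys y \<subseteq> S"
      and x: "rel #>\<^bsub>FA\<^esub> x \<in> carrier T \<and> Q (rel #>\<^bsub>FA\<^esub> x) \<and> Q (\<ominus>\<^bsub>T\<^esub> (rel #>\<^bsub>FA\<^esub> x))"
      and y: "rel #>\<^bsub>FA\<^esub> y \<in> carrier T \<and> Q (rel #>\<^bsub>FA\<^esub> y) \<and> Q (\<ominus>\<^bsub>T\<^esub> (rel #>\<^bsub>FA\<^esub> y))"
    have xy: "x - y \<in> carrier FA" using k keys_diff[of x y] by auto
    have "rel #>\<^bsub>FA\<^esub> x = (rel #>\<^bsub>FA\<^esub> (x - y)) \<oplus>\<^bsub>T\<^esub> (rel #>\<^bsub>FA\<^esub> y)"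
      using coset_add[OF xy, of y] k by simp
    then have "rel #>\<^bsub>FA\<^esub> (x - y) = (rel #>\<^bsub>FA\<^esub> x) \<oplus>\<^bsub>T\<^esub> \<ominus>\<^bsub>T\<^esub> (rel #>\<^bsub>FA\<^esub> y)"
      using coset_in_T[OF xy] y by (simp add: T.a_assoc T.r_neg)
    then show "rel #>\<^bsub>FA\<^esub> (x - y) \<in> carrier T \<and> Q (rel #>\<^bsub>FA\<^esub> (x - y)) \<and> Q (\<ominus>\<^bsub>T\<^esub> (rel #>\<^bsub>FA\<^esub> (x - y)))"
      using x y by (simp add: T.minus_add add)
  next
    fix a assume "a \<in> S"
    then obtain m v where a: "a = (m, v)" "m \<in> carrier M" "v \<in> carrier V" by auto
    then show "rel #>\<^bsub>FA\<^esub> frag_of a \<in> carrier T \<and> Q (rel #>\<^bsub>FA\<^esub> frag_of a) \<and> Q (\<ominus>\<^bsub>T\<^esub> (rel #>\<^bsub>FA\<^esub> frag_of a))"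
      using pure_in_T[of m v] pure[of m v] neg[of m v] pure[of "\<ominus>\<^bsub>M\<^esub> m" v]
      by (simp add: pure_tensor_def)
  qed
  then show ?thesis using w by simp
qed

lemma additive_maps_eqI:
  assumes "f \<in> additive_maps T G" "g \<in> additive_maps T G"
    and "\<And>m v. m \<in> carrier M \<Longrightarrow> v \<in> carrier V \<Longrightarrow> f (pur m v) = g (pur m v)"
    and "z \<in> carrier T"
  shows "f z = g z"
  using assms(4)
  by (induction rule: tensor_induct)
    (simp_all add: assms(3) additive_maps_add[OF assms(1)] additive_maps_add[OF assms(2)])

context
  fixes G :: "('c, 'u) ring_scheme" and f :: "'m \<Rightarrow> 'v \<Rightarrow> 'c"
  assumes G: "abelian_group G" and f: "balanced R M V G f"
begin

interpretation G: abelian_group G by (rule G)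

text \<open>A lift is evaluated on a chosen representative. This is the evaluation on an arbitrary one; it
  vanishes on the relations, so the choice is immaterial.\<close>

definition ev :: "('m \<times> 'v \<Rightarrow>\<^sub>0 int) \<Rightarrow> 'c" where
  "ev w = (\<Oplus>\<^bsub>G\<^esub>q\<in>Poly_Mapping.keys w. [Poly_Mapping.lookup w q] \<cdot>\<^bsub>G\<^esub> f (fst q) (snd q))"

lemma f_closed: "q \<in> S \<Longrightarrow> f (fst q) (snd q) \<in> carrier G"
  using balancedD(1)[OF f] by auto

lemma int_mult_closed: "x \<in> carrier G \<Longrightarrow> [(n::int)] \<cdot>\<^bsub>G\<^esub> x \<in> carrier G"
  using group.int_pow_closed[OF G.a_group, of x n] by (simp add: add_pow_def)

lemma int_mult_0: "[(0::int)] \<cdot>\<^bsub>G\<^esub> x = \<zero>\<^bsub>G\<^esub>"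
  by (simp add: add_pow_def int_pow_def nat_pow_def)

lemma int_mult_1: "x \<in> carrier G \<Longrightarrow> [(1::int)] \<cdot>\<^bsub>G\<^esub> x = x"
  using group.int_pow_1[OF G.a_group, of x] by (simp add: add_pow_def)

lemma int_mult_add:
  "x \<in> carrier G \<Longrightarrow> [(m + n::int)] \<cdot>\<^bsub>G\<^esub> x = [m] \<cdot>\<^bsub>G\<^esub> x \<oplus>\<^bsub>G\<^esub> [n] \<cdot>\<^bsub>G\<^esub> x"
  using group.int_pow_mult[OF G.a_group, of x m n] by (simp add: add_pow_def)

lemma ev_superset:
  assumes "finite A" "Poly_Mapping.keys w \<subseteq> A" "A \<subseteq> S"
  shows "ev w = (\<Oplus>\<^bsub>G\<^esub>q\<in>A. [Poly_Mapping.lookup w q] \<cdot>\<^bsub>G\<^esub> f (fst q) (snd q))"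
  unfolding ev_def
  by (rule G.add.finprod_mono_neutral_cong_left)
    (use assms f_closed in \<open>auto simp: in_keys_iff int_mult_0 intro!: int_mult_closed\<close>)

lemma ev_hom: "ev \<in> hom FA (add_monoid G)"
proof (rule homI)
  fix w assume "w \<in> carrier FA"
  then show "ev w \<in> carrier (add_monoid G)"
    unfolding ev_def using f_closed by (auto intro!: G.finsum_closed int_mult_closed)
next
  fix w w' assume w: "w \<in> carrier FA" "w' \<in> carrier FA"
  let ?A = "Poly_Mapping.keys w \<union> Poly_Mapping.keys w'"
  let ?e = "\<lambda>w q. [Poly_Mapping.lookup w q] \<cdot>\<^bsub>G\<^esub> f (fst q) (snd q)"
  have A: "finite ?A" "?A \<subseteq> S" "Poly_Mapping.keys (w + w') \<subseteq> ?A" using w Poly_Mapping.keys_add[of w w'] by auto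
  have cl: "?e w q \<in> carrier G" if "q \<in> ?A" for w :: "('m \<times> 'v) \<Rightarrow>\<^sub>0 int" and q
    using that A(2) by (intro int_mult_closed f_closed) auto
  have "ev (w + w') = (\<Oplus>\<^bsub>G\<^esub>q\<in>?A. ?e (w + w') q)"
    by (rule ev_superset) (use A in auto)
  also have "\<dots> = (\<Oplus>\<^bsub>G\<^esub>q\<in>?A. ?e w q \<oplus>\<^bsub>G\<^esub> ?e w' q)"
    by (rule G.finsum_cong') (use A(2) cl f_closed in \<open>auto simp: lookup_add intro!: int_mult_add\<close>)
  also have "\<dots> = (\<Oplus>\<^bsub>G\<^esub>q\<in>?A. ?e w q) \<oplus>\<^bsub>G\<^esub> (\<Oplus>\<^bsub>G\<^esub>q\<in>?A. ?e w' q)"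
    by (rule G.finsum_addf) (use cl in auto)
  also have "\<dots> = ev w \<oplus>\<^bsub>G\<^esub> ev w'"
    using A ev_superset[of ?A w] ev_superset[of ?A w'] by simp
  finally show "ev (w \<otimes>\<^bsub>FA\<^esub> w') = ev w \<otimes>\<^bsub>add_monoid G\<^esub> ev w'" by simp
qed

interpretation ev: group_hom FA "add_monoid G" ev
  by (rule group_hom.intro)
    (use ev_hom in \<open>auto simp: group_hom_axioms_def G.a_group\<close>)

lemma ev_add: "w \<in> carrier FA \<Longrightarrow> w' \<in> carrier FA \<Longrightarrow> ev (w + w') = ev w \<oplus>\<^bsub>G\<^esub> ev w'"
  using ev.hom_mult[of w w'] by simp

lemma ev_frag_of: "q \<in> S \<Longrightarrow> ev (frag_of q) = f (fst q) (snd q)"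
  unfolding ev_def using f_closed[of q] by (simp add: keys_frag_of int_mult_1)

lemma ev_diff: "w \<in> carrier FA \<Longrightarrow> w' \<in> carrier FA \<Longrightarrow> ev (w - w') = ev w \<ominus>\<^bsub>G\<^esub> ev w'"
  using ev_add[of w "- w'"] ev.hom_inv[of w'] by (simp add: a_minus_def a_inv_def)

lemma ev_gens: "g \<in> gens \<Longrightarrow> ev g = \<zero>\<^bsub>G\<^esub>"
proof -
  interpret M: abelian_group M by (rule group_M)
  interpret V: abelian_group V by (rule group_V)
  assume "g \<in> gens"
  then consider
      (1) m m' v where "g = frag_of (m \<oplus>\<^bsub>M\<^esub> m', v) - frag_of (m, v) - frag_of (m', v)"
        "m \<in> carrier M" "m' \<in> carrier M" "v \<in> carrier V"
    | (2) m v v' where "g = frag_of (m, v \<oplus>\<^bsub>V\<^esub> v') - frag_of (m, v) - frag_of (m, v')"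
        "m \<in> carrier M" "v \<in> carrier V" "v' \<in> carrier V"
    | (3) r m v where "g = frag_of (r \<odot>\<^bsub>M\<^esub> m, v) - frag_of (m, r \<odot>\<^bsub>V\<^esub> v)"
        "r \<in> carrier R" "m \<in> carrier M" "v \<in> carrier V"
    unfolding gens_def by blast
  then show ?thesis
  proof cases
    case 1
    then have "ev g = f (m \<oplus>\<^bsub>M\<^esub> m') v \<ominus>\<^bsub>G\<^esub> f m v \<ominus>\<^bsub>G\<^esub> f m' v"
      by (simp add: ev_diff ev_frag_of frag_of_diff_in_FA frag_of_in_FA del: carrier_free_Abelian_group_iff)
    also have "\<dots> = \<zero>\<^bsub>G\<^esub>"
      using 1 balancedD(1,2)[OF f] by (simp add: a_minus_def G.a_ac G.r_neg2 G.r_neg)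
    finally show ?thesis .
  next
    case 2
    then have "ev g = f m (v \<oplus>\<^bsub>V\<^esub> v') \<ominus>\<^bsub>G\<^esub> f m v \<ominus>\<^bsub>G\<^esub> f m v'"
      by (simp add: ev_diff ev_frag_of frag_of_diff_in_FA frag_of_in_FA del: carrier_free_Abelian_group_iff)
    also have "\<dots> = \<zero>\<^bsub>G\<^esub>"
      using 2 balancedD(1,3)[OF f] by (simp add: a_minus_def G.a_ac G.r_neg2 G.r_neg)
    finally show ?thesis .
  next
    case 3
    then have "ev g = f (r \<odot>\<^bsub>M\<^esub> m) v \<ominus>\<^bsub>G\<^esub> f m (r \<odot>\<^bsub>V\<^esub> v)"
      by (simp add: ev_diff ev_frag_of frag_of_in_FA act_M act_V del: carrier_free_Abelian_group_iff)
    also have "\<dots> = \<zero>\<^bsub>G\<^esub>"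
      using 3 balancedD(1,4)[OF f] act_V by (simp add: G.r_neg a_minus_def)
    finally show ?thesis .
  qed
qed

lemma ev_rel: "w \<in> rel \<Longrightarrow> ev w = \<zero>\<^bsub>G\<^esub>"
proof -
  have "rel \<subseteq> kernel FA (add_monoid G) ev"
    unfolding rel_gens
    by (rule group.generate_subgroup_incl[OF _ _ ev.subgroup_kernel])
      (use ev_gens gens_subset in \<open>auto simp: kernel_def simp del: carrier_free_Abelian_group_iff\<close>)
  then show "w \<in> rel \<Longrightarrow> ev w = \<zero>\<^bsub>G\<^esub>" by (auto simp: kernel_def)
qed

lemma tensor_lift_coset:
  assumes "w \<in> carrier FA"
  shows "tensor_lift G f (rel #>\<^bsub>FA\<^esub> w) = ev w"
proof -
  let ?v = "SOME v. v \<in> rel #>\<^bsub>FA\<^esub> w"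
  have "w \<in> rel #>\<^bsub>FA\<^esub> w"
    by (rule group.rcos_self[OF group_free_Abelian_group assms subgroup_rel])
  then have "?v \<in> rel #>\<^bsub>FA\<^esub> w" by (rule someI)
  then obtain r where r: "r \<in> rel" "?v = r + w" by (auto simp: r_coset_def)
  have "ev ?v = \<zero>\<^bsub>G\<^esub> \<oplus>\<^bsub>G\<^esub> ev w"
    using r assms subgroup.subset[OF subgroup_rel] by (auto simp: ev_add ev_rel)
  then have "ev ?v = ev w"
    using ev.hom_closed[OF assms] by simp
  then show ?thesis by (simp add: tensor_lift_def ev_def Let_def)
qed

lemma tensor_lift_pure [simp]:
  "m \<in> carrier M \<Longrightarrow> v \<in> carrier V \<Longrightarrow> tensor_lift G f (pur m v) = f m v"
  unfolding pure_tensor_def by (subst tensor_lift_coset) (auto simp: ev_frag_of)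

lemma tensor_lift_additive: "tensor_lift G f \<in> additive_maps T G"
proof (rule additive_mapsI)
  fix z assume "z \<in> carrier T"
  then obtain w where w: "w \<in> carrier FA" "z = rel #>\<^bsub>FA\<^esub> w"
    unfolding carrier_T_eq by (auto simp: RCOSETS_def)
  then show "tensor_lift G f z \<in> carrier G" using ev.hom_closed[of w] by (simp add: tensor_lift_coset)
  fix z' assume "z' \<in> carrier T"
  then obtain w' where w': "w' \<in> carrier FA" "z' = rel #>\<^bsub>FA\<^esub> w'"
    unfolding carrier_T_eq by (auto simp: RCOSETS_def)
  then show "tensor_lift G f (z \<oplus>\<^bsub>T\<^esub> z') = tensor_lift G f z \<oplus>\<^bsub>G\<^esub> tensor_lift G f z'"
    using w FA_add_closed[of w w'] by (simp add: coset_add[symmetric] tensor_lift_coset ev_add del: carrier_free_Abelian_group_iff)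
qed

lemmas tensor_lift_closed = additive_maps_closed[OF tensor_lift_additive]

end

lemma tensor_lift_comp:
  assumes "abelian_group G" "abelian_group G'" "balanced R M V G f" "h \<in> additive_maps G G'"
    and "z \<in> carrier T"
  shows "h (tensor_lift G f z) = tensor_lift G' (\<lambda>m v. h (f m v)) z"
proof (rule additive_maps_eqI[where G = G'])
  have b: "balanced R M V G' (\<lambda>m v. h (f m v))" by (rule balanced_compose[OF assms(3,4)])
  show "(\<lambda>z. h (tensor_lift G f z)) \<in> additive_maps T G'"
    by (rule additive_maps_comp[OF tensor_lift_additive[OF assms(1,3)] assms(4)])
  show "tensor_lift G' (\<lambda>m v. h (f m v)) \<in> additive_maps T G'"
    by (rule tensor_lift_additive[OF assms(2) b])
  show "h (tensor_lift G f (pur m v)) = tensor_lift G' (\<lambda>m v. h (f m v)) (pur m v)"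
    if "m \<in> carrier M" "v \<in> carrier V" for m v
    using that by (simp add: tensor_lift_pure[OF assms(1,3)] tensor_lift_pure[OF assms(2) b])
qed (rule assms(5))

lemma tensor_lift_cong:
  assumes "abelian_group G" "balanced R M V G f"
    and "\<And>m v. m \<in> carrier M \<Longrightarrow> v \<in> carrier V \<Longrightarrow> f m v = g m v"
    and "z \<in> carrier T"
  shows "tensor_lift G f z = tensor_lift G g z"
proof (rule additive_maps_eqI[OF _ _ _ assms(4)])
  interpret M: abelian_group M by (rule group_M)
  interpret V: abelian_group V by (rule group_V)
  have g: "balanced R M V G g"
    by (rule balancedI)
      (simp_all add: assms(3)[symmetric] balancedD[OF assms(2)] act_M act_V)
  show "tensor_lift G f \<in> additive_maps T G" by (rule tensor_lift_additive[OF assms(1,2)])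
  show "tensor_lift G g \<in> additive_maps T G" by (rule tensor_lift_additive[OF assms(1) g])
  show "tensor_lift G f (pur m v) = tensor_lift G g (pur m v)"
    if "m \<in> carrier M" "v \<in> carrier V" for m v
    using that assms(3) by (simp add: tensor_lift_pure[OF assms(1,2)] tensor_lift_pure[OF assms(1) g])
qed

text \<open>The work horse of all computations in Sweedler notation: an additive map is moved under a formal sum
and the summands are rewritten afterwards.\<close>

lemma tensor_lift_comp_eq:
  assumes "abelian_group G" "abelian_group G'" "balanced R M V G f" "h \<in> additive_maps G G'"
    and "z \<in> carrier T"
    and "\<And>m v. m \<in> carrier M \<Longrightarrow> v \<in> carrier V \<Longrightarrow> h (f m v) = g m v"
  shows "h (tensor_lift G f z) = tensor_lift G' g z"
  unfolding tensor_lift_comp[OF assms(1-5)]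
  by (rule tensor_lift_cong[OF assms(2) balanced_compose[OF assms(3,4)] assms(6,5)])

lemma tensor_lift_same_group:
  assumes G: "abelian_group G" and G': "abelian_group G'"
    and eq: "carrier G' = carrier G" "ring.add G' = ring.add G"
    and f: "balanced R M V G f" and z: "z \<in> carrier T"
  shows "tensor_lift G f z = tensor_lift G' f z"
proof -
  have f': "balanced R M V G' f" using f by (simp add: balanced_def additive_maps_def eq)
  have "tensor_lift G' f \<in> additive_maps T G"
    using tensor_lift_additive[OF G' f'] by (simp add: additive_maps_def eq)
  then show ?thesis
    by (rule additive_maps_eqI[OF tensor_lift_additive[OF G f] _ _ z])
      (simp add: tensor_lift_pure[OF G f] tensor_lift_pure[OF G' f'])
qed

lemma tensor_lift_plus:
  assumes "abelian_group G" "balanced R M V G f" "balanced R M V G g" "z \<in> carrier T"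
  shows "tensor_lift G (\<lambda>m v. f m v \<oplus>\<^bsub>G\<^esub> g m v) z = tensor_lift G f z \<oplus>\<^bsub>G\<^esub> tensor_lift G g z"
proof -
  have fg: "balanced R M V G (\<lambda>m v. f m v \<oplus>\<^bsub>G\<^esub> g m v)"
    using assms(1-3) by (auto simp: balanced_def intro: additive_maps_plus)
  show ?thesis
  proof (rule additive_maps_eqI[OF _ _ _ assms(4)])
    show "tensor_lift G (\<lambda>m v. f m v \<oplus>\<^bsub>G\<^esub> g m v) \<in> additive_maps T G"
      by (rule tensor_lift_additive[OF assms(1) fg])
    show "(\<lambda>z. tensor_lift G f z \<oplus>\<^bsub>G\<^esub> tensor_lift G g z) \<in> additive_maps T G"
      by (rule additive_maps_plus[OF assms(1) tensor_lift_additive[OF assms(1,2)]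
            tensor_lift_additive[OF assms(1,3)]])
  qed (simp add: tensor_lift_pure[OF assms(1) fg] tensor_lift_pure[OF assms(1,2)] tensor_lift_pure[OF assms(1,3)])
qed

text \<open>Sums over a fixed tensor whose summands depend additively on a parameter. Together with additivity in
the tensor this makes iterated lifts biadditive, hence liftable again.\<close>

lemma tensor_lift_param:
  assumes "abelian_group G" "\<And>a. a \<in> carrier A \<Longrightarrow> balanced R M V G (F a)"
    and "\<And>m v. m \<in> carrier M \<Longrightarrow> v \<in> carrier V \<Longrightarrow> (\<lambda>a. F a m v) \<in> additive_maps A G"
    and "z \<in> carrier T" and A: "\<And>a a'. a \<in> carrier A \<Longrightarrow> a' \<in> carrier A \<Longrightarrow> a \<oplus>\<^bsub>A\<^esub> a' \<in> carrier A"
  shows "(\<lambda>a. tensor_lift G (F a) z) \<in> additive_maps A G"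
proof (rule additive_mapsI)
  fix a assume a: "a \<in> carrier A"
  show "tensor_lift G (F a) z \<in> carrier G"
    by (rule tensor_lift_closed[OF assms(1) assms(2)[OF a] assms(4)])
  fix a' assume a': "a' \<in> carrier A"
  have "tensor_lift G (F (a \<oplus>\<^bsub>A\<^esub> a')) z = tensor_lift G (\<lambda>m v. F a m v \<oplus>\<^bsub>G\<^esub> F a' m v) z"
    by (rule tensor_lift_cong[OF assms(1) assms(2)[OF A[OF a a']] _ assms(4)])
      (rule additive_maps_add[OF assms(3) a a'])
  also have "\<dots> = tensor_lift G (F a) z \<oplus>\<^bsub>G\<^esub> tensor_lift G (F a') z"
    by (rule tensor_lift_plus[OF assms(1) assms(2)[OF a] assms(2)[OF a'] assms(4)])
  finally show "tensor_lift G (F (a \<oplus>\<^bsub>A\<^esub> a')) z = tensor_lift G (F a) z \<oplus>\<^bsub>G\<^esub> tensor_lift G (F a') z" .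
qed

end

lemma tensor_pair_tensor:
  assumes "abelian_group M" "abelian_group V"
    and "\<And>r m. r \<in> carrier R \<Longrightarrow> m \<in> carrier M \<Longrightarrow> r \<odot>\<^bsub>M\<^esub> m \<in> carrier M"
    and "\<And>r v. r \<in> carrier R \<Longrightarrow> v \<in> carrier V \<Longrightarrow> r \<odot>\<^bsub>V\<^esub> v \<in> carrier V"
  shows "tensor_pair R M V (tensor R M V)"
  using assms by (simp add: tensor_pair_def)

section \<open>Consequences of faithful flatness\<close>

lemma carrier_opp [simp]: "carrier (opp R) = carrier R"
  and add_opp [simp]: "ring.add (opp R) = ring.add R"
  and zero_opp [simp]: "ring.zero (opp R) = ring.zero R"
  and one_opp [simp]: "monoid.one (opp R) = monoid.one R"
  and mult_opp [simp]: "x \<otimes>\<^bsub>opp R\<^esub> y = y \<otimes>\<^bsub>R\<^esub> x"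
  by (simp_all add: opp_def)

lemma linear_mapsD:
  assumes "f \<in> linear_maps R V W"
  shows "f \<in> additive_maps V W"
    and "\<And>r x. r \<in> carrier R \<Longrightarrow> x \<in> carrier V \<Longrightarrow> f (r \<odot>\<^bsub>V\<^esub> x) = r \<odot>\<^bsub>W\<^esub> f x"
  using assms by (auto simp: linear_maps_def)

lemma linear_maps_closed: "f \<in> linear_maps R V W \<Longrightarrow> x \<in> carrier V \<Longrightarrow> f x \<in> carrier W"
  using additive_maps_closed linear_mapsD(1) by metis

lemma linear_mapsI:
  assumes "f \<in> additive_maps V W"
    and "\<And>r x. r \<in> carrier R \<Longrightarrow> x \<in> carrier V \<Longrightarrow> f (r \<odot>\<^bsub>V\<^esub> x) = r \<odot>\<^bsub>W\<^esub> f x"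
  shows "f \<in> linear_maps R V W"
  using assms by (auto simp: linear_maps_def)

lemma linear_maps_comp:
  "f \<in> linear_maps R V W \<Longrightarrow> g \<in> linear_maps R W X \<Longrightarrow> (\<lambda>x. g (f x)) \<in> linear_maps R V X"
  by (auto simp: linear_maps_def intro: additive_maps_comp dest: additive_maps_closed)

lemma tensor_pair_modules:
  assumes "right_module R M" "left_module R V"
  shows "tensor_pair R M V (tensor R M V)"
proof -
  interpret M: left_module "opp R" M by fact
  interpret V: left_module R V by fact
  show ?thesis
    by (rule tensor_pair_tensor)
      (use M.smult_closed V.smult_closed M.M.abelian_group_axioms V.M.abelian_group_axioms in auto)
qed

lemma
  assumes M: "right_module R M" and V: "left_module R V" and W: "left_module R W"
    and f: "f \<in> linear_maps R V W"
  shows tensor_map_additive: "tensor_map R M W f \<in> additive_maps (tensor R M V) (tensor R M W)"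
    and tensor_map_pure: "\<And>m v. m \<in> carrier M \<Longrightarrow> v \<in> carrier V \<Longrightarrow>
      tensor_map R M W f (pure_tensor R M V m v) = pure_tensor R M W m (f v)"
proof -
  interpret V: tensor_pair R M V "tensor R M V" by (rule tensor_pair_modules[OF M V])
  interpret W: tensor_pair R M W "tensor R M W" by (rule tensor_pair_modules[OF M W])
  have b: "balanced R M V (tensor R M W) (\<lambda>m v. pure_tensor R M W m (f v))"
    by (rule balancedI)
      (simp_all add: W.pure_in_T W.pure_add_left W.pure_add_right W.pure_smult
        additive_maps_closed[OF linear_mapsD(1)[OF f]] additive_maps_add[OF linear_mapsD(1)[OF f]]
        linear_mapsD(2)[OF f])
  show "tensor_map R M W f \<in> additive_maps (tensor R M V) (tensor R M W)"
    unfolding tensor_map_def by (rule V.tensor_lift_additive[OF W.group_T b])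
  show "tensor_map R M W f (pure_tensor R M V m v) = pure_tensor R M W m (f v)"
    if "m \<in> carrier M" "v \<in> carrier V" for m v
    unfolding tensor_map_def by (rule V.tensor_lift_pure[OF W.group_T b that])
qed

lemma tensor_map_comp:
  assumes M: "right_module R M" and V: "left_module R V" and W: "left_module R W" and X: "left_module R X"
    and f: "f \<in> linear_maps R V W" and g: "g \<in> linear_maps R W X" and h: "h \<in> linear_maps R V X"
    and h_eq: "\<And>v. v \<in> carrier V \<Longrightarrow> h v = g (f v)"
    and z: "z \<in> carrier (tensor R M V)"
  shows "tensor_map R M X g (tensor_map R M W f z) = tensor_map R M X h z"
proof -
  interpret V: tensor_pair R M V "tensor R M V" by (rule tensor_pair_modules[OF M V])
  show ?thesis
    by (rule V.additive_maps_eqI[OF _ _ _ z],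
        rule additive_maps_comp[OF tensor_map_additive[OF M V W f] tensor_map_additive[OF M W X g]],
        rule tensor_map_additive[OF M V X h])
      (simp add: tensor_map_pure[OF M V W f] tensor_map_pure[OF M W X g] tensor_map_pure[OF M V X h]
        linear_maps_closed[OF f] h_eq)
qed

lemma tensor_map_id:
  assumes M: "right_module R M" and V: "left_module R V"
    and h: "\<And>v. v \<in> carrier V \<Longrightarrow> h v = v"
    and z: "z \<in> carrier (tensor R M V)"
  shows "tensor_map R M V h z = z"
proof -
  interpret V: tensor_pair R M V "tensor R M V" by (rule tensor_pair_modules[OF M V])
  interpret V: left_module R V by fact
  have l: "h \<in> linear_maps R V V"
    by (rule linear_mapsI) (use V.smult_closed in \<open>auto simp: additive_maps_def h\<close>)
  show ?thesis
    by (rule V.additive_maps_eqI[OF tensor_map_additive[OF M V V l] _ _ z])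
      (auto simp: additive_maps_def tensor_map_pure[OF M V V l] h)
qed

text \<open>Faithful flatness speaks of modules on one fixed type. A module on another type is carried there along
an injection.\<close>

definition copy_module :: "('a \<Rightarrow> 'u) \<Rightarrow> ('r, 'a, 'y) module_scheme \<Rightarrow> ('r, 'u) module" where
  "copy_module e V = (let d = inv_into (carrier V) e in
     \<lparr>carrier = e ` carrier V, mult = undefined, one = undefined,
      ring.zero = e \<zero>\<^bsub>V\<^esub>, ring.add = (\<lambda>x y. e (d x \<oplus>\<^bsub>V\<^esub> d y)),
      smult = (\<lambda>r x. e (r \<odot>\<^bsub>V\<^esub> d x))\<rparr>)"

lemma
  assumes V: "left_module R V" and e: "inj_on e (carrier V)"
  shows copy_left_module: "left_module R (copy_module e V)"
    and copy_linear: "e \<in> linear_maps R V (copy_module e V)"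
    and copy_inv_linear: "inv_into (carrier V) e \<in> linear_maps R (copy_module e V) V"
proof -
  interpret V: left_module R V by fact
  have c: "carrier (copy_module e V) = e ` carrier V" by (simp add: copy_module_def Let_def)
  have z: "\<zero>\<^bsub>copy_module e V\<^esub> = e \<zero>\<^bsub>V\<^esub>" by (simp add: copy_module_def Let_def)
  have a: "e x \<oplus>\<^bsub>copy_module e V\<^esub> e y = e (x \<oplus>\<^bsub>V\<^esub> y)" if "x \<in> carrier V" "y \<in> carrier V" for x y
    using that by (simp add: copy_module_def Let_def inv_into_f_f[OF e])
  have s: "r \<odot>\<^bsub>copy_module e V\<^esub> e x = e (r \<odot>\<^bsub>V\<^esub> x)" if "x \<in> carrier V" for r x
    using that by (simp add: copy_module_def Let_def inv_into_f_f[OF e])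
  have "abelian_group (copy_module e V)"
  proof (rule abelian_groupI)
    fix x assume "x \<in> carrier (copy_module e V)"
    then obtain x' where "x' \<in> carrier V" "x = e x'" by (auto simp: c)
    then show "\<exists>y\<in>carrier (copy_module e V). y \<oplus>\<^bsub>copy_module e V\<^esub> x = \<zero>\<^bsub>copy_module e V\<^esub>"
      by (intro bexI[of _ "e (\<ominus>\<^bsub>V\<^esub> x')"]) (auto simp: a z c V.M.l_neg)
  qed (auto simp: a z c V.M.a_ac)
  then show lm: "left_module R (copy_module e V)"
    by (rule left_module.intro[OF V.R.ring_axioms])
      (unfold_locales, auto simp: a s c V.smult_closed V.smult_l_distr V.smult_r_distr V.smult_assoc V.smult_one)
  show "e \<in> linear_maps R V (copy_module e V)"
    by (auto simp: linear_maps_def additive_maps_def a s c)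
  show "inv_into (carrier V) e \<in> linear_maps R (copy_module e V) V"
    by (auto simp: linear_maps_def additive_maps_def a s c inv_into_f_f[OF e] V.smult_closed)
qed

lemma exact_at_iso:
  assumes h1: "h1 ` carrier V1 = carrier W1" and h2: "bij_betw h2 (carrier V2) (carrier W2)"
    and h3: "inj_on h3 (carrier V3)"
    and f: "\<And>x. x \<in> carrier V1 \<Longrightarrow> f x \<in> carrier V2" and g: "\<And>x. x \<in> carrier V2 \<Longrightarrow> g x \<in> carrier V3"
    and hf: "\<And>x. x \<in> carrier V1 \<Longrightarrow> f' (h1 x) = h2 (f x)"
    and hg: "\<And>x. x \<in> carrier V2 \<Longrightarrow> g' (h2 x) = h3 (g x)"
    and zero: "\<zero>\<^bsub>V3\<^esub> \<in> carrier V3" "h3 \<zero>\<^bsub>V3\<^esub> = \<zero>\<^bsub>W3\<^esub>"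
  shows "exact_at V1 f V2 g V3 \<longleftrightarrow> exact_at W1 f' W2 g' W3"
proof -
  have 1: "f' ` carrier W1 = h2 ` f ` carrier V1"
    unfolding h1[symmetric] image_image using hf by (auto intro!: image_cong)
  have 2: "{x \<in> carrier W2. g' x = \<zero>\<^bsub>W3\<^esub>} = h2 ` {x \<in> carrier V2. g x = \<zero>\<^bsub>V3\<^esub>}"
    unfolding bij_betw_imp_surj_on[OF h2, symmetric]
    using hg zero inj_onD[OF h3 _ g zero(1)] by (auto simp: image_iff)
  show ?thesis
    unfolding exact_at_def 1 2
    using inj_on_image_eq_iff[OF bij_betw_imp_inj_on[OF h2],
        of "f ` carrier V1" "{x \<in> carrier V2. g x = \<zero>\<^bsub>V3\<^esub>}"] f by auto
qed

lemma tensor_map_copy_bij: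
  assumes M: "right_module R M" and V: "left_module R V" and e: "inj_on e (carrier V)"
  shows "bij_betw (tensor_map R M (copy_module e V) e) (carrier (tensor R M V))
    (carrier (tensor R M (copy_module e V)))"
proof -
  note C = copy_left_module[OF V e] and l = copy_linear[OF V e] and l' = copy_inv_linear[OF V e]
  let ?d = "inv_into (carrier V) e"
  have c: "carrier (copy_module e V) = e ` carrier V" by (simp add: copy_module_def Let_def)
  show ?thesis
  proof (rule bij_betw_byWitness[where f' = "tensor_map R M V ?d"])
    show "\<forall>z\<in>carrier (tensor R M V). tensor_map R M V ?d (tensor_map R M (copy_module e V) e z) = z"
      by (auto simp: tensor_map_comp[OF M V C V l l' linear_maps_comp[OF l l']] tensor_map_id[OF M V] inv_into_f_f[OF e])
    show "\<forall>z\<in>carrier (tensor R M (copy_module e V)).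
        tensor_map R M (copy_module e V) e (tensor_map R M V ?d z) = z"
      by (auto simp: tensor_map_comp[OF M C V C l' l linear_maps_comp[OF l' l]] c f_inv_into_f
          intro!: tensor_map_id[OF M C])
  qed (use additive_maps_closed[OF tensor_map_additive[OF M V C l]]
        additive_maps_closed[OF tensor_map_additive[OF M C V l']] in auto)
qed

text \<open>The sequence and its tensored version are isomorphic to the sequences formed from the copies, and
exactness is invariant under isomorphism of sequences.\<close>

lemma flat_exact_iff:
  fixes e1 :: "'v1 \<Rightarrow> 'u" and e2 :: "'v2 \<Rightarrow> 'u" and e3 :: "'v3 \<Rightarrow> 'u"
  assumes ff: "right_faithfully_flat TYPE('u) R M"
    and V1: "left_module R V1" and V2: "left_module R V2" and V3: "left_module R V3"
    and e1: "inj_on e1 (carrier V1)" and e2: "inj_on e2 (carrier V2)" and e3: "inj_on e3 (carrier V3)"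
    and f: "f \<in> linear_maps R V1 V2" and g: "g \<in> linear_maps R V2 V3"
  shows "exact_at V1 f V2 g V3 \<longleftrightarrow>
    exact_at (tensor R M V1) (tensor_map R M V2 f) (tensor R M V2) (tensor_map R M V3 g) (tensor R M V3)"
proof -
  have M: "right_module R M" using ff by (simp add: right_faithfully_flat_def)
  interpret V3: left_module R V3 by (rule V3)
  interpret T3: tensor_pair R M V3 "tensor R M V3" by (rule tensor_pair_modules[OF M V3])
  let ?W1 = "copy_module e1 V1" and ?W2 = "copy_module e2 V2" and ?W3 = "copy_module e3 V3"
  note C1 = copy_left_module[OF V1 e1] and C2 = copy_left_module[OF V2 e2] and C3 = copy_left_module[OF V3 e3]
  note l1 = copy_linear[OF V1 e1] and l2 = copy_linear[OF V2 e2] and l3 = copy_linear[OF V3 e3]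
  note i1 = copy_inv_linear[OF V1 e1] and i2 = copy_inv_linear[OF V2 e2]
  interpret S3: tensor_pair R M ?W3 "tensor R M ?W3" by (rule tensor_pair_modules[OF M C3])
  let ?f = "\<lambda>x. e2 (f (inv_into (carrier V1) e1 x))" and ?g = "\<lambda>x. e3 (g (inv_into (carrier V2) e2 x))"
  have f': "?f \<in> linear_maps R ?W1 ?W2" by (intro linear_maps_comp[OF linear_maps_comp[OF i1 f] l2])
  have g': "?g \<in> linear_maps R ?W2 ?W3" by (intro linear_maps_comp[OF linear_maps_comp[OF i2 g] l3])
  have b: "bij_betw e (carrier V) (carrier (copy_module e V))" if "inj_on e (carrier V)"
    for e :: "'v \<Rightarrow> 'u" and V :: "('r, 'v, 't) module_scheme"
    using that by (simp add: copy_module_def Let_def inj_on_imp_bij_betw)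
  have "exact_at V1 f V2 g V3 \<longleftrightarrow> exact_at ?W1 ?f ?W2 ?g ?W3"
  proof (rule exact_at_iso[where ?h1.0 = e1 and ?h2.0 = e2 and ?h3.0 = e3])
    show "e1 ` carrier V1 = carrier ?W1" "e3 \<zero>\<^bsub>V3\<^esub> = \<zero>\<^bsub>?W3\<^esub>" by (simp_all add: copy_module_def Let_def)
  qed (use b[OF e2] e3 linear_maps_closed[OF f] linear_maps_closed[OF g] V3.M.zero_closed in
      \<open>auto simp: inv_into_f_f[OF e1] inv_into_f_f[OF e2]\<close>)
  also have "\<dots> \<longleftrightarrow> exact_at (tensor R M ?W1) (tensor_map R M ?W2 ?f) (tensor R M ?W2)
      (tensor_map R M ?W3 ?g) (tensor R M ?W3)"
    using ff C1 C2 C3 f' g' unfolding right_faithfully_flat_def by blast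
  also have "\<dots> \<longleftrightarrow> exact_at (tensor R M V1) (tensor_map R M V2 f) (tensor R M V2)
      (tensor_map R M V3 g) (tensor R M V3)"
  proof (rule sym[OF exact_at_iso[where ?h1.0 = "tensor_map R M ?W1 e1" and ?h2.0 = "tensor_map R M ?W2 e2"
        and ?h3.0 = "tensor_map R M ?W3 e3"]])
    show "tensor_map R M ?W1 e1 ` carrier (tensor R M V1) = carrier (tensor R M ?W1)"
      by (rule bij_betw_imp_surj_on[OF tensor_map_copy_bij[OF M V1 e1]])
    show "bij_betw (tensor_map R M ?W2 e2) (carrier (tensor R M V2)) (carrier (tensor R M ?W2))"
      by (rule tensor_map_copy_bij[OF M V2 e2])
    show "inj_on (tensor_map R M ?W3 e3) (carrier (tensor R M V3))"
      by (rule bij_betw_imp_inj_on[OF tensor_map_copy_bij[OF M V3 e3]])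
    show "tensor_map R M ?W2 ?f (tensor_map R M ?W1 e1 z) = tensor_map R M ?W2 e2 (tensor_map R M V2 f z)"
      if "z \<in> carrier (tensor R M V1)" for z
      using tensor_map_comp[OF M V1 C1 C2 l1 f' linear_maps_comp[OF f l2] _ that]
        tensor_map_comp[OF M V1 V2 C2 f l2 linear_maps_comp[OF f l2] _ that]
      by (simp add: inv_into_f_f[OF e1])
    show "tensor_map R M ?W3 ?g (tensor_map R M ?W2 e2 z) = tensor_map R M ?W3 e3 (tensor_map R M V3 g z)"
      if "z \<in> carrier (tensor R M V2)" for z
      using tensor_map_comp[OF M V2 C2 C3 l2 g' linear_maps_comp[OF g l3] _ that]
        tensor_map_comp[OF M V2 V3 C3 g l3 linear_maps_comp[OF g l3] _ that]
      by (simp add: inv_into_f_f[OF e2])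
    show "\<zero>\<^bsub>tensor R M V3\<^esub> \<in> carrier (tensor R M V3)"
      by (rule abelian_monoid.zero_closed[OF abelian_group.axioms(1)[OF T3.group_T]])
    show "tensor_map R M ?W3 e3 \<zero>\<^bsub>tensor R M V3\<^esub> = \<zero>\<^bsub>tensor R M ?W3\<^esub>"
      by (rule additive_maps_zero[OF T3.group_T S3.group_T tensor_map_additive[OF M V3 C3 l3]])
  qed (use additive_maps_closed[OF tensor_map_additive[OF M V1 V2 f]]
        additive_maps_closed[OF tensor_map_additive[OF M V2 V3 g]] in auto)
  finally show ?thesis .
qed

lemma flat_kernel:
  fixes e1 :: "'v1 \<Rightarrow> 'u" and e2 :: "'v2 \<Rightarrow> 'u" and e3 :: "'v3 \<Rightarrow> 'u"
  assumes ff: "right_faithfully_flat TYPE('u) R M"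
    and V: "left_module R V1" "left_module R V2" "left_module R V3"
    and e: "inj_on e1 (carrier V1)" "inj_on e2 (carrier V2)" "inj_on e3 (carrier V3)"
    and fg: "f \<in> linear_maps R V1 V2" "g \<in> linear_maps R V2 V3"
    and ker: "f ` carrier V1 = {x \<in> carrier V2. g x = \<zero>\<^bsub>V3\<^esub>}"
    and z: "z \<in> carrier (tensor R M V2)" "tensor_map R M V3 g z = \<zero>\<^bsub>tensor R M V3\<^esub>"
  shows "z \<in> tensor_map R M V2 f ` carrier (tensor R M V1)"
  using flat_exact_iff[OF ff V e fg] ker z by (auto simp: exact_at_def)

lemma zero_linear: "left_module R W \<Longrightarrow> (\<lambda>x. \<zero>\<^bsub>W\<^esub>) \<in> linear_maps R V W"
proof -
  assume "left_module R W"
  then interpret W: left_module R W .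
  have "r \<odot>\<^bsub>W\<^esub> \<zero>\<^bsub>W\<^esub> = \<zero>\<^bsub>W\<^esub>" if "r \<in> carrier R" for r
    by (rule additive_maps_zero[of W W "\<lambda>x. r \<odot>\<^bsub>W\<^esub> x"])
      (use that W.smult_closed W.smult_r_distr W.M.abelian_group_axioms in \<open>auto simp: additive_maps_def\<close>)
  then show ?thesis by (auto simp: linear_maps_def additive_maps_def)
qed

lemma tensor_map_zero:
  assumes M: "right_module R M" and V: "left_module R V" and W: "left_module R W"
    and z: "z \<in> carrier (tensor R M V)"
  shows "tensor_map R M W (\<lambda>x. \<zero>\<^bsub>W\<^esub>) z = \<zero>\<^bsub>tensor R M W\<^esub>"
proof -
  interpret V: tensor_pair R M V "tensor R M V" by (rule tensor_pair_modules[OF M V])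
  interpret W: tensor_pair R M W "tensor R M W" by (rule tensor_pair_modules[OF M W])
  have "pure_tensor R M W m \<zero>\<^bsub>W\<^esub> = \<zero>\<^bsub>tensor R M W\<^esub>" if "m \<in> carrier M" for m
    by (rule additive_maps_zero[OF W.group_V W.group_T balanced_additive_right[OF W.balanced_pure that]])
  then show ?thesis
    by (intro V.additive_maps_eqI[OF tensor_map_additive[OF M V W zero_linear[OF W]]
          additive_maps_zero_map[OF W.group_T] _ z])
      (simp add: tensor_map_pure[OF M V W zero_linear[OF W]])
qed

text \<open>Injectivity of \<open>f\<close> is exactness of \<open>0 : V \<rightarrow> V\<close> followed by \<open>f\<close>.\<close>

lemma flat_inj:
  fixes e1 :: "'v \<Rightarrow> 'u" and e2 :: "'w \<Rightarrow> 'u"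
  assumes ff: "right_faithfully_flat TYPE('u) R M"
    and V: "left_module R V" and W: "left_module R W"
    and e: "inj_on e1 (carrier V)" "inj_on e2 (carrier W)"
    and f: "f \<in> linear_maps R V W" and inj: "inj_on f (carrier V)"
  shows "inj_on (tensor_map R M W f) (carrier (tensor R M V))"
proof -
  have M: "right_module R M" using ff by (simp add: right_faithfully_flat_def)
  interpret TV: tensor_pair R M V "tensor R M V" by (rule tensor_pair_modules[OF M V])
  interpret TW: tensor_pair R M W "tensor R M W" by (rule tensor_pair_modules[OF M W])
  interpret V: abelian_group V by (rule TV.group_V)
  have f0: "f \<zero>\<^bsub>V\<^esub> = \<zero>\<^bsub>W\<^esub>"
    by (rule additive_maps_zero[OF TV.group_V TW.group_V linear_mapsD(1)[OF f]])
  have ker: "(\<lambda>x. \<zero>\<^bsub>V\<^esub>) ` carrier V = {x \<in> carrier V. f x = \<zero>\<^bsub>W\<^esub>}"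
    using f0 inj_onD[OF inj] by (auto intro!: image_eqI[of _ _ "\<zero>\<^bsub>V\<^esub>"])
  show ?thesis
  proof (rule additive_maps_inj_onI[OF TV.group_T TW.group_T tensor_map_additive[OF M V W f]])
    fix z assume z: "z \<in> carrier (tensor R M V)" "tensor_map R M W f z = \<zero>\<^bsub>tensor R M W\<^esub>"
    show "z = \<zero>\<^bsub>tensor R M V\<^esub>"
      using flat_kernel[OF ff V V W e(1) e zero_linear[OF V] f ker z] tensor_map_zero[OF M V V]
      by auto
  qed
qed

text \<open>Surjectivity of \<open>f\<close> is exactness of \<open>f\<close> followed by \<open>0 : W \<rightarrow> W\<close>.\<close>

lemma flat_surj:
  fixes e1 :: "'v \<Rightarrow> 'u" and e2 :: "'w \<Rightarrow> 'u"
  assumes ff: "right_faithfully_flat TYPE('u) R M"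
    and V: "left_module R V" and W: "left_module R W"
    and e: "inj_on e1 (carrier V)" "inj_on e2 (carrier W)"
    and f: "f \<in> linear_maps R V W"
    and surj: "\<And>m w. m \<in> carrier M \<Longrightarrow> w \<in> carrier W \<Longrightarrow>
      pure_tensor R M W m w \<in> tensor_map R M W f ` carrier (tensor R M V)"
  shows "f ` carrier V = carrier W"
proof -
  have M: "right_module R M" using ff by (simp add: right_faithfully_flat_def)
  interpret TV: tensor_pair R M V "tensor R M V" by (rule tensor_pair_modules[OF M V])
  interpret TW: tensor_pair R M W "tensor R M W" by (rule tensor_pair_modules[OF M W])
  interpret T: abelian_group "tensor R M V" by (rule TV.group_T)
  note add = tensor_map_additive[OF M V W f]
  have "z \<in> tensor_map R M W f ` carrier (tensor R M V)" if "z \<in> carrier (tensor R M W)" for z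
    using that
  proof (induction rule: TW.tensor_induct)
    case (add x y)
    then obtain x' y' where "x' \<in> carrier (tensor R M V)" "x = tensor_map R M W f x'"
      "y' \<in> carrier (tensor R M V)" "y = tensor_map R M W f y'" by auto
    then show ?case
      by (intro image_eqI[of _ _ "x' \<oplus>\<^bsub>tensor R M V\<^esub> y'"])
        (simp_all add: additive_maps_add[OF tensor_map_additive[OF M V W f]])
  qed (rule surj)
  then have "exact_at (tensor R M V) (tensor_map R M W f) (tensor R M W)
      (tensor_map R M W (\<lambda>x. \<zero>\<^bsub>W\<^esub>)) (tensor R M W)"
    using additive_maps_closed[OF add] tensor_map_zero[OF M W W] by (auto simp: exact_at_def)
  then have "exact_at V f W (\<lambda>x. \<zero>\<^bsub>W\<^esub>) W"
    using flat_exact_iff[OF ff V W W e e(2) f zero_linear[OF W]] by blast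
  then show ?thesis by (simp add: exact_at_def)
qed

text \<open>The elements \<open>x\<close> with \<open>m \<otimes> x = 0\<close> for all \<open>m\<close> form a submodule \<open>K\<close> whose inclusion into \<open>V\<close> becomes zero
after tensoring. So \<open>K \<rightarrow> V\<close> followed by the identity of \<open>V\<close> becomes exact, hence it was exact, and \<open>K\<close>
is zero.\<close>

lemma flat_zero:
  fixes e :: "'v \<Rightarrow> 'u"
  assumes ff: "right_faithfully_flat TYPE('u) R M"
    and V: "left_module R V" and e: "inj_on e (carrier V)"
    and v: "v \<in> carrier V"
    and zero: "\<And>m. m \<in> carrier M \<Longrightarrow> pure_tensor R M V m v = \<zero>\<^bsub>tensor R M V\<^esub>"
  shows "v = \<zero>\<^bsub>V\<^esub>"
proof -
  have M: "right_module R M" using ff by (simp add: right_faithfully_flat_def)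
  interpret V: left_module R V by fact
  interpret TV: tensor_pair R M V "tensor R M V" by (rule tensor_pair_modules[OF M V])
  interpret T: abelian_group "tensor R M V" by (rule TV.group_T)
  define K where "K = {x \<in> carrier V. \<forall>m\<in>carrier M. pure_tensor R M V m x = \<zero>\<^bsub>tensor R M V\<^esub>}"
  have K_V: "x \<in> carrier V" if "x \<in> K" for x using that by (simp add: K_def)
  have K0: "\<zero>\<^bsub>V\<^esub> \<in> K"
    using additive_maps_zero[OF TV.group_V TV.group_T balanced_additive_right[OF TV.balanced_pure]]
    by (auto simp: K_def)
  have Kadd: "x \<oplus>\<^bsub>V\<^esub> y \<in> K" if "x \<in> K" "y \<in> K" for x y
    using that by (auto simp: K_def TV.pure_add_right)
  have Kneg: "\<ominus>\<^bsub>V\<^esub> x \<in> K" if "x \<in> K" for x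
  proof -
    have "\<ominus>\<^bsub>tensor R M V\<^esub> \<zero>\<^bsub>tensor R M V\<^esub> = \<zero>\<^bsub>tensor R M V\<^esub>"
      by (metis T.r_neg T.l_zero T.a_inv_closed T.zero_closed)
    then show ?thesis
      using that additive_maps_uminus[OF TV.group_V TV.group_T balanced_additive_right[OF TV.balanced_pure]]
      by (auto simp: K_def)
  qed
  have Ksmult: "r \<odot>\<^bsub>V\<^esub> x \<in> K" if "r \<in> carrier R" "x \<in> K" for r x
    using that V.smult_closed TV.act_M by (auto simp: K_def TV.pure_smult[symmetric])
  let ?W = "V\<lparr>carrier := K\<rparr>"
  have "abelian_group ?W"
  proof (rule abelian_groupI)
    fix x assume "x \<in> carrier ?W"
    then show "\<exists>y\<in>carrier ?W. y \<oplus>\<^bsub>?W\<^esub> x = \<zero>\<^bsub>?W\<^esub>"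
      using Kneg[of x] K_V[of x] V.M.l_neg[of x] by auto
  qed (use K0 Kadd K_V V.M.a_ac V.M.l_zero in auto)
  then have W: "left_module R ?W"
    by (rule left_module.intro[OF V.R.ring_axioms])
      (unfold_locales, auto simp: Ksmult K_V V.smult_l_distr V.smult_r_distr V.smult_assoc V.smult_one)
  have i: "(\<lambda>x. x) \<in> linear_maps R ?W V" "(\<lambda>x. x) \<in> linear_maps R V V"
    by (auto simp: linear_maps_def additive_maps_def K_V)
  have e': "inj_on e (carrier ?W)"
    using e by (rule inj_on_subset) (auto simp: K_V)
  interpret TW: tensor_pair R M ?W "tensor R M ?W" by (rule tensor_pair_modules[OF M W])
  have 0: "tensor_map R M V (\<lambda>x. x) z = \<zero>\<^bsub>tensor R M V\<^esub>" if "z \<in> carrier (tensor R M ?W)" for z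
    by (rule TW.additive_maps_eqI[OF tensor_map_additive[OF M W V i(1)] additive_maps_zero_map[OF TV.group_T] _ that])
      (use tensor_map_pure[OF M W V i(1)] in \<open>simp add: K_def\<close>)
  have ne: "\<zero>\<^bsub>tensor R M ?W\<^esub> \<in> carrier (tensor R M ?W)"
    by (rule abelian_monoid.zero_closed[OF abelian_group.axioms(1)[OF TW.group_T]])
  have "exact_at (tensor R M ?W) (tensor_map R M V (\<lambda>x. x)) (tensor R M V)
      (tensor_map R M V (\<lambda>x. x)) (tensor R M V)"
    using tensor_map_id[OF M V, of "\<lambda>x. x"] 0 ne by (auto simp: exact_at_def image_iff)
  then have "exact_at ?W (\<lambda>x. x) V (\<lambda>x. x) V"
    using flat_exact_iff[OF ff W V V e' e e i] by blast
  then have "K = {\<zero>\<^bsub>V\<^esub>}" by (auto simp: exact_at_def)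
  moreover have "v \<in> K" using v zero by (simp add: K_def)
  ultimately show ?thesis by simp
qed

section \<open>Bialgebroids and rings over the base\<close>

lemma left_mult_simps [simp]:
  "carrier (left_mult A f) = carrier A" "ring.add (left_mult A f) = ring.add A"
  "ring.zero (left_mult A f) = ring.zero A" "r \<odot>\<^bsub>left_mult A f\<^esub> x = f r \<otimes>\<^bsub>A\<^esub> x"
  by (simp_all add: left_mult_def)

lemma right_mult_simps [simp]:
  "carrier (right_mult A f) = carrier A" "ring.add (right_mult A f) = ring.add A"
  "ring.zero (right_mult A f) = ring.zero A" "r \<odot>\<^bsub>right_mult A f\<^esub> x = x \<otimes>\<^bsub>A\<^esub> f r"
  by (simp_all add: right_mult_def)

lemma ring_bimodule_simps [simp]:
  "carrier (ring_bimodule A f) = carrier A" "ring.add (ring_bimodule A f) = ring.add A"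
  "ring.zero (ring_bimodule A f) = ring.zero A" "r \<odot>\<^bsub>ring_bimodule A f\<^esub> x = f r \<otimes>\<^bsub>A\<^esub> x"
  "rsmult (ring_bimodule A f) x r = x \<otimes>\<^bsub>A\<^esub> f r"
  by (simp_all add: ring_bimodule_def)

lemma abelian_group_cong:
  assumes "abelian_group G" "carrier G' = carrier G" "ring.add G' = ring.add G" "ring.zero G' = ring.zero G"
  shows "abelian_group G'"
proof -
  interpret abelian_group G by fact
  show ?thesis
    by (rule abelian_groupI) (use assms(2-4) l_neg in \<open>auto simp: a_ac\<close>)
qed

lemma abelian_group_left_mult: "ring A \<Longrightarrow> abelian_group (left_mult A f)"
  and abelian_group_right_mult: "ring A \<Longrightarrow> abelian_group (right_mult A f)"
  and abelian_group_ring_bimodule: "ring A \<Longrightarrow> abelian_group (ring_bimodule A f)"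
  by (rule abelian_group_cong[OF ring.is_abelian_group]; simp)+

locale bialg =
  fixes K :: "('k, 'x) ring_scheme" and B :: "('k, 'b, 'y) module_scheme"
    and L :: "('k, 'b, 'l, 'z) bialgebroid_scheme"
  assumes bialgebroid: "left_bialgebroid K B L"
begin

abbreviation "s \<equiv> src L"
abbreviation "t \<equiv> tgt L"
abbreviation "\<Delta> \<equiv> comult L"
abbreviation "\<epsilon> \<equiv> counit L"
abbreviation mult_L (infixl "\<cdot>" 70) where "x \<cdot> y \<equiv> x \<otimes>\<^bsub>L\<^esub> y"
abbreviation "LM \<equiv> left_mult L (tgt L)"

lemma ring_B: "ring B" and ring_L: "ring L"
  using bialgebroid by (auto simp: left_bialgebroid_def Let_def k_algebra_def)

sublocale B: ring B by (rule ring_B)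
sublocale L: ring L by (rule ring_L)

lemma s_hom: "s \<in> ring_hom B L" and t_hom: "t \<in> ring_hom (opp B) L"
  using bialgebroid by (auto simp: left_bialgebroid_def Let_def alg_hom_def)

lemma s_simps [simp]:
  "b \<in> carrier B \<Longrightarrow> s b \<in> carrier L" "s \<one>\<^bsub>B\<^esub> = \<one>\<^bsub>L\<^esub>"
  "b \<in> carrier B \<Longrightarrow> c \<in> carrier B \<Longrightarrow> s (b \<oplus>\<^bsub>B\<^esub> c) = s b \<oplus>\<^bsub>L\<^esub> s c"
  "b \<in> carrier B \<Longrightarrow> c \<in> carrier B \<Longrightarrow> s (b \<otimes>\<^bsub>B\<^esub> c) = s b \<cdot> s c"
  using s_hom by (auto simp: ring_hom_def)

lemma t_simps [simp]:
  "b \<in> carrier B \<Longrightarrow> t b \<in> carrier L" "t \<one>\<^bsub>B\<^esub> = \<one>\<^bsub>L\<^esub>"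
  "b \<in> carrier B \<Longrightarrow> c \<in> carrier B \<Longrightarrow> t (b \<oplus>\<^bsub>B\<^esub> c) = t b \<oplus>\<^bsub>L\<^esub> t c"
  "b \<in> carrier B \<Longrightarrow> c \<in> carrier B \<Longrightarrow> t (b \<otimes>\<^bsub>B\<^esub> c) = t c \<cdot> t b"
  using t_hom by (auto simp: ring_hom_def)

lemma s_t_commute: "b \<in> carrier B \<Longrightarrow> c \<in> carrier B \<Longrightarrow> s b \<cdot> t c = t c \<cdot> s b"
  using bialgebroid by (auto simp: left_bialgebroid_def Let_def)

lemma s_t_commute_left:
  "b \<in> carrier B \<Longrightarrow> c \<in> carrier B \<Longrightarrow> x \<in> carrier L \<Longrightarrow> s b \<cdot> (t c \<cdot> x) = t c \<cdot> (s b \<cdot> x)"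
  by (simp add: L.m_assoc[symmetric] s_t_commute)

lemma diamond_pair:
  assumes "abelian_group M"
    and "\<And>b m. b \<in> carrier B \<Longrightarrow> m \<in> carrier M \<Longrightarrow> b \<odot>\<^bsub>M\<^esub> m \<in> carrier M"
  shows "tensor_pair B LM M (diamond B L M)"
  by (rule tensor_pair.intro)
    (use assms abelian_group_left_mult[OF ring_L] in \<open>auto simp: diamond_def Let_def\<close>)

lemma
  assumes M: "abelian_group M"
    and act: "\<And>b m. b \<in> carrier B \<Longrightarrow> m \<in> carrier M \<Longrightarrow> b \<odot>\<^bsub>M\<^esub> m \<in> carrier M"
    and b: "b \<in> carrier B"
  shows diamond_smult_additive: "(\<lambda>z. b \<odot>\<^bsub>diamond B L M\<^esub> z) \<in> additive_maps (diamond B L M) (diamond B L M)"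
    and diamond_smult_pure: "\<And>x m. x \<in> carrier L \<Longrightarrow> m \<in> carrier M \<Longrightarrow>
      b \<odot>\<^bsub>diamond B L M\<^esub> diamond_pure B L M x m = diamond_pure B L M (s b \<cdot> x) m"
proof -
  interpret tensor_pair B LM M "diamond B L M" by (rule diamond_pair[OF M act])
  interpret T: tensor_pair B LM M "tensor B LM M"
    by (rule tensor_pair_tensor) (use M act abelian_group_left_mult[OF ring_L] in auto)
  have bal: "balanced B LM M (tensor B LM M) (\<lambda>x m. diamond_pure B L M (s b \<cdot> x) m)"
    by (rule balancedI)
      (use T.pure_in_T T.pure_add_left T.pure_add_right T.pure_smult b act in
        \<open>auto simp: L.r_distr s_t_commute_left\<close>)
  have sm: "b \<odot>\<^bsub>diamond B L M\<^esub> z = tensor_lift (tensor B LM M) (\<lambda>x m. diamond_pure B L M (s b \<cdot> x) m) z" for z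
    by (simp add: diamond_def Let_def)
  show "(\<lambda>z. b \<odot>\<^bsub>diamond B L M\<^esub> z) \<in> additive_maps (diamond B L M) (diamond B L M)"
    unfolding sm using T.tensor_lift_additive[OF T.group_T bal]
    by (simp add: additive_maps_def diamond_def Let_def)
  show "b \<odot>\<^bsub>diamond B L M\<^esub> diamond_pure B L M x m = diamond_pure B L M (s b \<cdot> x) m"
    if "x \<in> carrier L" "m \<in> carrier M" for x m
    unfolding sm using that by (simp add: T.tensor_lift_pure[OF T.group_T bal])
qed

end

text \<open>The pair \<open>(A, f)\<close> is either \<open>L\<close> with its source map or a comodule algebra with its base map, so that
\<open>L \<diamondop> L\<close> and \<open>L \<diamondop> P\<close> share all lemmas.\<close>

locale B_ring = bialg K B L
  for K :: "('k, 'x) ring_scheme" and B :: "('k, 'b, 'y) module_scheme"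
    and L :: "('k, 'b, 'l, 'z) bialgebroid_scheme" +
  fixes A :: "('a, 'w) ring_scheme" and f :: "'b \<Rightarrow> 'a"
  assumes ring_A: "ring A" and f_hom: "f \<in> ring_hom B A"
begin

abbreviation "A' \<equiv> ring_bimodule A f"
abbreviation "D \<equiv> diamond B L A'"
abbreviation "DD \<equiv> diamond B L D"
abbreviation dia (infixr "\<diamondop>" 68) where "x \<diamondop> a \<equiv> diamond_pure B L A' x a"
abbreviation ddia (infixr "\<diamondop>\<diamondop>" 68) where "x \<diamondop>\<diamondop> a \<equiv> diamond_pure B L D x a"

sublocale A: ring A by (rule ring_A)

lemma f_simps [simp]:
  "b \<in> carrier B \<Longrightarrow> f b \<in> carrier A" "f \<one>\<^bsub>B\<^esub> = \<one>\<^bsub>A\<^esub>"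
  "b \<in> carrier B \<Longrightarrow> c \<in> carrier B \<Longrightarrow> f (b \<oplus>\<^bsub>B\<^esub> c) = f b \<oplus>\<^bsub>A\<^esub> f c"
  "b \<in> carrier B \<Longrightarrow> c \<in> carrier B \<Longrightarrow> f (b \<otimes>\<^bsub>B\<^esub> c) = f b \<otimes>\<^bsub>A\<^esub> f c"
  using f_hom by (auto simp: ring_hom_def)

sublocale D: tensor_pair B "left_mult L (tgt L)" "ring_bimodule A f" "diamond B L (ring_bimodule A f)"
  by (rule diamond_pair) (auto intro: abelian_group_ring_bimodule[OF ring_A])

lemmas D_smult_additive = diamond_smult_additive[OF abelian_group_ring_bimodule[OF ring_A, of f]]

lemma D_smult_pure [simp]:
  "b \<in> carrier B \<Longrightarrow> x \<in> carrier L \<Longrightarrow> a \<in> carrier A \<Longrightarrow> b \<odot>\<^bsub>D\<^esub> (x \<diamondop> a) = s b \<cdot> x \<diamondop> a"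
  by (rule diamond_smult_pure[OF abelian_group_ring_bimodule[OF ring_A]]) auto

lemma D_smult_closed [simp]: "b \<in> carrier B \<Longrightarrow> z \<in> carrier D \<Longrightarrow> b \<odot>\<^bsub>D\<^esub> z \<in> carrier D"
  by (rule additive_maps_closed[OF D_smult_additive]) auto

sublocale DD: tensor_pair B "left_mult L (tgt L)" "diamond B L (ring_bimodule A f)"
    "diamond B L (diamond B L (ring_bimodule A f))"
  by (rule diamond_pair[OF D.group_T D_smult_closed])

lemma dia_closed [simp]:
  "x \<in> carrier L \<Longrightarrow> a \<in> carrier A \<Longrightarrow> x \<diamondop> a \<in> carrier D"
  using D.pure_in_T by simp

lemma dia_add_left: "x \<in> carrier L \<Longrightarrow> y \<in> carrier L \<Longrightarrow> a \<in> carrier A \<Longrightarrow> (x \<oplus>\<^bsub>L\<^esub> y) \<diamondop> a = x \<diamondop> a \<oplus>\<^bsub>D\<^esub> y \<diamondop> a"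
  using D.pure_add_left[of x y a] by simp

lemma dia_add_right: "x \<in> carrier L \<Longrightarrow> a \<in> carrier A \<Longrightarrow> c \<in> carrier A \<Longrightarrow> x \<diamondop> (a \<oplus>\<^bsub>A\<^esub> c) = x \<diamondop> a \<oplus>\<^bsub>D\<^esub> x \<diamondop> c"
  using D.pure_add_right[of x a c] by simp

lemma dia_balanced: "b \<in> carrier B \<Longrightarrow> x \<in> carrier L \<Longrightarrow> a \<in> carrier A \<Longrightarrow> t b \<cdot> x \<diamondop> a = x \<diamondop> f b \<otimes>\<^bsub>A\<^esub> a"
  using D.pure_smult[of b x a] by simp

lemma ddia_closed [simp]: "x \<in> carrier L \<Longrightarrow> z \<in> carrier D \<Longrightarrow> x \<diamondop>\<diamondop> z \<in> carrier DD"
  using DD.pure_in_T by simp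

lemma ddia_add_left: "x \<in> carrier L \<Longrightarrow> y \<in> carrier L \<Longrightarrow> a \<in> carrier D \<Longrightarrow> (x \<oplus>\<^bsub>L\<^esub> y) \<diamondop>\<diamondop> a = x \<diamondop>\<diamondop> a \<oplus>\<^bsub>DD\<^esub> y \<diamondop>\<diamondop> a"
  using DD.pure_add_left[of x y a] by simp

lemma ddia_add_right: "x \<in> carrier L \<Longrightarrow> a \<in> carrier D \<Longrightarrow> c \<in> carrier D \<Longrightarrow> x \<diamondop>\<diamondop> (a \<oplus>\<^bsub>D\<^esub> c) = x \<diamondop>\<diamondop> a \<oplus>\<^bsub>DD\<^esub> x \<diamondop>\<diamondop> c"
  using DD.pure_add_right[of x a c] by simp

lemma ddia_balanced: "b \<in> carrier B \<Longrightarrow> x \<in> carrier L \<Longrightarrow> a \<in> carrier D \<Longrightarrow> t b \<cdot> x \<diamondop>\<diamondop> a = x \<diamondop>\<diamondop> b \<odot>\<^bsub>D\<^esub> a"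
  using DD.pure_smult[of b x a] by simp

abbreviation bal where "bal G F \<equiv> balanced B (left_mult L (tgt L)) (ring_bimodule A f) G F"

lemma balI:
  assumes "\<And>x a. x \<in> carrier L \<Longrightarrow> a \<in> carrier A \<Longrightarrow> F x a \<in> carrier G"
    and "\<And>x y a. x \<in> carrier L \<Longrightarrow> y \<in> carrier L \<Longrightarrow> a \<in> carrier A \<Longrightarrow> F (x \<oplus>\<^bsub>L\<^esub> y) a = F x a \<oplus>\<^bsub>G\<^esub> F y a"
    and "\<And>x a c. x \<in> carrier L \<Longrightarrow> a \<in> carrier A \<Longrightarrow> c \<in> carrier A \<Longrightarrow> F x (a \<oplus>\<^bsub>A\<^esub> c) = F x a \<oplus>\<^bsub>G\<^esub> F x c"
    and "\<And>b x a. b \<in> carrier B \<Longrightarrow> x \<in> carrier L \<Longrightarrow> a \<in> carrier A \<Longrightarrow> F (t b \<cdot> x) a = F x (f b \<otimes>\<^bsub>A\<^esub> a)"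
  shows "bal G F"
  by (rule balancedI) (use assms in auto)

lemma balD:
  assumes "bal G F"
  shows "\<And>x a. x \<in> carrier L \<Longrightarrow> a \<in> carrier A \<Longrightarrow> F x a \<in> carrier G"
    and "\<And>x y a. x \<in> carrier L \<Longrightarrow> y \<in> carrier L \<Longrightarrow> a \<in> carrier A \<Longrightarrow> F (x \<oplus>\<^bsub>L\<^esub> y) a = F x a \<oplus>\<^bsub>G\<^esub> F y a"
    and "\<And>x a c. x \<in> carrier L \<Longrightarrow> a \<in> carrier A \<Longrightarrow> c \<in> carrier A \<Longrightarrow> F x (a \<oplus>\<^bsub>A\<^esub> c) = F x a \<oplus>\<^bsub>G\<^esub> F x c"
    and "\<And>b x a. b \<in> carrier B \<Longrightarrow> x \<in> carrier L \<Longrightarrow> a \<in> carrier A \<Longrightarrow> F (t b \<cdot> x) a = F x (f b \<otimes>\<^bsub>A\<^esub> a)"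
  using balancedD[OF assms] by auto

lemma lift_dia:
  "abelian_group G \<Longrightarrow> bal G F \<Longrightarrow> x \<in> carrier L \<Longrightarrow> a \<in> carrier A \<Longrightarrow> tensor_lift G F (x \<diamondop> a) = F x a"
  using D.tensor_lift_pure[of G F x a] by simp

lemma bal_mult_right:
  "y \<in> carrier L \<Longrightarrow> c \<in> carrier A \<Longrightarrow> bal D (\<lambda>x a. x \<cdot> y \<diamondop> a \<otimes>\<^bsub>A\<^esub> c)"
  by (rule balI)
    (auto simp: L.l_distr A.l_distr dia_add_left dia_add_right L.m_assoc A.m_assoc dia_balanced)

lemma takeuchi_carrier: "z \<in> takeuchi B L A' \<Longrightarrow> z \<in> carrier D"
  by (simp add: takeuchi_def)

lemma bal_left_right_shift:
  assumes "b \<in> carrier B"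
  shows "bal D (\<lambda>x a. x \<cdot> t b \<diamondop> a)" "bal D (\<lambda>x a. x \<diamondop> a \<otimes>\<^bsub>A\<^esub> f b)"
  using bal_mult_right[of "t b" "\<one>\<^bsub>A\<^esub>"] bal_mult_right[of "\<one>\<^bsub>L\<^esub>" "f b"] assms
    dia_add_left dia_add_right dia_balanced
  by (auto intro!: balI simp: L.l_distr A.l_distr dia_add_left dia_add_right L.m_assoc A.m_assoc dia_balanced)

text \<open>The Takeuchi condition in Sweedler form: \<open>F (x\<^sub>i b') a\<^sub>i = F x\<^sub>i (a\<^sub>i b)\<close> after summation, where \<open>b'\<close> is the
image of \<open>b\<close> under the target map.\<close>

lemma takeuchi_shift:
  assumes G: "abelian_group G" and F: "bal G F" and z: "z \<in> takeuchi B L A'" and b: "b \<in> carrier B"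
  shows "tensor_lift G (\<lambda>x a. F (x \<cdot> t b) a) z = tensor_lift G (\<lambda>x a. F x (a \<otimes>\<^bsub>A\<^esub> f b)) z"
proof -
  note zc = takeuchi_carrier[OF z] and l = D.tensor_lift_additive[OF G F]
  have "tensor_lift D (\<lambda>x a. x \<cdot> t b \<diamondop> a) z = tensor_lift D (\<lambda>x a. x \<diamondop> a \<otimes>\<^bsub>A\<^esub> f b) z"
    using z b by (simp add: takeuchi_def)
  moreover have "tensor_lift G F (tensor_lift D (\<lambda>x a. x \<cdot> t b \<diamondop> a) z) = tensor_lift G (\<lambda>x a. F (x \<cdot> t b) a) z"
    by (rule D.tensor_lift_comp_eq[OF D.group_T G bal_left_right_shift(1)[OF b] l zc])
      (use b in \<open>simp add: lift_dia[OF G F]\<close>)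
  moreover have "tensor_lift G F (tensor_lift D (\<lambda>x a. x \<diamondop> a \<otimes>\<^bsub>A\<^esub> f b) z)
      = tensor_lift G (\<lambda>x a. F x (a \<otimes>\<^bsub>A\<^esub> f b)) z"
    by (rule D.tensor_lift_comp_eq[OF D.group_T G bal_left_right_shift(2)[OF b] l zc])
      (use b in \<open>simp add: lift_dia[OF G F]\<close>)
  ultimately show ?thesis by simp
qed

definition mult_by :: "('l \<times> 'a \<Rightarrow>\<^sub>0 int) set \<Rightarrow> 'l \<Rightarrow> 'a \<Rightarrow> ('l \<times> 'a \<Rightarrow>\<^sub>0 int) set" where
  "mult_by z y c = tensor_lift D (\<lambda>x a. x \<cdot> y \<diamondop> a \<otimes>\<^bsub>A\<^esub> c) z"

lemma mult_by_dia [simp]: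
  "x \<in> carrier L \<Longrightarrow> a \<in> carrier A \<Longrightarrow> y \<in> carrier L \<Longrightarrow> c \<in> carrier A \<Longrightarrow>
    mult_by (x \<diamondop> a) y c = x \<cdot> y \<diamondop> a \<otimes>\<^bsub>A\<^esub> c"
  by (simp add: mult_by_def lift_dia[OF D.group_T bal_mult_right])

lemma mult_by_additive: "y \<in> carrier L \<Longrightarrow> c \<in> carrier A \<Longrightarrow> (\<lambda>z. mult_by z y c) \<in> additive_maps D D"
  unfolding mult_by_def by (rule D.tensor_lift_additive[OF D.group_T bal_mult_right])

lemma mult_by_closed [simp]:
  "z \<in> carrier D \<Longrightarrow> y \<in> carrier L \<Longrightarrow> c \<in> carrier A \<Longrightarrow> mult_by z y c \<in> carrier D"
  by (rule additive_maps_closed[OF mult_by_additive])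

text \<open>The Takeuchi condition makes the componentwise product well defined in its right factor.\<close>

lemma bal_mult_by:
  assumes z: "z \<in> takeuchi B L A'"
  shows "bal D (mult_by z)"
proof (rule balI)
  note zc = takeuchi_carrier[OF z]
  fix x y a c assume h: "x \<in> carrier L" "y \<in> carrier L" "a \<in> carrier A" "c \<in> carrier A"
  show "mult_by z x a \<in> carrier D" using h zc by simp
  show "mult_by z (x \<oplus>\<^bsub>L\<^esub> y) a = mult_by z x a \<oplus>\<^bsub>D\<^esub> mult_by z y a"
    by (rule D.additive_maps_eqI[OF _ _ _ zc], rule mult_by_additive, use h in simp, use h in simp,
        rule additive_maps_plus[OF D.group_T mult_by_additive mult_by_additive])
      (use h in \<open>simp_all add: L.r_distr dia_add_left\<close>)
  show "mult_by z x (a \<oplus>\<^bsub>A\<^esub> c) = mult_by z x a \<oplus>\<^bsub>D\<^esub> mult_by z x c"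
    by (rule D.additive_maps_eqI[OF _ _ _ zc], rule mult_by_additive, use h in simp, use h in simp,
        rule additive_maps_plus[OF D.group_T mult_by_additive mult_by_additive])
      (use h in \<open>simp_all add: A.r_distr dia_add_right\<close>)
next
  note zc = takeuchi_carrier[OF z]
  fix b x a assume h: "b \<in> carrier B" "x \<in> carrier L" "a \<in> carrier A"
  have "mult_by z (t b \<cdot> x) a = tensor_lift D (\<lambda>y c. (y \<cdot> t b) \<cdot> x \<diamondop> c \<otimes>\<^bsub>A\<^esub> a) z"
    unfolding mult_by_def
    by (rule D.tensor_lift_cong[OF D.group_T bal_mult_right _ zc]) (use h in \<open>simp_all add: L.m_assoc\<close>)
  also have "\<dots> = tensor_lift D (\<lambda>y c. y \<cdot> x \<diamondop> (c \<otimes>\<^bsub>A\<^esub> f b) \<otimes>\<^bsub>A\<^esub> a) z"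
    by (rule takeuchi_shift[OF D.group_T bal_mult_right z]) (use h in simp_all)
  also have "\<dots> = mult_by z x (f b \<otimes>\<^bsub>A\<^esub> a)"
    unfolding mult_by_def
    by (rule sym, rule D.tensor_lift_cong[OF D.group_T bal_mult_right _ zc]) (use h in \<open>simp_all add: A.m_assoc\<close>)
  finally show "mult_by z (t b \<cdot> x) a = mult_by z x (f b \<otimes>\<^bsub>A\<^esub> a)" .
qed

lemma takeuchi_mult_eq: "takeuchi_mult B L A f z w = tensor_lift D (mult_by z) w"
  by (simp add: takeuchi_mult_def mult_by_def[abs_def] Let_def)

lemma takeuchi_mult_pure:
  "z \<in> takeuchi B L A' \<Longrightarrow> y \<in> carrier L \<Longrightarrow> c \<in> carrier A \<Longrightarrow>
    takeuchi_mult B L A f z (y \<diamondop> c) = mult_by z y c"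
  by (simp add: takeuchi_mult_eq lift_dia[OF D.group_T bal_mult_by])

lemma mult_by_smult:
  assumes "b \<in> carrier B" "z \<in> carrier D" "y \<in> carrier L" "c \<in> carrier A"
  shows "mult_by (b \<odot>\<^bsub>D\<^esub> z) y c = b \<odot>\<^bsub>D\<^esub> mult_by z y c"
  by (rule D.additive_maps_eqI[OF additive_maps_comp[OF D_smult_additive mult_by_additive]
        additive_maps_comp[OF mult_by_additive D_smult_additive]])
    (use assms in \<open>auto simp: L.m_assoc\<close>)

end

section \<open>Coactions and coassociativity\<close>

context B_ring begin

lemma bal_smult:
  assumes F: "bal G F" and b: "b \<in> carrier B"
  shows "bal G (\<lambda>x a. F (s b \<cdot> x) a)"
  by (rule balI) (use balD[OF F] b in \<open>simp_all add: L.r_distr s_t_commute_left\<close>)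

lemma lift_smult:
  assumes G: "abelian_group G" and F: "bal G F" and z: "z \<in> carrier D" and b: "b \<in> carrier B"
  shows "tensor_lift G F (b \<odot>\<^bsub>D\<^esub> z) = tensor_lift G (\<lambda>x a. F (s b \<cdot> x) a) z"
proof (rule D.additive_maps_eqI[OF _ D.tensor_lift_additive[OF G bal_smult[OF F b]] _ z])
  show "(\<lambda>z. tensor_lift G F (b \<odot>\<^bsub>D\<^esub> z)) \<in> additive_maps D G"
    by (rule additive_maps_comp[OF D_smult_additive D.tensor_lift_additive[OF G F]]) (use b in auto)
qed (use b in \<open>simp add: lift_dia[OF G F] lift_dia[OF G bal_smult[OF F b]]\<close>)

text \<open>These are the functions that induce maps on \<open>L \<diamondop> (L \<diamondop> A)\<close>.\<close>

definition trilinear :: "('c, 'u) ring_scheme \<Rightarrow> ('l \<Rightarrow> 'l \<Rightarrow> 'a \<Rightarrow> 'c) \<Rightarrow> bool" where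
  "trilinear G F \<longleftrightarrow>
     (\<forall>x\<in>carrier L. bal G (F x)) \<and>
     (\<forall>y\<in>carrier L. \<forall>a\<in>carrier A. (\<lambda>x. F x y a) \<in> additive_maps L G) \<and>
     (\<forall>b\<in>carrier B. \<forall>x\<in>carrier L. \<forall>y\<in>carrier L. \<forall>a\<in>carrier A. F (t b \<cdot> x) y a = F x (s b \<cdot> y) a)"

lemma trilinear_bal: "trilinear G F \<Longrightarrow> x \<in> carrier L \<Longrightarrow> bal G (F x)"
  by (simp add: trilinear_def)

lemma trilinear_outer:
  assumes G: "abelian_group G" and F: "trilinear G F"
  shows "balanced B LM D G (\<lambda>x. tensor_lift G (F x))"
proof (rule balancedI_additive)
  show "tensor_lift G (F x) \<in> additive_maps D G" if "x \<in> carrier LM" for x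
    using that by (intro D.tensor_lift_additive[OF G trilinear_bal[OF F]]) auto
  show "(\<lambda>x. tensor_lift G (F x) z) \<in> additive_maps LM G" if "z \<in> carrier D" for z
    using F D.tensor_lift_param[OF G, of L F z] that
    by (auto simp: trilinear_def additive_maps_def)
  fix b x z assume h: "b \<in> carrier B" "x \<in> carrier LM" "z \<in> carrier D"
  have "tensor_lift G (F (t b \<cdot> x)) z = tensor_lift G (\<lambda>y. F x (s b \<cdot> y)) z"
    by (rule D.tensor_lift_cong[OF G _ _ h(3)]) (use F h in \<open>auto simp: trilinear_def\<close>)
  also have "\<dots> = tensor_lift G (F x) (b \<odot>\<^bsub>D\<^esub> z)"
    using lift_smult[OF G trilinear_bal[OF F] h(3,1), of x] h by simp
  finally show "tensor_lift G (F (b \<odot>\<^bsub>LM\<^esub> x)) z = tensor_lift G (F x) (b \<odot>\<^bsub>D\<^esub> z)" by simp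
qed

lemma trilinear_pure: "trilinear DD (\<lambda>x y a. x \<diamondop>\<diamondop> (y \<diamondop> a))"
  unfolding trilinear_def
  by (auto intro!: balI additive_mapsI simp: dia_add_left dia_add_right ddia_add_left ddia_add_right
      ddia_balanced dia_balanced)

end

sublocale bialg \<subseteq> LL: B_ring K B L L "src L"
  by unfold_locales (rule ring_L s_hom)+

context bialg begin

lemma comult_takeuchi: "x \<in> carrier L \<Longrightarrow> \<Delta> x \<in> takeuchi B L LL.A'"
  and comult_additive: "\<Delta> \<in> additive_maps L LL.D"
  and comult_mult: "x \<in> carrier L \<Longrightarrow> y \<in> carrier L \<Longrightarrow> \<Delta> (x \<cdot> y) = takeuchi_mult B L L s (\<Delta> x) (\<Delta> y)"
  and comult_one: "\<Delta> \<one>\<^bsub>L\<^esub> = LL.dia \<one>\<^bsub>L\<^esub> \<one>\<^bsub>L\<^esub>"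
  and comult_coassoc: "coassociative B L LL.A' \<Delta>"
  using bialgebroid by (auto simp: left_bialgebroid_def Let_def)

lemma comult_closed [simp]: "x \<in> carrier L \<Longrightarrow> \<Delta> x \<in> carrier LL.D"
  by (rule additive_maps_closed[OF comult_additive])

lemma comult_s_t:
  "b \<in> carrier B \<Longrightarrow> c \<in> carrier B \<Longrightarrow> x \<in> carrier L \<Longrightarrow>
    \<Delta> (s b \<cdot> t c \<cdot> x) = tensor_lift LL.D (\<lambda>x1 x2. LL.dia (s b \<cdot> x1) (t c \<cdot> x2)) (\<Delta> x)"
  using bialgebroid by (auto simp: left_bialgebroid_def Let_def)

lemma bal_s_t:
  assumes "b \<in> carrier B" "c \<in> carrier B"
  shows "LL.bal LL.D (\<lambda>x1 x2. LL.dia (s b \<cdot> x1) (t c \<cdot> x2))"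
  by (rule LL.balI)
    (use assms in \<open>simp_all add: L.r_distr LL.dia_add_left LL.dia_add_right s_t_commute_left LL.dia_balanced\<close>)

lemma bal_t:
  assumes "c \<in> carrier B"
  shows "LL.bal LL.D (\<lambda>x1 x2. LL.dia x1 (t c \<cdot> x2))"
  by (rule LL.balI)
    (use assms in \<open>simp_all add: L.r_distr LL.dia_add_left LL.dia_add_right s_t_commute_left LL.dia_balanced\<close>)

lemma comult_t_left:
  assumes "c \<in> carrier B" "x \<in> carrier L"
  shows "\<Delta> (t c \<cdot> x) = tensor_lift LL.D (\<lambda>x1 x2. LL.dia x1 (t c \<cdot> x2)) (\<Delta> x)"
proof -
  have "\<Delta> (t c \<cdot> x) = tensor_lift LL.D (\<lambda>x1 x2. LL.dia (s \<one>\<^bsub>B\<^esub> \<cdot> x1) (t c \<cdot> x2)) (\<Delta> x)"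
    using comult_s_t[of "\<one>\<^bsub>B\<^esub>" c x] assms by simp
  also have "\<dots> = tensor_lift LL.D (\<lambda>x1 x2. LL.dia x1 (t c \<cdot> x2)) (\<Delta> x)"
    by (rule LL.D.tensor_lift_cong[OF LL.D.group_T bal_s_t]) (use assms in auto)
  finally show ?thesis .
qed

lemma comult_t: "c \<in> carrier B \<Longrightarrow> \<Delta> (t c) = LL.dia \<one>\<^bsub>L\<^esub> (t c)"
  using comult_t_left[of c "\<one>\<^bsub>L\<^esub>"]
  by (simp add: comult_one LL.lift_dia[OF LL.D.group_T bal_t])

lemma comult_s_left:
  assumes "b \<in> carrier B" "x \<in> carrier L"
  shows "\<Delta> (s b \<cdot> x) = b \<odot>\<^bsub>LL.D\<^esub> \<Delta> x"
proof -
  have "\<Delta> (s b \<cdot> x) = tensor_lift LL.D (\<lambda>x1 x2. LL.dia (s b \<cdot> x1) (t \<one>\<^bsub>B\<^esub> \<cdot> x2)) (\<Delta> x)"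
    using comult_s_t[of b "\<one>\<^bsub>B\<^esub>" x] assms by simp
  also have "\<dots> = b \<odot>\<^bsub>LL.D\<^esub> \<Delta> x"
    by (rule LL.D.additive_maps_eqI[OF LL.D.tensor_lift_additive[OF LL.D.group_T bal_s_t] LL.D_smult_additive])
      (use assms in \<open>simp_all add: LL.lift_dia[OF LL.D.group_T bal_s_t, of _ "\<one>\<^bsub>B\<^esub>", simplified]\<close>)
  finally show ?thesis .
qed

end

text \<open>Both the bialgebroid itself and every comodule algebra are instances, so that computations with the
comultiplication and with a coaction share their lemmas.\<close>

locale comod_ring = B_ring K B L A f
  for K :: "('k, 'x) ring_scheme" and B :: "('k, 'b, 'y) module_scheme"
    and L :: "('k, 'b, 'l, 'z) bialgebroid_scheme"
    and A :: "('a, 'w) ring_scheme" and f :: "'b \<Rightarrow> 'a" +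
  fixes d :: "'a \<Rightarrow> ('l \<times> 'a \<Rightarrow>\<^sub>0 int) set"
  assumes d_takeuchi: "a \<in> carrier A \<Longrightarrow> d a \<in> takeuchi B L A'"
    and d_additive: "d \<in> additive_maps A D"
    and d_mult: "a \<in> carrier A \<Longrightarrow> c \<in> carrier A \<Longrightarrow> d (a \<otimes>\<^bsub>A\<^esub> c) = takeuchi_mult B L A f (d a) (d c)"
    and d_base: "b \<in> carrier B \<Longrightarrow> a \<in> carrier A \<Longrightarrow> d (f b \<otimes>\<^bsub>A\<^esub> a) = b \<odot>\<^bsub>D\<^esub> d a"
    and d_coassoc: "coassociative B L A' d"
begin

lemma d_closed [simp]: "a \<in> carrier A \<Longrightarrow> d a \<in> carrier D"
  by (rule additive_maps_closed[OF d_additive])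

lemma d_mult_coinvariant:
  "a \<in> carrier A \<Longrightarrow> n \<in> carrier A \<Longrightarrow> d n = \<one>\<^bsub>L\<^esub> \<diamondop> n \<Longrightarrow> d (a \<otimes>\<^bsub>A\<^esub> n) = mult_by (d a) \<one>\<^bsub>L\<^esub> n"
  by (simp add: d_mult takeuchi_mult_pure d_takeuchi)

text \<open>For coinvariant \<open>n\<close> the function that multiplies the second factor by \<open>n\<close> from the left is well defined
on \<open>L \<diamondop> A\<close>: it is the componentwise product with the element \<open>1 \<otimes> n\<close> of the Takeuchi product.\<close>

lemma d_coinvariant_mult:
  assumes "a \<in> carrier A" "n \<in> carrier A" "d n = \<one>\<^bsub>L\<^esub> \<diamondop> n"
  shows "bal D (\<lambda>x c. x \<diamondop> n \<otimes>\<^bsub>A\<^esub> c)" and "d (n \<otimes>\<^bsub>A\<^esub> a) = tensor_lift D (\<lambda>x c. x \<diamondop> n \<otimes>\<^bsub>A\<^esub> c) (d a)"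
proof -
  have b: "bal D (mult_by (\<one>\<^bsub>L\<^esub> \<diamondop> n))"
    using bal_mult_by[OF d_takeuchi[OF assms(2)]] assms(3) by simp
  then show "bal D (\<lambda>x c. x \<diamondop> n \<otimes>\<^bsub>A\<^esub> c)"
    using balD[OF b] assms(2) by (intro balI) auto
  have "d (n \<otimes>\<^bsub>A\<^esub> a) = tensor_lift D (mult_by (\<one>\<^bsub>L\<^esub> \<diamondop> n)) (d a)"
    by (simp add: d_mult takeuchi_mult_eq assms)
  also have "\<dots> = tensor_lift D (\<lambda>x c. x \<diamondop> n \<otimes>\<^bsub>A\<^esub> c) (d a)"
    by (rule D.tensor_lift_cong[OF D.group_T b]) (use assms in auto)
  finally show "d (n \<otimes>\<^bsub>A\<^esub> a) = tensor_lift D (\<lambda>x c. x \<diamondop> n \<otimes>\<^bsub>A\<^esub> c) (d a)" .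
qed

lemma coinvariant_mult:
  "a \<in> carrier A \<Longrightarrow> n \<in> carrier A \<Longrightarrow> d a = \<one>\<^bsub>L\<^esub> \<diamondop> a \<Longrightarrow> d n = \<one>\<^bsub>L\<^esub> \<diamondop> n \<Longrightarrow>
    d (a \<otimes>\<^bsub>A\<^esub> n) = \<one>\<^bsub>L\<^esub> \<diamondop> a \<otimes>\<^bsub>A\<^esub> n"
  by (simp add: d_mult_coinvariant)

lemma trilinear_inner:
  "trilinear G F \<Longrightarrow> a \<in> carrier A \<Longrightarrow> LL.bal G (\<lambda>x1 x2. F x1 x2 a)"
  using balD[OF trilinear_bal, of G F]
  by (intro LL.balI) (auto simp: trilinear_def additive_maps_def)

lemma bal_comult:
  assumes G: "abelian_group G" and F: "trilinear G F"
  shows "bal G (\<lambda>x a. tensor_lift G (\<lambda>x1 x2. F x1 x2 a) (\<Delta> x))"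
proof -
  note in_bal = trilinear_inner[OF F]
  show ?thesis
  proof (rule balancedI_additive)
    fix a assume a: "a \<in> carrier A'"
    then have a': "a \<in> carrier A" by simp
    show "(\<lambda>x. tensor_lift G (\<lambda>x1 x2. F x1 x2 a) (\<Delta> x)) \<in> additive_maps LM G"
      using additive_maps_comp[OF comult_additive LL.D.tensor_lift_additive[OF G in_bal[OF a']]]
      by (simp add: additive_maps_def)
  next
    fix x assume x: "x \<in> carrier LM"
    show "(\<lambda>a. tensor_lift G (\<lambda>x1 x2. F x1 x2 a) (\<Delta> x)) \<in> additive_maps A' G"
      by (rule LL.D.tensor_lift_param[OF G in_bal])
        (use x balD[OF trilinear_bal[OF F]] in \<open>auto simp: additive_maps_def\<close>)
  next
    fix b x a assume h: "b \<in> carrier B" "x \<in> carrier LM" "a \<in> carrier A'"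
    then have x: "x \<in> carrier L" and a: "a \<in> carrier A" by auto
    have "tensor_lift G (\<lambda>x1 x2. F x1 x2 a) (\<Delta> (t b \<cdot> x)) = tensor_lift G (\<lambda>x1 x2. F x1 x2 (f b \<otimes>\<^bsub>A\<^esub> a)) (\<Delta> x)"
      unfolding comult_t_left[OF h(1) x]
      by (rule LL.D.tensor_lift_comp_eq[OF LL.D.group_T G bal_t[OF h(1)] LL.D.tensor_lift_additive[OF G in_bal[OF a]]])
        (use x a h balD(4)[OF trilinear_bal[OF F]] in \<open>auto simp: LL.lift_dia[OF G in_bal[OF a]]\<close>)
    then show "tensor_lift G (\<lambda>x1 x2. F x1 x2 a) (\<Delta> (b \<odot>\<^bsub>LM\<^esub> x)) =
        tensor_lift G (\<lambda>x1 x2. F x1 x2 (b \<odot>\<^bsub>A'\<^esub> a)) (\<Delta> x)"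
      by simp
  qed
qed

text \<open>Coassociativity in Sweedler form, \<open>F a\<^sub>1\<^sub>1 a\<^sub>1\<^sub>2 a\<^sub>2 = F a\<^sub>1 a\<^sub>2\<^sub>1 a\<^sub>2\<^sub>2\<close>: apply the map induced by \<open>F\<close> to the
coassociativity equation in \<open>L \<diamondop> (L \<diamondop> A)\<close>.\<close>

lemma coassoc:
  assumes G: "abelian_group G" and F: "trilinear G F" and a: "a \<in> carrier A"
  shows "tensor_lift G (\<lambda>x m. tensor_lift G (\<lambda>x1 x2. F x1 x2 m) (\<Delta> x)) (d a)
       = tensor_lift G (\<lambda>x m. tensor_lift G (F x) (d m)) (d a)"
proof -
  let ?T = "\<lambda>x y a. x \<diamondop>\<diamondop> (y \<diamondop> a)"
  let ?\<Phi> = "tensor_lift G (\<lambda>x. tensor_lift G (F x))"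
  note \<Phi> = DD.tensor_lift_additive[OF G trilinear_outer[OF G F]]
  have \<Phi>_pure: "?\<Phi> (x \<diamondop>\<diamondop> z) = tensor_lift G (F x) z" if "x \<in> carrier L" "z \<in> carrier D" for x z
    using that DD.tensor_lift_pure[OF G trilinear_outer[OF G F]] by simp
  have eq: "tensor_lift DD (\<lambda>x m. tensor_lift DD (\<lambda>x1 x2. ?T x1 x2 m) (\<Delta> x)) (d a)
      = tensor_lift DD (\<lambda>x m. x \<diamondop>\<diamondop> d m) (d a)"
    using d_coassoc a by (simp add: coassociative_def Let_def)
  note b1 = bal_comult[OF DD.group_T trilinear_pure]
  have b2: "bal DD (\<lambda>x m. x \<diamondop>\<diamondop> d m)"
    by (rule balI) (simp_all add: ddia_add_left ddia_add_right additive_maps_add[OF d_additive] ddia_balanced d_base)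
  note i = trilinear_inner[OF trilinear_pure]
  have "?\<Phi> (tensor_lift DD (\<lambda>x m. tensor_lift DD (\<lambda>x1 x2. ?T x1 x2 m) (\<Delta> x)) (d a))
      = tensor_lift G (\<lambda>x m. tensor_lift G (\<lambda>x1 x2. F x1 x2 m) (\<Delta> x)) (d a)"
  proof (rule D.tensor_lift_comp_eq[OF DD.group_T G b1 \<Phi>])
    fix x m assume "x \<in> carrier LM" "m \<in> carrier A'"
    then have h: "x \<in> carrier L" "m \<in> carrier A" by auto
    show "?\<Phi> (tensor_lift DD (\<lambda>x1 x2. ?T x1 x2 m) (\<Delta> x)) = tensor_lift G (\<lambda>x1 x2. F x1 x2 m) (\<Delta> x)"
      by (rule LL.D.tensor_lift_comp_eq[OF DD.group_T G i[OF h(2)] \<Phi>])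
        (use h in \<open>simp_all add: \<Phi>_pure lift_dia[OF G trilinear_bal[OF F]]\<close>)
  qed (use a in simp)
  moreover have "?\<Phi> (tensor_lift DD (\<lambda>x m. x \<diamondop>\<diamondop> d m) (d a)) = tensor_lift G (\<lambda>x m. tensor_lift G (F x) (d m)) (d a)"
    by (rule D.tensor_lift_comp_eq[OF DD.group_T G b2 \<Phi>]) (use a in \<open>simp_all add: \<Phi>_pure\<close>)
  ultimately show ?thesis using eq by simp
qed

end

sublocale bialg \<subseteq> LL: comod_ring K B L L "src L" "comult L"
  by unfold_locales
    (use comult_takeuchi comult_additive comult_mult comult_s_left comult_coassoc in auto)

section \<open>The canonical map of a left Hopf algebroid\<close>

context B_ring begin

definition mult_right :: "('l \<times> 'a \<Rightarrow>\<^sub>0 int) set \<Rightarrow> 'a \<Rightarrow> ('l \<times> 'a \<Rightarrow>\<^sub>0 int) set" where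
  "mult_right z c = tensor_lift D (\<lambda>x a. x \<diamondop> a \<otimes>\<^bsub>A\<^esub> c) z"

lemma bal_mult_right_factor: "c \<in> carrier A \<Longrightarrow> bal D (\<lambda>x a. x \<diamondop> a \<otimes>\<^bsub>A\<^esub> c)"
  by (rule balI) (auto simp: A.l_distr dia_add_left dia_add_right A.m_assoc dia_balanced)

lemma mult_right_dia [simp]:
  "x \<in> carrier L \<Longrightarrow> a \<in> carrier A \<Longrightarrow> c \<in> carrier A \<Longrightarrow> mult_right (x \<diamondop> a) c = x \<diamondop> a \<otimes>\<^bsub>A\<^esub> c"
  by (simp add: mult_right_def lift_dia[OF D.group_T bal_mult_right_factor])

lemma mult_right_additive: "c \<in> carrier A \<Longrightarrow> (\<lambda>z. mult_right z c) \<in> additive_maps D D"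
  unfolding mult_right_def by (rule D.tensor_lift_additive[OF D.group_T bal_mult_right_factor])

lemma mult_right_closed [simp]: "z \<in> carrier D \<Longrightarrow> c \<in> carrier A \<Longrightarrow> mult_right z c \<in> carrier D"
  by (rule additive_maps_closed[OF mult_right_additive])

lemma mult_right_additive_factor: "z \<in> carrier D \<Longrightarrow> (\<lambda>c. mult_right z c) \<in> additive_maps A D"
  unfolding mult_right_def
  by (rule D.tensor_lift_param[OF D.group_T bal_mult_right_factor])
    (auto intro!: additive_mapsI simp: A.r_distr dia_add_right)

lemma mult_by_one: "z \<in> carrier D \<Longrightarrow> c \<in> carrier A \<Longrightarrow> mult_by z \<one>\<^bsub>L\<^esub> c = mult_right z c"
  by (rule D.additive_maps_eqI[OF mult_by_additive mult_right_additive]) auto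

lemma mult_right_assoc:
  "z \<in> carrier D \<Longrightarrow> a \<in> carrier A \<Longrightarrow> c \<in> carrier A \<Longrightarrow>
    mult_right (mult_right z a) c = mult_right z (a \<otimes>\<^bsub>A\<^esub> c)"
  by (rule D.additive_maps_eqI[OF additive_maps_comp[OF mult_right_additive mult_right_additive] mult_right_additive])
    (auto simp: A.m_assoc)

lemma additive_mult_right:
  assumes G: "abelian_group G" and h: "h \<in> additive_maps D G" and z: "z \<in> carrier D" and c: "c \<in> carrier A"
    and g: "\<And>x a. x \<in> carrier L \<Longrightarrow> a \<in> carrier A \<Longrightarrow> h (x \<diamondop> a \<otimes>\<^bsub>A\<^esub> c) = g x a"
  shows "h (mult_right z c) = tensor_lift G g z"
  unfolding mult_right_def
  by (rule D.tensor_lift_comp_eq[OF D.group_T G bal_mult_right_factor[OF c] h z]) (simp add: g)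

end

lemma ring_opp: "ring R \<Longrightarrow> ring (opp R)"
proof -
  assume "ring R"
  then interpret ring R .
  have "abelian_group (opp R)"
    by (rule abelian_group_cong[of R]) (simp_all add: abelian_group_axioms)
  then show ?thesis
    by (rule ringI) (auto intro!: monoidI simp: m_assoc r_distr l_distr)
qed

context bialg begin

abbreviation "RM \<equiv> right_mult L (tgt L)"
abbreviation "TL \<equiv> tensor_opp B L LM"
abbreviation "pL \<equiv> tensor_opp_pure B L LM"

lemma opp_pair:
  assumes "abelian_group V"
    and "\<And>b v. b \<in> carrier B \<Longrightarrow> v \<in> carrier V \<Longrightarrow> b \<odot>\<^bsub>V\<^esub> v \<in> carrier V"
  shows "tensor_pair (opp B) RM V (tensor_opp B L V)"
  by (rule tensor_pair_tensor) (use assms abelian_group_right_mult[OF ring_L] in auto)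

sublocale TL: tensor_pair "opp B" "right_mult L (tgt L)" "left_mult L (tgt L)"
    "tensor (opp B) (right_mult L (tgt L)) (left_mult L (tgt L))"
  by (rule opp_pair) (auto intro: abelian_group_left_mult ring_L)

lemma pL_simps:
  "x \<in> carrier L \<Longrightarrow> y \<in> carrier L \<Longrightarrow> pL x y \<in> carrier TL"
  "x \<in> carrier L \<Longrightarrow> x' \<in> carrier L \<Longrightarrow> y \<in> carrier L \<Longrightarrow> pL (x \<oplus>\<^bsub>L\<^esub> x') y = pL x y \<oplus>\<^bsub>TL\<^esub> pL x' y"
  "x \<in> carrier L \<Longrightarrow> y \<in> carrier L \<Longrightarrow> y' \<in> carrier L \<Longrightarrow> pL x (y \<oplus>\<^bsub>L\<^esub> y') = pL x y \<oplus>\<^bsub>TL\<^esub> pL x y'"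
  "b \<in> carrier B \<Longrightarrow> x \<in> carrier L \<Longrightarrow> y \<in> carrier L \<Longrightarrow> pL (x \<cdot> t b) y = pL x (t b \<cdot> y)"
  using TL.pure_in_T[of x y] TL.pure_add_left[of x x' y] TL.pure_add_right[of x y y'] TL.pure_smult[of b x y]
  by simp_all

abbreviation oppbal where "oppbal V G F \<equiv> balanced (opp B) (right_mult L (tgt L)) V G F"

lemma oppbalI:
  assumes "\<And>x v. x \<in> carrier L \<Longrightarrow> v \<in> carrier V \<Longrightarrow> F x v \<in> carrier G"
    and "\<And>x y v. x \<in> carrier L \<Longrightarrow> y \<in> carrier L \<Longrightarrow> v \<in> carrier V \<Longrightarrow> F (x \<oplus>\<^bsub>L\<^esub> y) v = F x v \<oplus>\<^bsub>G\<^esub> F y v"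
    and "\<And>x v w. x \<in> carrier L \<Longrightarrow> v \<in> carrier V \<Longrightarrow> w \<in> carrier V \<Longrightarrow> F x (v \<oplus>\<^bsub>V\<^esub> w) = F x v \<oplus>\<^bsub>G\<^esub> F x w"
    and "\<And>b x v. b \<in> carrier B \<Longrightarrow> x \<in> carrier L \<Longrightarrow> v \<in> carrier V \<Longrightarrow> F (x \<cdot> t b) v = F x (b \<odot>\<^bsub>V\<^esub> v)"
  shows "oppbal V G F"
  by (rule balancedI) (use assms in auto)

lemma comult_t_right:
  assumes "x \<in> carrier L" "b \<in> carrier B"
  shows "\<Delta> (x \<cdot> t b) = LL.mult_right (\<Delta> x) (t b)"
  using LL.d_mult_coinvariant[of x "t b"] assms by (simp add: comult_t LL.mult_by_one)

definition "lam x y = LL.mult_right (\<Delta> x) y"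

lemma lam_balanced: "oppbal LM LL.D lam"
  unfolding lam_def
  by (rule oppbalI)
    (simp_all add: comult_t_right LL.mult_right_assoc additive_maps_add[OF comult_additive]
      additive_maps_add[OF LL.mult_right_additive] additive_maps_add[OF LL.mult_right_additive_factor])

text \<open>The map \<open>x \<otimes> y \<mapsto> x\<^sub>1 \<otimes> x\<^sub>2 y\<close> whose bijectivity is the Hopf condition. It is right \<open>L\<close>-linear, and it
carries left multiplication of the first factor by \<open>t b\<close> to left multiplication of the second one.\<close>

definition "Lam = tensor_lift LL.D lam"

lemma Lam_additive: "Lam \<in> additive_maps TL LL.D"
  unfolding Lam_def by (rule TL.tensor_lift_additive[OF LL.D.group_T lam_balanced])

lemma Lam_pure: "x \<in> carrier L \<Longrightarrow> y \<in> carrier L \<Longrightarrow> Lam (pL x y) = LL.mult_right (\<Delta> x) y"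
  unfolding Lam_def by (subst TL.tensor_lift_pure[OF LL.D.group_T lam_balanced]) (auto simp: lam_def)

lemma bal_TL_right: "y \<in> carrier L \<Longrightarrow> oppbal LM TL (\<lambda>u v. pL u (v \<cdot> y))"
  by (rule oppbalI) (simp_all add: pL_simps L.l_distr L.m_assoc)

lemma bal_TL_left: "b \<in> carrier B \<Longrightarrow> oppbal LM TL (\<lambda>u v. pL (t b \<cdot> u) v)"
  by (rule oppbalI) (simp_all add: pL_simps L.r_distr L.m_assoc[symmetric])

lemma Lam_right:
  assumes "z \<in> carrier TL" "y \<in> carrier L"
  shows "Lam (tensor_lift TL (\<lambda>u v. pL u (v \<cdot> y)) z) = LL.mult_right (Lam z) y"
  by (rule TL.additive_maps_eqI[OF
        additive_maps_comp[OF TL.tensor_lift_additive[OF TL.group_T bal_TL_right] Lam_additive]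
        additive_maps_comp[OF Lam_additive LL.mult_right_additive]])
    (use assms in \<open>simp_all add: TL.tensor_lift_pure[OF TL.group_T bal_TL_right] Lam_pure LL.mult_right_assoc\<close>)

lemma mult_right_bal_t:
  assumes "b \<in> carrier B" "y \<in> carrier L" "w \<in> carrier LL.D"
  shows "LL.mult_right (tensor_lift LL.D (\<lambda>x1 x2. LL.dia x1 (t b \<cdot> x2)) w) y
    = tensor_lift LL.D (\<lambda>x1 x2. LL.dia x1 (t b \<cdot> x2)) (LL.mult_right w y)"
  by (rule LL.D.additive_maps_eqI[OF
        additive_maps_comp[OF LL.D.tensor_lift_additive[OF LL.D.group_T bal_t] LL.mult_right_additive]
        additive_maps_comp[OF LL.mult_right_additive LL.D.tensor_lift_additive[OF LL.D.group_T bal_t]]])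
    (use assms in \<open>simp_all add: LL.lift_dia[OF LL.D.group_T bal_t] L.m_assoc\<close>)

lemma Lam_left:
  assumes "z \<in> carrier TL" "b \<in> carrier B"
  shows "Lam (tensor_lift TL (\<lambda>u v. pL (t b \<cdot> u) v) z)
    = tensor_lift LL.D (\<lambda>x1 x2. LL.dia x1 (t b \<cdot> x2)) (Lam z)"
  by (rule TL.additive_maps_eqI[OF
        additive_maps_comp[OF TL.tensor_lift_additive[OF TL.group_T bal_TL_left] Lam_additive]
        additive_maps_comp[OF Lam_additive LL.D.tensor_lift_additive[OF LL.D.group_T bal_t]]])
    (use assms in \<open>simp_all add: TL.tensor_lift_pure[OF TL.group_T bal_TL_left] Lam_pure comult_t_left mult_right_bal_t\<close>)

end

locale hopf = bialg K B L
  for K :: "('k, 'x) ring_scheme" and B :: "('k, 'b, 'y) module_scheme"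
    and L :: "('k, 'b, 'l, 'z) bialgebroid_scheme" +
  assumes Lam_bij: "bij_betw Lam (carrier TL) (carrier LL.D)"
begin

text \<open>In the usual notation \<open>mu (x \<otimes> y) = x\<^sub>+ \<otimes> x\<^sub>- y\<close>.\<close>

definition "mu = inv_into (carrier TL) Lam"

lemma mu_additive: "mu \<in> additive_maps LL.D TL"
  unfolding mu_def by (rule additive_maps_inv_into[OF TL.group_T Lam_additive Lam_bij])

lemma mu_closed [simp]: "w \<in> carrier LL.D \<Longrightarrow> mu w \<in> carrier TL"
  by (rule additive_maps_closed[OF mu_additive])

lemma mu_Lam: "z \<in> carrier TL \<Longrightarrow> mu (Lam z) = z"
  unfolding mu_def by (rule inv_into_f_f[OF bij_betw_imp_inj_on[OF Lam_bij]])

lemma Lam_mu: "w \<in> carrier LL.D \<Longrightarrow> Lam (mu w) = w"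
  unfolding mu_def using Lam_bij by (metis bij_betw_inv_into_right)

lemma lift_mu_right:
  assumes G: "abelian_group G" and F: "oppbal LM G F"
    and w: "w \<in> carrier LL.D" and y: "y \<in> carrier L"
  shows "tensor_lift G F (mu (LL.mult_right w y)) = tensor_lift G (\<lambda>u v. F u (v \<cdot> y)) (mu w)"
proof -
  note l = TL.tensor_lift_additive[OF G F] and b = bal_TL_right[OF y]
  let ?z = "tensor_lift TL (\<lambda>u v. pL u (v \<cdot> y)) (mu w)"
  have z: "?z \<in> carrier TL" by (rule TL.tensor_lift_closed[OF TL.group_T b]) (use w in simp)
  have "mu (LL.mult_right w y) = ?z"
    using Lam_right[OF mu_closed[OF w] y] mu_Lam[OF z] by (simp add: Lam_mu w)
  then show ?thesis
    using TL.tensor_lift_comp_eq[OF TL.group_T G b l mu_closed[OF w], of "\<lambda>u v. F u (v \<cdot> y)"] y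
    by (simp add: TL.tensor_lift_pure[OF G F])
qed

lemma lift_mu_left:
  assumes G: "abelian_group G" and F: "oppbal LM G F"
    and w: "w \<in> carrier LL.D" and b: "b \<in> carrier B"
  shows "tensor_lift G F (mu (tensor_lift LL.D (\<lambda>x1 x2. LL.dia x1 (t b \<cdot> x2)) w))
    = tensor_lift G (\<lambda>u v. F (t b \<cdot> u) v) (mu w)"
proof -
  note l = TL.tensor_lift_additive[OF G F] and bl = bal_TL_left[OF b]
  let ?z = "tensor_lift TL (\<lambda>u v. pL (t b \<cdot> u) v) (mu w)"
  have z: "?z \<in> carrier TL" by (rule TL.tensor_lift_closed[OF TL.group_T bl]) (use w in simp)
  have "mu (tensor_lift LL.D (\<lambda>x1 x2. LL.dia x1 (t b \<cdot> x2)) w) = ?z"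
    using Lam_left[OF mu_closed[OF w] b] mu_Lam[OF z] by (simp add: Lam_mu w)
  then show ?thesis
    using TL.tensor_lift_comp_eq[OF TL.group_T G bl l mu_closed[OF w], of "\<lambda>u v. F (t b \<cdot> u) v"] b
    by (simp add: TL.tensor_lift_pure[OF G F])
qed

text \<open>In Sweedler notation \<open>x\<^sub>1\<^sub>+ \<otimes> x\<^sub>1\<^sub>- x\<^sub>2 y = x \<otimes> y\<close>, the analogue of the antipode axiom.\<close>

lemma mu_cancel:
  assumes G: "abelian_group G" and F: "oppbal LM G F" and x: "x \<in> carrier L" and y: "y \<in> carrier L"
  shows "tensor_lift G (\<lambda>x1 x2. tensor_lift G F (mu (LL.dia x1 (x2 \<cdot> y)))) (\<Delta> x) = F x y"
proof -
  have h: "(\<lambda>w. tensor_lift G F (mu w)) \<in> additive_maps LL.D G"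
    by (rule additive_maps_comp[OF mu_additive TL.tensor_lift_additive[OF G F]])
  have "F x y = tensor_lift G F (mu (Lam (pL x y)))"
    using x y by (simp add: mu_Lam pL_simps TL.tensor_lift_pure[OF G F])
  also have "\<dots> = tensor_lift G (\<lambda>x1 x2. tensor_lift G F (mu (LL.dia x1 (x2 \<cdot> y)))) (\<Delta> x)"
    using LL.additive_mult_right[OF G h comult_closed[OF x] y] x y by (simp add: Lam_pure)
  finally show ?thesis by simp
qed

lemma mu_one: "y \<in> carrier L \<Longrightarrow> mu (LL.dia \<one>\<^bsub>L\<^esub> y) = pL \<one>\<^bsub>L\<^esub> y"
  using mu_Lam[of "pL \<one>\<^bsub>L\<^esub> y"] by (simp add: pL_simps Lam_pure comult_one)

end

section \<open>Comodule algebras with an inclusion of the opposite base\<close>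

context bialg begin

lemma counit_additive: "\<epsilon> \<in> additive_maps L B"
  and counit_one [simp]: "\<epsilon> \<one>\<^bsub>L\<^esub> = \<one>\<^bsub>B\<^esub>"
  and counit_s_t: "b \<in> carrier B \<Longrightarrow> c \<in> carrier B \<Longrightarrow> x \<in> carrier L \<Longrightarrow> \<epsilon> (s b \<cdot> t c \<cdot> x) = b \<otimes>\<^bsub>B\<^esub> \<epsilon> x \<otimes>\<^bsub>B\<^esub> c"
  using bialgebroid by (auto simp: left_bialgebroid_def Let_def)

lemma counit_closed [simp]: "x \<in> carrier L \<Longrightarrow> \<epsilon> x \<in> carrier B"
  by (rule additive_maps_closed[OF counit_additive])

lemma counit_t: "c \<in> carrier B \<Longrightarrow> x \<in> carrier L \<Longrightarrow> \<epsilon> (t c \<cdot> x) = \<epsilon> x \<otimes>\<^bsub>B\<^esub> c"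
  using counit_s_t[of "\<one>\<^bsub>B\<^esub>" c x] by simp

end

locale comod_alg = comod_ring K B L P "base P" "coact P"
  for K :: "('k, 'x) ring_scheme" and B :: "('k, 'b, 'y) module_scheme"
    and L :: "('k, 'b, 'l, 'z) bialgebroid_scheme"
    and P :: "('k, 'b, 'l, 'p, 'w) comodule_algebra_scheme" +
  assumes coact_counit: "p \<in> carrier P \<Longrightarrow>
      tensor_lift P (\<lambda>x m. base P (counit L x) \<otimes>\<^bsub>P\<^esub> m) (coact P p) = p"
    and coact_one: "coact P \<one>\<^bsub>P\<^esub> = diamond_pure B L (base_bimodule P) \<one>\<^bsub>L\<^esub> \<one>\<^bsub>P\<^esub>"

lemma comod_algI:
  assumes L: "left_bialgebroid K B L" and P: "left_comodule_algebra K B L P"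
  shows "comod_alg K B L P"
proof -
  interpret bialg K B L by unfold_locales (rule L)
  interpret B_ring K B L P "base P"
    by (intro B_ring.intro bialg_axioms B_ring_axioms.intro)
      (use P in \<open>auto simp: left_comodule_algebra_def k_algebra_def alg_hom_def\<close>)
  have ca: "left_comodule K B L (ring_bimodule P (base P)) (coact P)"
    using P by (simp add: left_comodule_algebra_def)
  have bal1: "bal D (\<lambda>x m. dia (s b \<cdot> x \<cdot> s \<one>\<^bsub>B\<^esub>) m)" if "b \<in> carrier B" for b
    by (rule balI) (use that in \<open>auto simp: L.r_distr s_t_commute_left dia_add_left dia_add_right dia_balanced\<close>)
  have cl: "coact P a \<in> carrier D" if "a \<in> carrier P" for a
    using ca that by (auto simp: left_comodule_def takeuchi_def)
  show ?thesis
  proof (intro comod_alg.intro comod_ring.intro B_ring_axioms comod_ring_axioms.intro comod_alg_axioms.intro)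
    fix b a assume h: "b \<in> carrier B" "a \<in> carrier P"
    have cond: "\<forall>b\<in>carrier B. \<forall>b'\<in>carrier B. \<forall>m\<in>carrier P.
        coact P (base P b \<otimes>\<^bsub>P\<^esub> (m \<otimes>\<^bsub>P\<^esub> base P b')) =
        tensor_lift D (\<lambda>x m'. dia (s b \<cdot> x \<cdot> s b') m') (coact P m)"
      using ca by (simp add: left_comodule_def)
    have "coact P (base P b \<otimes>\<^bsub>P\<^esub> a) = tensor_lift D (\<lambda>x m'. dia (s b \<cdot> x \<cdot> s \<one>\<^bsub>B\<^esub>) m') (coact P a)"
      using h bspec[OF bspec[OF bspec[OF cond h(1)] B.one_closed] h(2)] by simp
    also have "\<dots> = b \<odot>\<^bsub>D\<^esub> coact P a"
      by (rule D.additive_maps_eqI[OF D.tensor_lift_additive[OF D.group_T bal1] D_smult_additive])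
        (use h cl lift_dia[OF D.group_T bal1[OF h(1)]] in auto)
    finally show "coact P (base P b \<otimes>\<^bsub>P\<^esub> a) = b \<odot>\<^bsub>D\<^esub> coact P a" .
  next
    show "coact P \<in> additive_maps P D"
      using ca unfolding left_comodule_def additive_maps_def by simp
    show "coassociative B L A' (coact P)"
      using ca unfolding left_comodule_def by simp
    show "coact P a \<in> takeuchi B L A'" if "a \<in> carrier P" for a
      using ca that unfolding left_comodule_def by auto
    show "coact P (a \<otimes>\<^bsub>P\<^esub> c) = takeuchi_mult B L P (base P) (coact P a) (coact P c)"
      if "a \<in> carrier P" "c \<in> carrier P" for a c
      using P that unfolding left_comodule_algebra_def by simp
    show "coact P \<one>\<^bsub>P\<^esub> = diamond_pure B L A' \<one>\<^bsub>L\<^esub> \<one>\<^bsub>P\<^esub>"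
      using P unfolding left_comodule_algebra_def by simp
    fix p assume p: "p \<in> carrier P"
    have "tensor_lift A' (\<lambda>x m. counit L x \<odot>\<^bsub>A'\<^esub> m) (coact P p) = p"
      using ca p ring_bimodule_simps(1)[of P "base P"] unfolding left_comodule_def by blast
    moreover have b: "bal A' (\<lambda>x m. counit L x \<odot>\<^bsub>A'\<^esub> m)"
      by (rule balI)
        (auto simp: additive_maps_add[OF counit_additive] A.l_distr A.r_distr counit_t A.m_assoc)
    have "tensor_lift A' (\<lambda>x m. counit L x \<odot>\<^bsub>A'\<^esub> m) (coact P p)
        = tensor_lift P (\<lambda>x m. counit L x \<odot>\<^bsub>A'\<^esub> m) (coact P p)"
      by (rule D.tensor_lift_same_group[OF D.group_V A.is_abelian_group _ _ b]) (use cl p in auto)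
    moreover have "(\<lambda>x m. counit L x \<odot>\<^bsub>A'\<^esub> m) = (\<lambda>x m. base P (counit L x) \<otimes>\<^bsub>P\<^esub> m)"
      by (intro ext) simp
    ultimately show "tensor_lift P (\<lambda>x m. base P (counit L x) \<otimes>\<^bsub>P\<^esub> m) (coact P p) = p"
      by simp
  qed
qed

context comod_alg begin

notation dia (infixr "\<diamondop>" 68)
notation ddia (infixr "\<diamondop>\<diamondop>" 68)
abbreviation "\<rho> \<equiv> coact P"
abbreviation "\<beta> \<equiv> base P"
abbreviation mult_P (infixl "\<bullet>" 70) where "p \<bullet> q \<equiv> p \<otimes>\<^bsub>P\<^esub> q"
abbreviation "N \<equiv> coinvariants B L P"

lemma group_P: "abelian_group P" by (rule A.is_abelian_group)

lemma bal_counit: "bal P (\<lambda>x m. \<beta> (\<epsilon> x) \<bullet> m)"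
  by (rule balI)
    (auto simp: additive_maps_add[OF counit_additive] A.l_distr A.r_distr counit_t A.m_assoc)

lemma coact_inj: "inj_on \<rho> (carrier P)"
  by (rule inj_on_inverseI[where g = "tensor_lift P (\<lambda>x m. \<beta> (\<epsilon> x) \<bullet> m)"]) (rule coact_counit)

lemma N_simps:
  "n \<in> N \<Longrightarrow> n \<in> carrier P" "n \<in> N \<Longrightarrow> \<rho> n = \<one>\<^bsub>L\<^esub> \<diamondop> n"
  by (auto simp: coinvariants_def)

lemma N_I: "n \<in> carrier P \<Longrightarrow> \<rho> n = \<one>\<^bsub>L\<^esub> \<diamondop> n \<Longrightarrow> n \<in> N"
  by (auto simp: coinvariants_def)

lemma pure_one_additive: "(\<lambda>p. \<one>\<^bsub>L\<^esub> \<diamondop> p) \<in> additive_maps P D"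
  by (auto intro!: additive_mapsI simp: dia_add_right)

lemma N_add: "n \<in> N \<Longrightarrow> m \<in> N \<Longrightarrow> n \<oplus>\<^bsub>P\<^esub> m \<in> N"
  by (auto intro!: N_I simp: N_simps additive_maps_add[OF d_additive] dia_add_right)

lemma N_zero: "\<zero>\<^bsub>P\<^esub> \<in> N"
  by (auto intro!: N_I simp: additive_maps_zero[OF group_P D.group_T d_additive]
      additive_maps_zero[OF group_P D.group_T pure_one_additive])

lemma N_uminus: "n \<in> N \<Longrightarrow> \<ominus>\<^bsub>P\<^esub> n \<in> N"
  by (auto intro!: N_I simp: N_simps additive_maps_uminus[OF group_P D.group_T d_additive]
      additive_maps_uminus[OF group_P D.group_T pure_one_additive])

lemma N_one: "\<one>\<^bsub>P\<^esub> \<in> N"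
  by (auto intro!: N_I simp: coact_one)

lemma N_mult: "n \<in> N \<Longrightarrow> m \<in> N \<Longrightarrow> n \<bullet> m \<in> N"
  by (rule N_I) (simp_all add: N_simps coinvariant_mult)

text \<open>For coinvariant \<open>n\<close> the Takeuchi condition on \<open>1 \<otimes> n\<close> says \<open>t b \<otimes> n = 1 \<otimes> n b\<close>, while \<open>t b \<otimes> n = 1 \<otimes> b n\<close>
by balancedness. Applying the counit to the first factor gives \<open>n b = b n\<close>.\<close>

lemma N_commute:
  assumes n: "n \<in> N" and b: "b \<in> carrier B"
  shows "n \<bullet> \<beta> b = \<beta> b \<bullet> n"
proof -
  have nP: "n \<in> carrier P" using n by (rule N_simps)
  have "\<one>\<^bsub>L\<^esub> \<diamondop> n \<in> takeuchi B L A'" using d_takeuchi[OF nP] n by (simp add: N_simps)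
  then have "tensor_lift D (\<lambda>x a. x \<cdot> t b \<diamondop> a) (\<one>\<^bsub>L\<^esub> \<diamondop> n)
      = tensor_lift D (\<lambda>x a. x \<diamondop> a \<bullet> \<beta> b) (\<one>\<^bsub>L\<^esub> \<diamondop> n)"
    using b by (simp add: takeuchi_def)
  then have "t b \<diamondop> n = \<one>\<^bsub>L\<^esub> \<diamondop> n \<bullet> \<beta> b"
    using b nP by (simp add: lift_dia[OF D.group_T bal_left_right_shift(1)[OF b]]
      lift_dia[OF D.group_T bal_left_right_shift(2)[OF b]])
  then have "tensor_lift P (\<lambda>x m. \<beta> (\<epsilon> x) \<bullet> m) (t b \<diamondop> n) = tensor_lift P (\<lambda>x m. \<beta> (\<epsilon> x) \<bullet> m) (\<one>\<^bsub>L\<^esub> \<diamondop> n \<bullet> \<beta> b)"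
    by simp
  then show ?thesis
    using b nP counit_t[of b "\<one>\<^bsub>L\<^esub>"] by (simp add: lift_dia[OF group_P bal_counit])
qed

lemma coact_mult_N: "p \<in> carrier P \<Longrightarrow> n \<in> N \<Longrightarrow> \<rho> (p \<bullet> n) = mult_right (\<rho> p) n"
  by (simp add: N_simps d_mult_coinvariant mult_by_one)

end

text \<open>The flatness assumption is that of \<open>L\<close> as a right module over the opposite of \<open>B\<close>; by it
\<open>L \<otimes> -\<close>, formed over the opposite of \<open>B\<close>, preserves and detects exactness.\<close>

locale opp_alg = comod_alg K B L P
  for K :: "('k, 'x) ring_scheme" and B :: "('k, 'b, 'y) module_scheme"
    and L :: "('k, 'b, 'l, 'z) bialgebroid_scheme"
    and P :: "('k, 'b, 'l, 'p, 'w) comodule_algebra_scheme" +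
  fixes \<iota> :: "'b \<Rightarrow> 'p"
  assumes iota_hom: "\<iota> \<in> ring_hom (opp B) P" and iota_N: "b \<in> carrier B \<Longrightarrow> \<iota> b \<in> coinvariants B L P"
    and flat: "right_faithfully_flat TYPE(('b, 'l, 'p) test_type) (opp B) (right_mult L (tgt L))"
begin

lemma iota_simps [simp]:
  "b \<in> carrier B \<Longrightarrow> \<iota> b \<in> carrier P" "\<iota> \<one>\<^bsub>B\<^esub> = \<one>\<^bsub>P\<^esub>"
  "b \<in> carrier B \<Longrightarrow> c \<in> carrier B \<Longrightarrow> \<iota> (b \<oplus>\<^bsub>B\<^esub> c) = \<iota> b \<oplus>\<^bsub>P\<^esub> \<iota> c"
  "b \<in> carrier B \<Longrightarrow> c \<in> carrier B \<Longrightarrow> \<iota> (b \<otimes>\<^bsub>B\<^esub> c) = \<iota> c \<bullet> \<iota> b"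
  using iota_hom by (auto simp: ring_hom_def)

lemma iota_beta_commute: "b \<in> carrier B \<Longrightarrow> c \<in> carrier B \<Longrightarrow> \<iota> b \<bullet> \<beta> c = \<beta> c \<bullet> \<iota> b"
  by (rule N_commute[OF iota_N])

lemma iota_beta_commute_left:
  "b \<in> carrier B \<Longrightarrow> c \<in> carrier B \<Longrightarrow> p \<in> carrier P \<Longrightarrow> \<iota> b \<bullet> (\<beta> c \<bullet> p) = \<beta> c \<bullet> (\<iota> b \<bullet> p)"
  by (simp add: A.m_assoc[symmetric] iota_beta_commute)

abbreviation "VP \<equiv> left_mult P \<iota>"
abbreviation "VN \<equiv> coinvariants_module B L P \<iota>"

text \<open>The opposite of \<open>B\<close> acts on the second factor of \<open>L \<diamondop> P\<close>. This respects the relations of \<open>L \<diamondop> P\<close>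
  because coinvariants commute with the image of \<open>B\<close>.\<close>

definition opp_act :: "'b \<Rightarrow> ('l \<times> 'p \<Rightarrow>\<^sub>0 int) set \<Rightarrow> ('l \<times> 'p \<Rightarrow>\<^sub>0 int) set" where
  "opp_act b = tensor_lift D (\<lambda>x p. x \<diamondop> \<iota> b \<bullet> p)"

lemma bal_opp_act: "b \<in> carrier B \<Longrightarrow> bal D (\<lambda>x p. x \<diamondop> \<iota> b \<bullet> p)"
  by (rule balI) (simp_all add: dia_add_left dia_add_right A.r_distr iota_beta_commute_left dia_balanced)

lemma opp_act_additive: "b \<in> carrier B \<Longrightarrow> opp_act b \<in> additive_maps D D"
  unfolding opp_act_def by (rule D.tensor_lift_additive[OF D.group_T bal_opp_act])

lemma opp_act_closed [simp]: "b \<in> carrier B \<Longrightarrow> z \<in> carrier D \<Longrightarrow> opp_act b z \<in> carrier D"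
  by (rule additive_maps_closed[OF opp_act_additive])

lemma opp_act_pure [simp]:
  "b \<in> carrier B \<Longrightarrow> x \<in> carrier L \<Longrightarrow> p \<in> carrier P \<Longrightarrow> opp_act b (x \<diamondop> p) = x \<diamondop> \<iota> b \<bullet> p"
  by (simp add: opp_act_def lift_dia[OF D.group_T bal_opp_act])

abbreviation "VD \<equiv> D\<lparr>smult := opp_act\<rparr>"

lemma module_VP: "left_module (opp B) VP"
  by (rule left_module.intro[OF ring_opp[OF ring_B] abelian_group_left_mult[OF ring_A]], unfold_locales)
    (auto simp: A.r_distr A.l_distr A.m_assoc)

lemma module_VN: "left_module (opp B) VN"
proof -
  have "abelian_group VN"
  proof (rule abelian_groupI)
    fix n assume "n \<in> carrier VN"
    then show "\<exists>y\<in>carrier VN. y \<oplus>\<^bsub>VN\<^esub> n = \<zero>\<^bsub>VN\<^esub>"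
      using N_uminus[of n] A.l_neg[of n] by (auto simp: N_simps)
  qed (auto simp: N_simps A.a_ac N_add N_zero)
  from left_module.intro[OF ring_opp[OF ring_B] this] show ?thesis
    unfolding left_module_axioms_def
    by (auto simp: N_simps A.r_distr A.l_distr A.m_assoc N_mult iota_N)
qed

lemma module_VD: "left_module (opp B) VD"
proof -
  have gr: "abelian_group VD" by (rule abelian_group_cong[OF D.group_T]) simp_all
  show ?thesis
  proof (rule left_module.intro[OF ring_opp[OF ring_B] gr], unfold_locales)
    fix a b z assume h: "a \<in> carrier (opp B)" "b \<in> carrier (opp B)" "z \<in> carrier VD"
    then have z: "z \<in> carrier D" by simp
    have "opp_act (a \<oplus>\<^bsub>B\<^esub> b) z = opp_act a z \<oplus>\<^bsub>D\<^esub> opp_act b z"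
      by (rule D.additive_maps_eqI[OF opp_act_additive additive_maps_plus[OF D.group_T opp_act_additive opp_act_additive] _ z])
        (use h in \<open>auto simp: A.l_distr dia_add_right\<close>)
    then show "(a \<oplus>\<^bsub>opp B\<^esub> b) \<odot>\<^bsub>VD\<^esub> z = a \<odot>\<^bsub>VD\<^esub> z \<oplus>\<^bsub>VD\<^esub> b \<odot>\<^bsub>VD\<^esub> z" by simp
    have "opp_act (b \<otimes>\<^bsub>B\<^esub> a) z = opp_act a (opp_act b z)"
      by (rule D.additive_maps_eqI[OF opp_act_additive additive_maps_comp[OF opp_act_additive opp_act_additive] _ z])
        (use h in \<open>auto simp: A.m_assoc\<close>)
    then show "(a \<otimes>\<^bsub>opp B\<^esub> b) \<odot>\<^bsub>VD\<^esub> z = a \<odot>\<^bsub>VD\<^esub> (b \<odot>\<^bsub>VD\<^esub> z)" by simp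
  next
    fix z assume "z \<in> carrier VD"
    then have z: "z \<in> carrier D" by simp
    have "opp_act \<one>\<^bsub>B\<^esub> z = z"
      by (rule D.additive_maps_eqI[OF opp_act_additive _ _ z]) (auto simp: additive_maps_def)
    then show "\<one>\<^bsub>opp B\<^esub> \<odot>\<^bsub>VD\<^esub> z = z" by simp
  qed (auto simp: additive_maps_add[OF opp_act_additive])
qed

lemma module_RM: "right_module (opp B) RM"
  using flat by (simp add: right_faithfully_flat_def)

abbreviation "TP \<equiv> tensor_opp B L VP"
abbreviation "pP \<equiv> tensor_opp_pure B L VP"
abbreviation "TN \<equiv> tensor_opp B L VN"
abbreviation "pN \<equiv> tensor_opp_pure B L VN"
abbreviation "TD \<equiv> tensor_opp B L VD"
abbreviation "pD \<equiv> tensor_opp_pure B L VD"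

sublocale TP: tensor_pair "opp B" "right_mult L (tgt L)" "left_mult P \<iota>"
    "tensor (opp B) (right_mult L (tgt L)) (left_mult P \<iota>)"
  by (rule tensor_pair_modules[OF module_RM module_VP])
sublocale TN: tensor_pair "opp B" "right_mult L (tgt L)" "coinvariants_module B L P \<iota>"
    "tensor (opp B) (right_mult L (tgt L)) (coinvariants_module B L P \<iota>)"
  by (rule tensor_pair_modules[OF module_RM module_VN])
sublocale TD: tensor_pair "opp B" "right_mult L (tgt L)" "diamond B L (ring_bimodule P (base P))\<lparr>smult := opp_act\<rparr>"
    "tensor (opp B) (right_mult L (tgt L)) (diamond B L (ring_bimodule P (base P))\<lparr>smult := opp_act\<rparr>)"
  by (rule tensor_pair_modules[OF module_RM module_VD])

lemma pP_simps:
  "x \<in> carrier L \<Longrightarrow> y \<in> carrier P \<Longrightarrow> pP x y \<in> carrier TP"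
  "x \<in> carrier L \<Longrightarrow> x' \<in> carrier L \<Longrightarrow> y \<in> carrier P \<Longrightarrow> pP (x \<oplus>\<^bsub>L\<^esub> x') y = pP x y \<oplus>\<^bsub>TP\<^esub> pP x' y"
  "x \<in> carrier L \<Longrightarrow> y \<in> carrier P \<Longrightarrow> y' \<in> carrier P \<Longrightarrow> pP x (y \<oplus>\<^bsub>P\<^esub> y') = pP x y \<oplus>\<^bsub>TP\<^esub> pP x y'"
  "b \<in> carrier B \<Longrightarrow> x \<in> carrier L \<Longrightarrow> y \<in> carrier P \<Longrightarrow> pP (x \<cdot> t b) y = pP x (\<iota> b \<bullet> y)"
  using TP.pure_in_T[of x y] TP.pure_add_left[of x x' y] TP.pure_add_right[of x y y'] TP.pure_smult[of b x y]
  by simp_all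

lemma pN_simps:
  "x \<in> carrier L \<Longrightarrow> y \<in> N \<Longrightarrow> pN x y \<in> carrier TN"
  "x \<in> carrier L \<Longrightarrow> x' \<in> carrier L \<Longrightarrow> y \<in> N \<Longrightarrow> pN (x \<oplus>\<^bsub>L\<^esub> x') y = pN x y \<oplus>\<^bsub>TN\<^esub> pN x' y"
  "x \<in> carrier L \<Longrightarrow> y \<in> N \<Longrightarrow> y' \<in> N \<Longrightarrow> pN x (y \<oplus>\<^bsub>P\<^esub> y') = pN x y \<oplus>\<^bsub>TN\<^esub> pN x y'"
  "b \<in> carrier B \<Longrightarrow> x \<in> carrier L \<Longrightarrow> y \<in> N \<Longrightarrow> pN (x \<cdot> t b) y = pN x (\<iota> b \<bullet> y)"
  using TN.pure_in_T[of x y] TN.pure_add_left[of x x' y] TN.pure_add_right[of x y y'] TN.pure_smult[of b x y]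
  by simp_all

lemma pD_simps:
  "x \<in> carrier L \<Longrightarrow> y \<in> carrier D \<Longrightarrow> pD x y \<in> carrier TD"
  "x \<in> carrier L \<Longrightarrow> x' \<in> carrier L \<Longrightarrow> y \<in> carrier D \<Longrightarrow> pD (x \<oplus>\<^bsub>L\<^esub> x') y = pD x y \<oplus>\<^bsub>TD\<^esub> pD x' y"
  "x \<in> carrier L \<Longrightarrow> y \<in> carrier D \<Longrightarrow> y' \<in> carrier D \<Longrightarrow> pD x (y \<oplus>\<^bsub>D\<^esub> y') = pD x y \<oplus>\<^bsub>TD\<^esub> pD x y'"
  "b \<in> carrier B \<Longrightarrow> x \<in> carrier L \<Longrightarrow> y \<in> carrier D \<Longrightarrow> pD (x \<cdot> t b) y = pD x (opp_act b y)"
  using TD.pure_in_T[of x y] TD.pure_add_left[of x x' y] TD.pure_add_right[of x y y'] TD.pure_smult[of b x y]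
  by simp_all

text \<open>The flatness assumption is about modules on \<open>test_type\<close>. The modules to which it is applied are \<open>N\<close>,
\<open>P\<close> and \<open>L \<diamondop> P\<close>, which are embedded by means of lists of length one and two.\<close>

definition embed_P :: "'p \<Rightarrow> ('b, 'l, 'p) test_type" where
  "embed_P p = {frag_of [Inr (Inr p)]}"

lemma embed_P_inj: "inj_on embed_P C"
  by (auto simp: inj_on_def embed_P_def frag_of_eq)

definition embed_D :: "('l \<times> 'p \<Rightarrow>\<^sub>0 int) set \<Rightarrow> ('b, 'l, 'p) test_type" where
  "embed_D z = frag_extend (\<lambda>q. frag_of [Inr (Inl (fst q)), Inr (Inr (snd q))]) ` z"

lemma embed_D_inj: "inj_on embed_D C"
proof -
  let ?g = "\<lambda>q :: 'l \<times> 'p. [Inr (Inl (fst q)), Inr (Inr (snd q))] :: ('b + 'l + 'p) list"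
  have lk: "Poly_Mapping.lookup (frag_extend (\<lambda>q. frag_of (?g q)) c) (?g q) = Poly_Mapping.lookup c q" for c q
  proof (rule frag_induction[of c UNIV])
    show "Poly_Mapping.lookup (frag_extend (\<lambda>q. frag_of (?g q)) (a - b)) (?g q) = Poly_Mapping.lookup (a - b) q"
      if "Poly_Mapping.lookup (frag_extend (\<lambda>q. frag_of (?g q)) a) (?g q) = Poly_Mapping.lookup a q"
        "Poly_Mapping.lookup (frag_extend (\<lambda>q. frag_of (?g q)) b) (?g q) = Poly_Mapping.lookup b q" for a b
      using that by (simp add: frag_extend_diff lookup_minus)
  qed (auto simp: prod_eq_iff)
  have "inj (frag_extend (\<lambda>q. frag_of (?g q)))"
  proof (rule injI, rule poly_mapping_eqI)
    fix c c' q
    assume "frag_extend (\<lambda>q. frag_of (?g q)) c = frag_extend (\<lambda>q. frag_of (?g q)) c'"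
    from arg_cong[OF this, of "\<lambda>u. Poly_Mapping.lookup u (?g q)"]
    show "Poly_Mapping.lookup c q = Poly_Mapping.lookup c' q" by (simp only: lk)
  qed
  from inj_image_eq_iff[OF this] show ?thesis
    unfolding embed_D_def inj_on_def by blast
qed

definition "incl = tensor_map (opp B) RM VP (\<lambda>n. n)"

lemma incl_linear: "(\<lambda>n. n) \<in> linear_maps (opp B) VN VP"
  by (auto simp: linear_maps_def additive_maps_def N_simps)

lemma incl_pure: "x \<in> carrier L \<Longrightarrow> n \<in> N \<Longrightarrow> incl (pN x n) = pP x n"
  unfolding incl_def using tensor_map_pure[OF module_RM module_VN module_VP incl_linear, of x n] by simp

lemma incl_additive: "incl \<in> additive_maps TN TP"
  unfolding incl_def by (rule tensor_map_additive[OF module_RM module_VN module_VP incl_linear])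

text \<open>The tensor product with \<open>N\<close> may be computed inside that with \<open>P\<close>, by flatness.\<close>

lemma incl_inj: "inj_on incl (carrier TN)"
  unfolding incl_def
  by (rule flat_inj[OF flat module_VN module_VP embed_P_inj embed_P_inj incl_linear]) auto

end

section \<open>Colinear maps from the bialgebroid\<close>

text \<open>A cleaving map up to unitality and the bijectivity of \<open>J\<close>. The restriction of a normal basis
isomorphism to \<open>L \<otimes> 1\<close> is of this kind too, so both directions start from here.\<close>

locale colin = opp_alg K B L P \<iota>
  for K :: "('k, 'x) ring_scheme" and B :: "('k, 'b, 'y) module_scheme"
    and L :: "('k, 'b, 'l, 'z) bialgebroid_scheme"
    and P :: "('k, 'b, 'l, 'p, 'w) comodule_algebra_scheme" and \<iota> :: "'b \<Rightarrow> 'p" +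
  fixes \<gamma> :: "'l \<Rightarrow> 'p"
  assumes gamma_additive: "\<gamma> \<in> additive_maps L P"
    and gamma_s_left: "b \<in> carrier B \<Longrightarrow> x \<in> carrier L \<Longrightarrow> \<gamma> (s b \<cdot> x) = \<beta> b \<bullet> \<gamma> x"
    and gamma_s_right: "b \<in> carrier B \<Longrightarrow> x \<in> carrier L \<Longrightarrow> \<gamma> (x \<cdot> s b) = \<gamma> x \<bullet> \<beta> b"
    and gamma_t_left: "b \<in> carrier B \<Longrightarrow> x \<in> carrier L \<Longrightarrow> \<gamma> (t b \<cdot> x) = \<iota> b \<bullet> \<gamma> x"
    and gamma_t_right: "b \<in> carrier B \<Longrightarrow> x \<in> carrier L \<Longrightarrow> \<gamma> (x \<cdot> t b) = \<gamma> x \<bullet> \<iota> b"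
    and coact_gamma: "x \<in> carrier L \<Longrightarrow> \<rho> (\<gamma> x) = tensor_lift D (\<lambda>x1 x2. x1 \<diamondop> \<gamma> x2) (\<Delta> x)"
begin

lemma gamma_closed [simp]: "x \<in> carrier L \<Longrightarrow> \<gamma> x \<in> carrier P"
  by (rule additive_maps_closed[OF gamma_additive])

lemma gamma_add [simp]:
  "x \<in> carrier L \<Longrightarrow> y \<in> carrier L \<Longrightarrow> \<gamma> (x \<oplus>\<^bsub>L\<^esub> y) = \<gamma> x \<oplus>\<^bsub>P\<^esub> \<gamma> y"
  by (rule additive_maps_add[OF gamma_additive])

lemma bal_gamma: "LL.bal D (\<lambda>x1 x2. x1 \<diamondop> \<gamma> x2)"
  by (rule LL.balI) (simp_all add: dia_add_left dia_add_right gamma_s_left dia_balanced)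

text \<open>By colinearity of \<open>\<gamma>\<close>, sums over the coaction of \<open>\<gamma> x\<close> become sums over the comultiplication of \<open>x\<close>.\<close>

lemma additive_mult_by_gamma:
  assumes G: "abelian_group G" and h: "h \<in> additive_maps D G"
    and x: "x \<in> carrier L" and y: "y \<in> carrier L" and p: "p \<in> carrier P"
    and F: "\<And>x1 x2. x1 \<in> carrier L \<Longrightarrow> x2 \<in> carrier L \<Longrightarrow> h (x1 \<cdot> y \<diamondop> \<gamma> x2 \<bullet> p) = F x1 x2"
  shows "h (mult_by (\<rho> (\<gamma> x)) y p) = tensor_lift G F (\<Delta> x)"
  unfolding coact_gamma[OF x]
  by (rule LL.D.tensor_lift_comp_eq[OF D.group_T G bal_gamma additive_maps_comp[OF mult_by_additive[OF y p] h]])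
    (use x y p in \<open>simp_all add: F\<close>)

lemma additive_coact_gamma:
  assumes "abelian_group G" "h \<in> additive_maps D G" "x \<in> carrier L" "p \<in> carrier P"
    and "\<And>x1 x2. x1 \<in> carrier L \<Longrightarrow> x2 \<in> carrier L \<Longrightarrow> h (x1 \<diamondop> \<gamma> x2 \<bullet> p) = F x1 x2"
  shows "h (mult_right (\<rho> (\<gamma> x)) p) = tensor_lift G F (\<Delta> x)"
  using additive_mult_by_gamma[OF assms(1-3) L.one_closed assms(4), of F] assms(3-5) by (simp add: mult_by_one)

definition "jfun x p = mult_right (\<rho> (\<gamma> x)) p"

lemma jfun_balanced: "oppbal VP D jfun"
  unfolding jfun_def
  by (rule oppbalI)
    (simp_all add: gamma_t_right coact_mult_N iota_N mult_right_assoc additive_maps_add[OF d_additive]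
      additive_maps_add[OF mult_right_additive] additive_maps_add[OF mult_right_additive_factor])

text \<open>The map \<open>x \<otimes> p \<mapsto> x\<^sub>1 \<otimes> \<gamma> x\<^sub>2 p\<close> whose bijectivity is required of a cleaving map. It is written as the
coaction of \<open>\<gamma> x\<close> times \<open>p\<close>; this form makes the factorisation through the Galois map evident.\<close>

definition "J = tensor_lift D jfun"

lemma J_additive: "J \<in> additive_maps TP D"
  unfolding J_def by (rule TP.tensor_lift_additive[OF D.group_T jfun_balanced])

lemma J_closed [simp]: "z \<in> carrier TP \<Longrightarrow> J z \<in> carrier D"
  by (rule additive_maps_closed[OF J_additive])

lemma J_pure: "x \<in> carrier L \<Longrightarrow> p \<in> carrier P \<Longrightarrow> J (pP x p) = mult_right (\<rho> (\<gamma> x)) p"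
  unfolding J_def using TP.tensor_lift_pure[OF D.group_T jfun_balanced, of x p] by (simp add: jfun_def)

lemma J_literal:
  assumes z: "z \<in> carrier TP"
  shows "tensor_lift D (\<lambda>x p. tensor_lift D (\<lambda>x1 x2. x1 \<diamondop> \<gamma> x2 \<bullet> p) (\<Delta> x)) z = J z"
  unfolding J_def
  by (rule sym, rule TP.tensor_lift_cong[OF D.group_T jfun_balanced _ z])
    (use additive_coact_gamma[OF D.group_T, of "\<lambda>z. z", OF _ _ _ refl] in \<open>auto simp: jfun_def additive_maps_def\<close>)

lemma bal_TP_beta: "b \<in> carrier B \<Longrightarrow> oppbal VP TP (\<lambda>x p. pP x (\<beta> b \<bullet> p))"
  by (rule oppbalI) (simp_all add: pP_simps A.r_distr iota_beta_commute_left)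

lemma bal_shift: "b \<in> carrier B \<Longrightarrow> bal D (\<lambda>x p. x \<cdot> t b \<diamondop> p)"
  by (rule bal_left_right_shift)

text \<open>This is the Takeuchi condition on the coaction of \<open>\<gamma> x\<close>. It makes the inverse of \<open>J\<close> compatible with a
further factor \<open>L\<close> balanced over the target map.\<close>

lemma J_beta:
  assumes b: "b \<in> carrier B" and z: "z \<in> carrier TP"
  shows "J (tensor_lift TP (\<lambda>x p. pP x (\<beta> b \<bullet> p)) z) = tensor_lift D (\<lambda>x p. x \<cdot> t b \<diamondop> p) (J z)"
proof (rule TP.additive_maps_eqI[OF _ _ _ z])
  show "(\<lambda>z. J (tensor_lift TP (\<lambda>x p. pP x (\<beta> b \<bullet> p)) z)) \<in> additive_maps TP D"
    by (rule additive_maps_comp[OF TP.tensor_lift_additive[OF TP.group_T bal_TP_beta[OF b]] J_additive])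
  show "(\<lambda>z. tensor_lift D (\<lambda>x p. x \<cdot> t b \<diamondop> p) (J z)) \<in> additive_maps TP D"
    by (rule additive_maps_comp[OF J_additive D.tensor_lift_additive[OF D.group_T bal_shift[OF b]]])
  fix x p assume "x \<in> carrier RM" "p \<in> carrier VP"
  then have h: "x \<in> carrier L" "p \<in> carrier P" by auto
  have g: "\<rho> (\<gamma> x) \<in> takeuchi B L A'" "\<rho> (\<gamma> x) \<in> carrier D" using h d_takeuchi by simp_all
  have "J (tensor_lift TP (\<lambda>x p. pP x (\<beta> b \<bullet> p)) (pP x p)) = mult_right (\<rho> (\<gamma> x)) (\<beta> b \<bullet> p)"
    using h b by (simp add: TP.tensor_lift_pure[OF TP.group_T bal_TP_beta[OF b]] J_pure)
  also have "\<dots> = tensor_lift D (\<lambda>y a. y \<diamondop> (a \<bullet> \<beta> b) \<bullet> p) (\<rho> (\<gamma> x))"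
    unfolding mult_right_def
    by (rule D.tensor_lift_cong[OF D.group_T bal_mult_right_factor _ g(2)]) (use h b in \<open>simp_all add: A.m_assoc\<close>)
  also have "\<dots> = tensor_lift D (\<lambda>y a. y \<cdot> t b \<diamondop> a \<bullet> p) (\<rho> (\<gamma> x))"
    by (rule takeuchi_shift[OF D.group_T bal_mult_right_factor g(1) b, symmetric]) (use h in simp)
  also have "\<dots> = tensor_lift D (\<lambda>x p. x \<cdot> t b \<diamondop> p) (mult_right (\<rho> (\<gamma> x)) p)"
    by (rule additive_mult_right[OF D.group_T D.tensor_lift_additive[OF D.group_T bal_shift[OF b]] g(2) h(2), symmetric])
      (use h in \<open>simp add: lift_dia[OF D.group_T bal_shift[OF b]]\<close>)
  also have "\<dots> = tensor_lift D (\<lambda>x p. x \<cdot> t b \<diamondop> p) (J (pP x p))" using h by (simp add: J_pure)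
  finally show "J (tensor_lift TP (\<lambda>x p. pP x (\<beta> b \<bullet> p)) (pP x p)) =
      tensor_lift D (\<lambda>x p. x \<cdot> t b \<diamondop> p) (J (pP x p))" .
qed

lemma bal_phi: "oppbal VN P (\<lambda>x n. \<gamma> x \<bullet> n)"
  by (rule oppbalI) (simp_all add: N_simps A.l_distr A.r_distr gamma_t_right A.m_assoc)

text \<open>The candidate for the normal basis isomorphism.\<close>

definition "phi = tensor_lift P (\<lambda>x n. \<gamma> x \<bullet> n)"

lemma phi_additive: "phi \<in> additive_maps TN P"
  unfolding phi_def by (rule TN.tensor_lift_additive[OF group_P bal_phi])

lemma phi_closed [simp]: "z \<in> carrier TN \<Longrightarrow> phi z \<in> carrier P"
  by (rule additive_maps_closed[OF phi_additive])

lemma phi_pure: "x \<in> carrier L \<Longrightarrow> n \<in> N \<Longrightarrow> phi (pN x n) = \<gamma> x \<bullet> n"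
  unfolding phi_def using TN.tensor_lift_pure[OF group_P bal_phi, of x n] by simp

text \<open>Since \<open>N\<close> is coinvariant, the restriction of \<open>J\<close> to \<open>L \<otimes> N\<close> is \<open>phi\<close> followed by the coaction. As the
coaction is injective, this is what links the bijectivity of \<open>J\<close> to that of \<open>phi\<close>.\<close>

lemma coact_phi: "z \<in> carrier TN \<Longrightarrow> \<rho> (phi z) = J (incl z)"
  by (rule TN.additive_maps_eqI[OF additive_maps_comp[OF phi_additive d_additive]
        additive_maps_comp[OF incl_additive J_additive]])
    (simp_all add: phi_pure incl_pure J_pure N_simps coact_mult_N)

end

context comod_alg begin

abbreviation "PNP \<equiv> tensor (P\<lparr>carrier := N\<rparr>) (right_mult P id) (left_mult P id)"
abbreviation "pPNP \<equiv> pure_tensor (P\<lparr>carrier := N\<rparr>) (right_mult P id) (left_mult P id)"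

sublocale PNP: tensor_pair "P\<lparr>carrier := coinvariants B L P\<rparr>" "right_mult P id" "left_mult P id"
    "tensor (P\<lparr>carrier := coinvariants B L P\<rparr>) (right_mult P id) (left_mult P id)"
  by (rule tensor_pair_tensor)
    (auto simp: N_simps intro: abelian_group_left_mult abelian_group_right_mult ring_A)

lemma pPNP_simps:
  "p \<in> carrier P \<Longrightarrow> q \<in> carrier P \<Longrightarrow> pPNP p q \<in> carrier PNP"
  "p \<in> carrier P \<Longrightarrow> p' \<in> carrier P \<Longrightarrow> q \<in> carrier P \<Longrightarrow> pPNP (p \<oplus>\<^bsub>P\<^esub> p') q = pPNP p q \<oplus>\<^bsub>PNP\<^esub> pPNP p' q"
  "p \<in> carrier P \<Longrightarrow> q \<in> carrier P \<Longrightarrow> q' \<in> carrier P \<Longrightarrow> pPNP p (q \<oplus>\<^bsub>P\<^esub> q') = pPNP p q \<oplus>\<^bsub>PNP\<^esub> pPNP p q'"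
  "n \<in> N \<Longrightarrow> p \<in> carrier P \<Longrightarrow> q \<in> carrier P \<Longrightarrow> pPNP (p \<bullet> n) q = pPNP p (n \<bullet> q)"
  using PNP.pure_in_T[of p q] PNP.pure_add_left[of p p' q] PNP.pure_add_right[of p q q'] PNP.pure_smult[of n p q]
  by simp_all

definition "kappa_fun p q = mult_right (\<rho> p) q"

lemma kappa_balanced: "balanced (P\<lparr>carrier := N\<rparr>) (right_mult P id) (left_mult P id) D kappa_fun"
  unfolding kappa_fun_def
  by (rule balancedI)
    (simp_all add: coact_mult_N mult_right_assoc N_simps additive_maps_add[OF d_additive]
      additive_maps_add[OF mult_right_additive] additive_maps_add[OF mult_right_additive_factor])

text \<open>The Galois map of the extension.\<close>

definition "kappa = tensor_lift D kappa_fun"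

lemma kappa_additive: "kappa \<in> additive_maps PNP D"
  unfolding kappa_def by (rule PNP.tensor_lift_additive[OF D.group_T kappa_balanced])

lemma kappa_pure: "p \<in> carrier P \<Longrightarrow> q \<in> carrier P \<Longrightarrow> kappa (pPNP p q) = mult_right (\<rho> p) q"
  unfolding kappa_def using PNP.tensor_lift_pure[OF D.group_T kappa_balanced, of p q] by (simp add: kappa_fun_def)

lemma Galois_iff: "left_Galois_extension B L P \<longleftrightarrow> bij_betw kappa (carrier PNP) (carrier D)"
proof -
  have "tensor_lift D (\<lambda>p q. tensor_lift D (\<lambda>x p'. x \<diamondop> p' \<bullet> q) (\<rho> p)) = kappa"
    by (simp add: kappa_def kappa_fun_def[abs_def] mult_right_def)
  then show ?thesis by (simp add: left_Galois_extension_def Let_def)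
qed

end

context colin begin

definition "theta_fun x p = pPNP (\<gamma> x) p"

lemma theta_balanced: "oppbal VP PNP theta_fun"
  unfolding theta_fun_def by (rule oppbalI) (simp_all add: pPNP_simps gamma_t_right iota_N)

definition "theta = tensor_lift PNP theta_fun"

lemma theta_additive: "theta \<in> additive_maps TP PNP"
  unfolding theta_def by (rule TP.tensor_lift_additive[OF PNP.group_T theta_balanced])

lemma theta_pure: "x \<in> carrier L \<Longrightarrow> p \<in> carrier P \<Longrightarrow> theta (pP x p) = pPNP (\<gamma> x) p"
  unfolding theta_def using TP.tensor_lift_pure[OF PNP.group_T theta_balanced, of x p] by (simp add: theta_fun_def)

lemma kappa_theta: "z \<in> carrier TP \<Longrightarrow> kappa (theta z) = J z"
  by (rule TP.additive_maps_eqI[OF additive_maps_comp[OF theta_additive kappa_additive] J_additive])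
    (simp_all add: theta_pure kappa_pure J_pure)

text \<open>If \<open>p\<close> is a sum of terms \<open>\<gamma> x n\<close>, then \<open>p \<otimes> q\<close> is the corresponding sum of terms \<open>\<gamma> x \<otimes> n q\<close>.\<close>

lemma theta_surj:
  assumes phi: "carrier P \<subseteq> phi ` carrier TN" and w: "w \<in> carrier PNP"
  shows "w \<in> theta ` carrier TP"
proof -
  interpret TPg: abelian_group TP by (rule TP.group_T)
  have closed: "u \<oplus>\<^bsub>PNP\<^esub> v \<in> theta ` carrier TP" if "u \<in> theta ` carrier TP" "v \<in> theta ` carrier TP" for u v
    using that by (auto simp: additive_maps_add[OF theta_additive, symmetric])
  have "pPNP (phi z) q \<in> theta ` carrier TP" if "z \<in> carrier TN" "q \<in> carrier P" for z q
    using that(1)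
  proof (induction rule: TN.tensor_induct)
    case (pure x n)
    then have "pPNP (phi (pN x n)) q = theta (pP x (n \<bullet> q))"
      using that by (simp add: phi_pure theta_pure pPNP_simps N_simps)
    moreover have "pP x (n \<bullet> q) \<in> carrier TP" using pure that by (simp add: pP_simps N_simps)
    ultimately show ?case by (rule image_eqI)
  next
    case (add y z)
    have "pPNP (phi (y \<oplus>\<^bsub>TN\<^esub> z)) q = pPNP (phi y) q \<oplus>\<^bsub>PNP\<^esub> pPNP (phi z) q"
      using add that by (simp add: additive_maps_add[OF phi_additive] pPNP_simps)
    with closed[OF add(3,4)] show ?case by (simp only:)
  qed
  then have pure: "pPNP p q \<in> theta ` carrier TP" if "p \<in> carrier P" "q \<in> carrier P" for p q
    using that phi by auto
  show ?thesis using w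
    by (induction rule: PNP.tensor_induct) (use pure closed in auto)
qed

end

section \<open>Cleft extensions have a normal basis\<close>

text \<open>The crux is the surjectivity of \<open>phi\<close>. Given \<open>p\<close>, the element \<open>nu (\<rho> p)\<close> of \<open>L \<otimes> P\<close> should lie in
\<open>L \<otimes> N\<close>. Now \<open>N\<close> is the kernel of \<open>p \<mapsto> \<rho> p - 1 \<otimes> p\<close>, a linear map over the opposite of \<open>B\<close>, so by flatness
it suffices that \<open>x \<otimes> \<rho> p'\<close> and \<open>x \<otimes> (1 \<otimes> p')\<close> have the same sum over \<open>nu (\<rho> p) = x \<otimes> p'\<close> in
\<open>L \<otimes> (L \<diamondop> P)\<close>.

This is tested by the map \<open>twist\<close> from \<open>L \<otimes> (L \<diamondop> P)\<close> to \<open>L \<diamondop> (L \<diamondop> P)\<close> with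
\<open>twist x (y \<otimes> p) = x\<^sub>1 \<otimes> (x\<^sub>2 y \<otimes> \<gamma> x\<^sub>3 p)\<close>. It takes the two families to the two sides of the
coassociativity equation of \<open>p\<close>. It is injective because it is \<open>J\<close> on the factors \<open>x\<close> and \<open>p\<close> followed
by \<open>Lam\<close> on the first two factors; the inverses \<open>mu\<close> and \<open>nu\<close> combine to a left inverse \<open>untwist\<close>.\<close>

locale cleft = colin K B L P \<iota> \<gamma> + hopf K B L
  for K :: "('k, 'x) ring_scheme" and B :: "('k, 'b, 'y) module_scheme"
    and L :: "('k, 'b, 'l, 'z) bialgebroid_scheme"
    and P :: "('k, 'b, 'l, 'p, 'w) comodule_algebra_scheme" and \<iota> :: "'b \<Rightarrow> 'p" and \<gamma> :: "'l \<Rightarrow> 'p" +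
  assumes J_bij: "bij_betw J (carrier TP) (carrier D)"
begin

definition "nu = inv_into (carrier TP) J"

lemma nu_additive: "nu \<in> additive_maps D TP"
  unfolding nu_def by (rule additive_maps_inv_into[OF TP.group_T J_additive J_bij])

lemma nu_closed [simp]: "w \<in> carrier D \<Longrightarrow> nu w \<in> carrier TP"
  by (rule additive_maps_closed[OF nu_additive])

lemma nu_J: "z \<in> carrier TP \<Longrightarrow> nu (J z) = z"
  unfolding nu_def by (rule inv_into_f_f[OF bij_betw_imp_inj_on[OF J_bij]])

lemma J_nu: "w \<in> carrier D \<Longrightarrow> J (nu w) = w"
  unfolding nu_def using J_bij by (metis bij_betw_inv_into_right)

lemma bal_insert: "y \<in> carrier L \<Longrightarrow> oppbal VP TD (\<lambda>x p. pD x (y \<diamondop> p))"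
  by (rule oppbalI) (simp_all add: pD_simps dia_add_right)

text \<open>Apply \<open>nu\<close> to \<open>w\<close> and put \<open>y\<close> in front of the second factor of the result.\<close>

definition "insert_nu y w = tensor_lift TD (\<lambda>x p. pD x (y \<diamondop> p)) (nu w)"

lemma insert_nu_additive: "y \<in> carrier L \<Longrightarrow> insert_nu y \<in> additive_maps D TD"
  unfolding insert_nu_def by (rule additive_maps_comp[OF nu_additive TP.tensor_lift_additive[OF TD.group_T bal_insert]])

lemma insert_nu_additive_left: "w \<in> carrier D \<Longrightarrow> (\<lambda>y. insert_nu y w) \<in> additive_maps L TD"
  unfolding insert_nu_def
  by (rule TP.tensor_lift_param[OF TD.group_T bal_insert])
    (auto intro!: additive_mapsI simp: dia_add_left pD_simps)

lemma insert_nu_closed [simp]: "y \<in> carrier L \<Longrightarrow> w \<in> carrier D \<Longrightarrow> insert_nu y w \<in> carrier TD"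
  by (rule additive_maps_closed[OF insert_nu_additive])

lemma insert_nu_J: "y \<in> carrier L \<Longrightarrow> x \<in> carrier L \<Longrightarrow> p \<in> carrier P \<Longrightarrow> insert_nu y (mult_right (\<rho> (\<gamma> x)) p) = pD x (y \<diamondop> p)"
  using nu_J[of "pP x p"] TP.tensor_lift_pure[OF TD.group_T bal_insert, of y x p]
  by (simp add: insert_nu_def J_pure pP_simps)

lemma insert_nu_shift:
  assumes y: "y \<in> carrier L" and b: "b \<in> carrier B" and w: "w \<in> carrier D"
  shows "insert_nu y (tensor_lift D (\<lambda>x p. x \<cdot> t b \<diamondop> p) w) = insert_nu (t b \<cdot> y) w"
proof -
  let ?z = "tensor_lift TP (\<lambda>x p. pP x (\<beta> b \<bullet> p)) (nu w)"
  have z: "?z \<in> carrier TP" by (rule TP.tensor_lift_closed[OF TP.group_T bal_TP_beta[OF b]]) (use w in simp)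
  have "nu (tensor_lift D (\<lambda>x p. x \<cdot> t b \<diamondop> p) w) = ?z"
    using J_beta[OF b nu_closed[OF w]] nu_J[OF z] by (simp add: J_nu w)
  then show ?thesis
    using TP.tensor_lift_comp_eq[OF TP.group_T TD.group_T bal_TP_beta[OF b]
        TP.tensor_lift_additive[OF TD.group_T bal_insert[OF y]] nu_closed[OF w],
        of "\<lambda>x p. pD x (t b \<cdot> y \<diamondop> p)"] y b
    by (simp add: insert_nu_def TP.tensor_lift_pure[OF TD.group_T bal_insert[OF y]] dia_balanced)
qed

lemma bal_insert_nu: "p \<in> carrier P \<Longrightarrow> oppbal LM TD (\<lambda>u v. insert_nu v (u \<diamondop> p))"
proof (rule oppbalI)
  fix b u v assume h: "p \<in> carrier P" "b \<in> carrier B" "u \<in> carrier L" "v \<in> carrier LM"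
  then show "insert_nu v (u \<cdot> t b \<diamondop> p) = insert_nu (b \<odot>\<^bsub>LM\<^esub> v) (u \<diamondop> p)"
    using insert_nu_shift[of v b "u \<diamondop> p"] by (simp add: lift_dia[OF D.group_T bal_shift])
qed (auto simp: dia_add_left additive_maps_add[OF insert_nu_additive] additive_maps_add[OF insert_nu_additive_left])

text \<open>First \<open>mu\<close> on the factors \<open>x\<close> and \<open>y\<close>, then \<open>nu\<close> on the outer two.\<close>

definition "untwist_fun x y p = tensor_lift TD (\<lambda>u v. insert_nu v (u \<diamondop> p)) (mu (LL.dia x y))"

lemma lift_insert_nu_mu_additive: 
  "p \<in> carrier P \<Longrightarrow> (\<lambda>w. tensor_lift TD (\<lambda>u v. insert_nu v (u \<diamondop> p)) (mu w)) \<in> additive_maps LL.D TD"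
  by (rule additive_maps_comp[OF mu_additive TL.tensor_lift_additive[OF TD.group_T bal_insert_nu]])

lemma untwist_fun_closed: "x \<in> carrier L \<Longrightarrow> y \<in> carrier L \<Longrightarrow> p \<in> carrier P \<Longrightarrow> untwist_fun x y p \<in> carrier TD"
  unfolding untwist_fun_def by (rule additive_maps_closed[OF lift_insert_nu_mu_additive]) auto

lemma untwist_fun_add_left:
  assumes "x \<in> carrier L" "x' \<in> carrier L" "y \<in> carrier L" "p \<in> carrier P"
  shows "untwist_fun (x \<oplus>\<^bsub>L\<^esub> x') y p = untwist_fun x y p \<oplus>\<^bsub>TD\<^esub> untwist_fun x' y p"
  using assms additive_maps_add[OF lift_insert_nu_mu_additive[OF assms(4)]] by (simp add: untwist_fun_def LL.dia_add_left)

lemma untwist_fun_add_middle: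
  assumes "x \<in> carrier L" "y \<in> carrier L" "y' \<in> carrier L" "p \<in> carrier P"
  shows "untwist_fun x (y \<oplus>\<^bsub>L\<^esub> y') p = untwist_fun x y p \<oplus>\<^bsub>TD\<^esub> untwist_fun x y' p"
  using assms additive_maps_add[OF lift_insert_nu_mu_additive[OF assms(4)]] by (simp add: untwist_fun_def LL.dia_add_right)

lemma untwist_fun_add_right:
  assumes "x \<in> carrier L" "y \<in> carrier L" "p \<in> carrier P" "p' \<in> carrier P"
  shows "untwist_fun x y (p \<oplus>\<^bsub>P\<^esub> p') = untwist_fun x y p \<oplus>\<^bsub>TD\<^esub> untwist_fun x y p'"
proof -
  have "(\<lambda>p. untwist_fun x y p) \<in> additive_maps P TD"
    unfolding untwist_fun_def
    by (rule TL.tensor_lift_param[OF TD.group_T bal_insert_nu])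
      (use assms in \<open>auto intro!: additive_mapsI simp: dia_add_right additive_maps_add[OF insert_nu_additive]\<close>)
  then show ?thesis using assms by (simp add: additive_maps_add)
qed

lemmas untwist_fun_add = untwist_fun_add_left untwist_fun_add_middle untwist_fun_add_right

lemma untwist_fun_balanced:
  assumes "x \<in> carrier L" "y \<in> carrier L" "p \<in> carrier P" "b \<in> carrier B"
  shows "untwist_fun (t b \<cdot> x) y p = untwist_fun x (s b \<cdot> y) p"
    and "untwist_fun x (t b \<cdot> y) p = untwist_fun x y (\<beta> b \<bullet> p)"
proof -
  show "untwist_fun (t b \<cdot> x) y p = untwist_fun x (s b \<cdot> y) p"
    using assms by (simp add: untwist_fun_def LL.dia_balanced)
  have "LL.dia x (t b \<cdot> y) = tensor_lift LL.D (\<lambda>x1 x2. LL.dia x1 (t b \<cdot> x2)) (LL.dia x y)"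
    using assms by (simp add: LL.lift_dia[OF LL.D.group_T bal_t])
  then have "untwist_fun x (t b \<cdot> y) p = tensor_lift TD (\<lambda>u v. insert_nu v (t b \<cdot> u \<diamondop> p)) (mu (LL.dia x y))"
    unfolding untwist_fun_def using lift_mu_left[OF TD.group_T bal_insert_nu[OF assms(3)], of "LL.dia x y" b] assms by simp
  also have "\<dots> = untwist_fun x y (\<beta> b \<bullet> p)"
    unfolding untwist_fun_def
    by (rule sym, rule TL.tensor_lift_cong[OF TD.group_T bal_insert_nu]) (use assms in \<open>simp_all add: dia_balanced\<close>)
  finally show "untwist_fun x (t b \<cdot> y) p = untwist_fun x y (\<beta> b \<bullet> p)" .
qed

lemma untwist_fun_trilinear: "trilinear TD untwist_fun"
  unfolding trilinear_def
  by (auto intro!: balI additive_mapsI simp: untwist_fun_closed untwist_fun_add untwist_fun_balanced)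

definition "untwist = tensor_lift TD (\<lambda>x. tensor_lift TD (untwist_fun x))"

lemma untwist_additive: "untwist \<in> additive_maps DD TD"
  unfolding untwist_def by (rule DD.tensor_lift_additive[OF TD.group_T trilinear_outer[OF TD.group_T untwist_fun_trilinear]])

lemma untwist_pure: "x \<in> carrier L \<Longrightarrow> z \<in> carrier D \<Longrightarrow> untwist (x \<diamondop>\<diamondop> z) = tensor_lift TD (untwist_fun x) z"
  unfolding untwist_def
  using DD.tensor_lift_pure[OF TD.group_T trilinear_outer[OF TD.group_T untwist_fun_trilinear], of x z] by simp

text \<open>Left multiplication by the coaction of \<open>\<gamma> x\<close>. By colinearity it is \<open>y \<otimes> p \<mapsto> x\<^sub>1 y \<otimes> \<gamma> x\<^sub>2 p\<close>; written
  as a componentwise product it is visibly well defined.\<close>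

definition "gamma_act x z = tensor_lift D (mult_by (\<rho> (\<gamma> x))) z"

lemma bal_gamma_act: "x \<in> carrier L \<Longrightarrow> bal D (mult_by (\<rho> (\<gamma> x)))"
  by (rule bal_mult_by[OF d_takeuchi]) simp

lemma gamma_act_pure: "x \<in> carrier L \<Longrightarrow> y \<in> carrier L \<Longrightarrow> p \<in> carrier P \<Longrightarrow> gamma_act x (y \<diamondop> p) = mult_by (\<rho> (\<gamma> x)) y p"
  by (simp add: gamma_act_def lift_dia[OF D.group_T bal_gamma_act])

lemma gamma_act_additive: "x \<in> carrier L \<Longrightarrow> gamma_act x \<in> additive_maps D D"
  unfolding gamma_act_def by (rule D.tensor_lift_additive[OF D.group_T bal_gamma_act])

lemma gamma_act_closed [simp]: "x \<in> carrier L \<Longrightarrow> z \<in> carrier D \<Longrightarrow> gamma_act x z \<in> carrier D"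
  by (rule additive_maps_closed[OF gamma_act_additive])

lemma gamma_act_additive_left: "z \<in> carrier D \<Longrightarrow> (\<lambda>x. gamma_act x z) \<in> additive_maps L D"
  unfolding gamma_act_def
  by (rule D.tensor_lift_param[OF D.group_T bal_gamma_act])
    (auto intro!: additive_mapsI simp: additive_maps_add[OF d_additive] additive_maps_add[OF mult_by_additive])

lemma gamma_act_s:
  assumes "b \<in> carrier B" "x \<in> carrier L" "z \<in> carrier D"
  shows "gamma_act (s b \<cdot> x) z = b \<odot>\<^bsub>D\<^esub> gamma_act x z"
  by (rule D.additive_maps_eqI[OF gamma_act_additive additive_maps_comp[OF gamma_act_additive D_smult_additive]])
    (use assms in \<open>simp_all add: gamma_act_pure gamma_s_left d_base mult_by_smult\<close>)

lemma gamma_act_coact: "x \<in> carrier L \<Longrightarrow> p \<in> carrier P \<Longrightarrow> gamma_act x (\<rho> p) = \<rho> (\<gamma> x \<bullet> p)"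
  by (simp add: gamma_act_def d_mult takeuchi_mult_eq)

lemma bal_twist: "z \<in> carrier D \<Longrightarrow> LL.bal DD (\<lambda>x1 x2. x1 \<diamondop>\<diamondop> gamma_act x2 z)"
  by (rule LL.balI)
    (simp_all add: ddia_add_left ddia_add_right additive_maps_add[OF gamma_act_additive_left] ddia_balanced gamma_act_s)

definition "twist x z = tensor_lift DD (\<lambda>x1 x2. x1 \<diamondop>\<diamondop> gamma_act x2 z) (\<Delta> x)"

lemma D_add_closed: "z \<in> carrier D \<Longrightarrow> w \<in> carrier D \<Longrightarrow> z \<oplus>\<^bsub>D\<^esub> w \<in> carrier D"
  by (rule abelian_monoid.a_closed[OF abelian_group.axioms(1)[OF D.group_T]])

lemma twist_additive: "x \<in> carrier L \<Longrightarrow> twist x \<in> additive_maps D DD"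
  unfolding twist_def
  by (rule LL.D.tensor_lift_param[OF DD.group_T bal_twist])
    (auto intro!: additive_mapsI simp: additive_maps_add[OF gamma_act_additive] ddia_add_right D_add_closed)

lemma untwist_twist_pure:
  assumes x: "x \<in> carrier L" and y: "y \<in> carrier L" and p: "p \<in> carrier P"
  shows "untwist (twist x (y \<diamondop> p)) = pD x (y \<diamondop> p)"
proof -
  have yp: "y \<diamondop> p \<in> carrier D" using y p by simp
  \<comment> \<open>\<open>untwist\<close> turns \<open>twist\<close> into this sum over \<open>x\<^sub>1, x\<^sub>2, x\<^sub>3\<close>. Regrouped by coassociativity, \<open>mu\<close> cancels
    \<open>x\<^sub>2\<close> against \<open>x\<^sub>1\<close>, and then \<open>nu\<close> cancels what is left, namely \<open>J (x \<otimes> p)\<close>.\<close>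
  let ?F = "\<lambda>x1 x2 x3. untwist_fun x1 (x2 \<cdot> y) (\<gamma> x3 \<bullet> p)"
  have F: "LL.trilinear TD ?F"
    unfolding LL.trilinear_def
    by (auto intro!: LL.balI additive_mapsI
        simp: untwist_fun_closed untwist_fun_add untwist_fun_balanced y p L.l_distr A.l_distr L.m_assoc A.m_assoc gamma_s_left)
  have hadd: "tensor_lift TD (untwist_fun x1) \<in> additive_maps D TD" if "x1 \<in> carrier L" for x1
    by (rule D.tensor_lift_additive[OF TD.group_T trilinear_bal[OF untwist_fun_trilinear that]])
  have "untwist (twist x (y \<diamondop> p)) = tensor_lift TD (\<lambda>x1 x2. tensor_lift TD (?F x1) (\<Delta> x2)) (\<Delta> x)"
    unfolding twist_def
  proof (rule LL.D.tensor_lift_comp_eq[OF DD.group_T TD.group_T bal_twist[OF yp] untwist_additive])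
    fix x1 x2 assume "x1 \<in> carrier LM" "x2 \<in> carrier LL.A'"
    then have c: "x1 \<in> carrier L" "x2 \<in> carrier L" by auto
    have "untwist (x1 \<diamondop>\<diamondop> gamma_act x2 (y \<diamondop> p)) = tensor_lift TD (untwist_fun x1) (mult_by (\<rho> (\<gamma> x2)) y p)"
      using c y p by (simp add: untwist_pure gamma_act_pure)
    also have "\<dots> = tensor_lift TD (?F x1) (\<Delta> x2)"
      by (rule additive_mult_by_gamma[OF TD.group_T hadd[OF c(1)] c(2) y p])
        (use c y p in \<open>simp add: lift_dia[OF TD.group_T trilinear_bal[OF untwist_fun_trilinear]]\<close>)
    finally show "untwist (x1 \<diamondop>\<diamondop> gamma_act x2 (y \<diamondop> p)) = tensor_lift TD (?F x1) (\<Delta> x2)" .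
  qed (use x in simp)
  also have "\<dots> = tensor_lift TD (\<lambda>x1 x3. tensor_lift TD (\<lambda>a c. ?F a c x3) (\<Delta> x1)) (\<Delta> x)"
    by (rule LL.coassoc[OF TD.group_T F x, symmetric])
  also have "\<dots> = tensor_lift TD (\<lambda>x1 x3. insert_nu y (x1 \<diamondop> \<gamma> x3 \<bullet> p)) (\<Delta> x)"
  proof (rule LL.D.tensor_lift_cong[OF TD.group_T LL.bal_comult[OF TD.group_T F]])
    fix x1 x3 assume "x1 \<in> carrier LM" "x3 \<in> carrier LL.A'"
    then have c: "x1 \<in> carrier L" "\<gamma> x3 \<bullet> p \<in> carrier P" using p by auto
    show "tensor_lift TD (\<lambda>a c. ?F a c x3) (\<Delta> x1) = insert_nu y (x1 \<diamondop> \<gamma> x3 \<bullet> p)"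
      unfolding untwist_fun_def by (rule mu_cancel[OF TD.group_T bal_insert_nu[OF c(2)] c(1) y])
  qed (use x in simp)
  also have "\<dots> = insert_nu y (mult_right (\<rho> (\<gamma> x)) p)"
    by (rule additive_coact_gamma[OF TD.group_T insert_nu_additive[OF y] x p refl, symmetric])
  also have "\<dots> = pD x (y \<diamondop> p)" by (rule insert_nu_J[OF y x p])
  finally show ?thesis .
qed

lemma pD_additive: "x \<in> carrier L \<Longrightarrow> pD x \<in> additive_maps D TD"
  by (auto intro!: additive_mapsI simp: pD_simps)

lemma untwist_twist: "x \<in> carrier L \<Longrightarrow> z \<in> carrier D \<Longrightarrow> untwist (twist x z) = pD x z"
  by (rule D.additive_maps_eqI[OF additive_maps_comp[OF twist_additive untwist_additive] pD_additive])
    (simp_all add: untwist_twist_pure)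

lemma bal_id_coact: "bal DD (\<lambda>x p. x \<diamondop>\<diamondop> \<rho> p)"
  by (rule balI) (simp_all add: ddia_add_left ddia_add_right additive_maps_add[OF d_additive] ddia_balanced d_base)

lemma bal_comult_id: "bal DD (\<lambda>x p. tensor_lift DD (\<lambda>x1 x2. x1 \<diamondop>\<diamondop> (x2 \<diamondop> p)) (\<Delta> x))"
  by (rule bal_comult[OF DD.group_T trilinear_pure])

lemma twist_coact:
  assumes x: "x \<in> carrier L" and p: "p \<in> carrier P"
  shows "twist x (\<rho> p) = tensor_lift DD (\<lambda>x p. x \<diamondop>\<diamondop> \<rho> p) (J (pP x p))"
  unfolding J_pure[OF x p] twist_def
  by (rule additive_coact_gamma[OF DD.group_T D.tensor_lift_additive[OF DD.group_T bal_id_coact] x p, symmetric])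
    (use p in \<open>simp add: lift_dia[OF DD.group_T bal_id_coact] gamma_act_coact\<close>)

lemma twist_one:
  assumes x: "x \<in> carrier L" and p: "p \<in> carrier P"
  shows "twist x (\<one>\<^bsub>L\<^esub> \<diamondop> p) = tensor_lift DD (\<lambda>x p. tensor_lift DD (\<lambda>x1 x2. x1 \<diamondop>\<diamondop> (x2 \<diamondop> p)) (\<Delta> x)) (J (pP x p))"
proof -
  let ?F = "\<lambda>x1 x2 x3. x1 \<diamondop>\<diamondop> (x2 \<diamondop> \<gamma> x3 \<bullet> p)"
  have F: "LL.trilinear DD ?F"
    unfolding LL.trilinear_def
    by (auto intro!: LL.balI additive_mapsI simp: p dia_add_left dia_add_right ddia_add_left ddia_add_right
      ddia_balanced dia_balanced A.l_distr A.m_assoc gamma_s_left)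
  have add: "(\<lambda>z. x1 \<diamondop>\<diamondop> z) \<in> additive_maps D DD" if "x1 \<in> carrier L" for x1
    using that by (auto intro!: additive_mapsI simp: ddia_add_right)
  have "tensor_lift DD (\<lambda>x p. tensor_lift DD (\<lambda>x1 x2. x1 \<diamondop>\<diamondop> (x2 \<diamondop> p)) (\<Delta> x)) (J (pP x p))
      = tensor_lift DD (\<lambda>x1 x3. tensor_lift DD (\<lambda>a c. ?F a c x3) (\<Delta> x1)) (\<Delta> x)"
    unfolding J_pure[OF x p]
    by (rule additive_coact_gamma[OF DD.group_T D.tensor_lift_additive[OF DD.group_T bal_comult_id] x p])
      (use p in \<open>simp add: lift_dia[OF DD.group_T bal_comult_id]\<close>)
  also have "\<dots> = tensor_lift DD (\<lambda>x1 x2. tensor_lift DD (?F x1) (\<Delta> x2)) (\<Delta> x)"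
    by (rule LL.coassoc[OF DD.group_T F x])
  also have "\<dots> = twist x (\<one>\<^bsub>L\<^esub> \<diamondop> p)"
    unfolding twist_def
  proof (rule sym, rule LL.D.tensor_lift_cong[OF DD.group_T bal_twist])
    fix x1 x2 assume "x1 \<in> carrier LM" "x2 \<in> carrier LL.A'"
    then have c: "x1 \<in> carrier L" "x2 \<in> carrier L" by auto
    have "x1 \<diamondop>\<diamondop> gamma_act x2 (\<one>\<^bsub>L\<^esub> \<diamondop> p) = x1 \<diamondop>\<diamondop> mult_right (\<rho> (\<gamma> x2)) p"
      using c p by (simp add: gamma_act_pure mult_by_one)
    also have "\<dots> = tensor_lift DD (?F x1) (\<Delta> x2)"
      by (rule additive_coact_gamma[OF DD.group_T add[OF c(1)] c(2) p refl])
    finally show "x1 \<diamondop>\<diamondop> gamma_act x2 (\<one>\<^bsub>L\<^esub> \<diamondop> p) = tensor_lift DD (?F x1) (\<Delta> x2)" .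
  qed (use x p in simp_all)
  finally show ?thesis by simp
qed

lemma coact_iota: "b \<in> carrier B \<Longrightarrow> p \<in> carrier P \<Longrightarrow> \<rho> (\<iota> b \<bullet> p) = opp_act b (\<rho> p)"
  using d_coinvariant_mult(2)[of p "\<iota> b"] iota_N by (simp add: opp_act_def N_simps)

lemma coact_balanced: "oppbal VP TD (\<lambda>x p. pD x (\<rho> p))" "oppbal VP TD (\<lambda>x p. pD x (\<one>\<^bsub>L\<^esub> \<diamondop> p))"
  by (rule oppbalI, simp_all add: pD_simps additive_maps_add[OF d_additive] coact_iota)
    (rule bal_insert[OF L.one_closed])

text \<open>After \<open>twist\<close> the two sides become \<open>(id \<otimes> \<rho>) (\<rho> p)\<close> and \<open>(\<Delta> \<otimes> id) (\<rho> p)\<close>.\<close>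

lemma lift_coact_eq:
  assumes p: "p \<in> carrier P"
  shows "tensor_lift TD (\<lambda>x p. pD x (\<rho> p)) (nu (\<rho> p)) = tensor_lift TD (\<lambda>x p. pD x (\<one>\<^bsub>L\<^esub> \<diamondop> p)) (nu (\<rho> p))"
proof -
  have J: "J (nu (\<rho> p)) = \<rho> p" using p by (simp add: J_nu)
  have "tensor_lift TD (\<lambda>x p. pD x (\<rho> p)) z = untwist (tensor_lift DD (\<lambda>x p. x \<diamondop>\<diamondop> \<rho> p) (J z))"
    if "z \<in> carrier TP" for z
    by (rule TP.additive_maps_eqI[OF TP.tensor_lift_additive[OF TD.group_T coact_balanced(1)]
          additive_maps_comp[OF J_additive additive_maps_comp[OF D.tensor_lift_additive[OF DD.group_T bal_id_coact] untwist_additive]] _ that])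
      (simp add: twist_coact[symmetric] untwist_twist TP.tensor_lift_pure[OF TD.group_T coact_balanced(1)])
  moreover have "tensor_lift TD (\<lambda>x p. pD x (\<one>\<^bsub>L\<^esub> \<diamondop> p)) z
      = untwist (tensor_lift DD (\<lambda>x p. tensor_lift DD (\<lambda>x1 x2. x1 \<diamondop>\<diamondop> (x2 \<diamondop> p)) (\<Delta> x)) (J z))"
    if "z \<in> carrier TP" for z
    by (rule TP.additive_maps_eqI[OF TP.tensor_lift_additive[OF TD.group_T coact_balanced(2)]
          additive_maps_comp[OF J_additive additive_maps_comp[OF D.tensor_lift_additive[OF DD.group_T bal_comult_id] untwist_additive]] _ that])
      (simp add: twist_one[symmetric] untwist_twist TP.tensor_lift_pure[OF TD.group_T coact_balanced(2)])
  moreover have "tensor_lift DD (\<lambda>x p. tensor_lift DD (\<lambda>x1 x2. x1 \<diamondop>\<diamondop> (x2 \<diamondop> p)) (\<Delta> x)) (\<rho> p)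
      = tensor_lift DD (\<lambda>x p. x \<diamondop>\<diamondop> \<rho> p) (\<rho> p)"
    using d_coassoc p by (simp add: coassociative_def Let_def)
  ultimately show ?thesis using p by (simp add: J)
qed

lemma phi_surj:
  assumes p: "p \<in> carrier P"
  shows "p \<in> phi ` carrier TN"
proof -
  interpret Dg: abelian_group D by (rule D.group_T)
  interpret TDg: abelian_group TD by (rule TD.group_T)
  let ?\<delta> = "\<lambda>p. \<rho> p \<ominus>\<^bsub>D\<^esub> (\<one>\<^bsub>L\<^esub> \<diamondop> p)"
  have \<delta>: "?\<delta> \<in> linear_maps (opp B) VP VD"
  proof (rule linear_mapsI)
    show "?\<delta> \<in> additive_maps VP VD"
    proof (rule additive_mapsI)
      show "?\<delta> (x \<oplus>\<^bsub>VP\<^esub> y) = ?\<delta> x \<oplus>\<^bsub>VD\<^esub> ?\<delta> y" if "x \<in> carrier VP" "y \<in> carrier VP" for x y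
        using that by (simp add: additive_maps_add[OF d_additive] dia_add_right a_minus_def Dg.minus_add Dg.a_ac)
    qed simp
    show "?\<delta> (b \<odot>\<^bsub>VP\<^esub> p) = b \<odot>\<^bsub>VD\<^esub> ?\<delta> p" if "b \<in> carrier (opp B)" "p \<in> carrier VP" for b p
      using that
      by (simp add: coact_iota a_minus_def additive_maps_add[OF opp_act_additive]
          additive_maps_uminus[OF D.group_T D.group_T opp_act_additive])
  qed
  have diff: "u \<ominus>\<^bsub>D\<^esub> v = \<zero>\<^bsub>D\<^esub> \<longleftrightarrow> u = v" if "u \<in> carrier D" "v \<in> carrier D" for u v
  proof
    assume "u \<ominus>\<^bsub>D\<^esub> v = \<zero>\<^bsub>D\<^esub>"
    moreover have "u = (u \<ominus>\<^bsub>D\<^esub> v) \<oplus>\<^bsub>D\<^esub> v" using that by (simp add: a_minus_def Dg.a_assoc Dg.l_neg)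
    ultimately show "u = v" using that by simp
  qed (use that in \<open>simp add: a_minus_def Dg.r_neg\<close>)
  have ker: "(\<lambda>n. n) ` carrier VN = {x \<in> carrier VP. ?\<delta> x = \<zero>\<^bsub>VD\<^esub>}"
    by (simp add: coinvariants_def diff cong: conj_cong)
  let ?w = "nu (\<rho> p)"
  have w: "?w \<in> carrier TP" using p by simp
  have "tensor_lift TD (\<lambda>x p. pD x (\<rho> p)) ?w
      = tensor_map (opp B) RM VD ?\<delta> ?w \<oplus>\<^bsub>TD\<^esub> tensor_lift TD (\<lambda>x p. pD x (\<one>\<^bsub>L\<^esub> \<diamondop> p)) ?w"
  proof (rule TP.additive_maps_eqI[OF TP.tensor_lift_additive[OF TD.group_T coact_balanced(1)] _ _ w])
    show "(\<lambda>w. tensor_map (opp B) RM VD ?\<delta> w \<oplus>\<^bsub>TD\<^esub> tensor_lift TD (\<lambda>x p. pD x (\<one>\<^bsub>L\<^esub> \<diamondop> p)) w) \<in> additive_maps TP TD"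
      by (rule additive_maps_plus[OF TD.group_T tensor_map_additive[OF module_RM module_VP module_VD \<delta>]
            TP.tensor_lift_additive[OF TD.group_T coact_balanced(2)]])
    fix x q assume xq: "x \<in> carrier RM" "q \<in> carrier VP"
    then have c: "x \<in> carrier L" "q \<in> carrier P" by auto
    have "pD x (\<rho> q) = pD x (?\<delta> q \<oplus>\<^bsub>D\<^esub> (\<one>\<^bsub>L\<^esub> \<diamondop> q))"
      using c by (simp add: a_minus_def Dg.a_assoc Dg.l_neg)
    also have "\<dots> = pD x (?\<delta> q) \<oplus>\<^bsub>TD\<^esub> pD x (\<one>\<^bsub>L\<^esub> \<diamondop> q)"
      using c by (simp add: pD_simps)
    finally show "tensor_lift TD (\<lambda>x p. pD x (\<rho> p)) (pP x q) =
        tensor_map (opp B) RM VD ?\<delta> (pP x q) \<oplus>\<^bsub>TD\<^esub> tensor_lift TD (\<lambda>x p. pD x (\<one>\<^bsub>L\<^esub> \<diamondop> p)) (pP x q)"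
      using xq by (simp add: TP.tensor_lift_pure[OF TD.group_T coact_balanced(1)]
          TP.tensor_lift_pure[OF TD.group_T coact_balanced(2)]
          tensor_map_pure[OF module_RM module_VP module_VD \<delta>])
  qed
  moreover have "tensor_map (opp B) RM VD ?\<delta> ?w \<in> carrier TD"
    by (rule additive_maps_closed[OF tensor_map_additive[OF module_RM module_VP module_VD \<delta>] w])
  moreover have "tensor_lift TD (\<lambda>x p. pD x (\<one>\<^bsub>L\<^esub> \<diamondop> p)) ?w \<in> carrier TD"
    by (rule TP.tensor_lift_closed[OF TD.group_T coact_balanced(2) w])
  moreover have "m = \<zero>\<^bsub>TD\<^esub>" if "m \<in> carrier TD" "v \<in> carrier TD" "v = m \<oplus>\<^bsub>TD\<^esub> v" for m v
  proof -
    have "m = (m \<oplus>\<^bsub>TD\<^esub> v) \<oplus>\<^bsub>TD\<^esub> \<ominus>\<^bsub>TD\<^esub> v" using that(1,2) by (simp add: TDg.a_assoc TDg.r_neg)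
    then show ?thesis using that by (simp add: that(3)[symmetric] TDg.r_neg)
  qed
  ultimately have "tensor_map (opp B) RM VD ?\<delta> ?w = \<zero>\<^bsub>TD\<^esub>"
    unfolding lift_coact_eq[OF p] by blast
  then have "?w \<in> tensor_map (opp B) RM VP (\<lambda>n. n) ` carrier TN"
    by (rule flat_kernel[OF flat module_VN module_VP module_VD embed_P_inj embed_P_inj embed_D_inj
          incl_linear \<delta> ker w])
  then obtain z where z: "z \<in> carrier TN" "?w = incl z" by (auto simp: incl_def)
  have "\<rho> (phi z) = \<rho> p" using z p J_nu[of "\<rho> p"] by (simp add: coact_phi)
  then have "phi z = p" using inj_onD[OF coact_inj] z p by simp
  then show ?thesis using z by blast
qed

lemma phi_bij: "bij_betw phi (carrier TN) (carrier P)"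
  unfolding bij_betw_def
proof
  show "inj_on phi (carrier TN)"
  proof (rule inj_onI)
    fix z z' assume z: "z \<in> carrier TN" "z' \<in> carrier TN" "phi z = phi z'"
    then have "J (incl z) = J (incl z')" by (simp add: coact_phi[symmetric])
    then have "incl z = incl z'"
      using z additive_maps_closed[OF incl_additive] inj_onD[OF bij_betw_imp_inj_on[OF J_bij]] by blast
    then show "z = z'" using z inj_onD[OF incl_inj] by blast
  qed
  show "phi ` carrier TN = carrier P" using phi_surj by auto
qed

text \<open>\<open>J\<close> is \<open>kappa\<close> after \<open>theta\<close>, and \<open>theta\<close> is surjective because \<open>phi\<close> is; so \<open>theta\<close> and \<open>kappa\<close> are both
bijective.\<close>

lemma kappa_bij: "bij_betw kappa (carrier PNP) (carrier D)"
proof -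
  have surj: "theta ` carrier TP = carrier PNP"
    using theta_surj phi_surj additive_maps_closed[OF theta_additive] by auto
  have "inj_on kappa (carrier PNP)"
  proof (rule inj_onI)
    fix u v assume uv: "u \<in> carrier PNP" "v \<in> carrier PNP" "kappa u = kappa v"
    obtain u' where u': "u' \<in> carrier TP" "u = theta u'" using uv(1) unfolding surj[symmetric] by blast
    obtain v' where v': "v' \<in> carrier TP" "v = theta v'" using uv(2) unfolding surj[symmetric] by blast
    have "J u' = J v'" using uv(3) u' v' by (simp add: kappa_theta[symmetric])
    then show "u = v" using u' v' inj_onD[OF bij_betw_imp_inj_on[OF J_bij]] by blast
  qed
  moreover have "kappa ` carrier PNP = carrier D"
    unfolding surj[symmetric] image_image using bij_betw_imp_surj_on[OF J_bij] by (simp add: kappa_theta)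
  ultimately show ?thesis by (simp add: bij_betw_def)
qed

end

section \<open>Galois extensions with a normal basis are cleft\<close>

context opp_alg begin

lemma bal_TN_right: "m \<in> N \<Longrightarrow> oppbal VN TN (\<lambda>x n. pN x (n \<bullet> m))"
  by (rule oppbalI) (simp_all add: pN_simps N_simps A.l_distr A.m_assoc N_mult iota_N)

lemma bal_TN_left: "y \<in> carrier L \<Longrightarrow> oppbal VN TN (\<lambda>x n. pN (y \<cdot> x) n)"
  by (rule oppbalI) (simp_all add: pN_simps L.r_distr L.m_assoc[symmetric] N_mult iota_N)

end

text \<open>Here \<open>\<gamma> x\<close> is the image of \<open>x \<otimes> 1\<close> under a normal basis isomorphism, which is then \<open>phi\<close>. The map \<open>J\<close> is
bijective since both its factors are: \<open>kappa\<close> by assumption, \<open>theta\<close> because it is \<open>phi\<close> with the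
functor \<open>- \<otimes>\<^sub>N P\<close> applied. The remaining defect of \<open>\<gamma>\<close> is that \<open>u = \<gamma> 1\<close> need not be \<open>1\<close>. It is
repaired by multiplying with the inverse of \<open>u\<close>, and the work lies in showing that the coinvariant
element \<open>u\<close> is invertible in \<open>N\<close>.

By faithful flatness it is enough that \<open>n \<mapsto> u n\<close> becomes surjective on \<open>L \<otimes> N\<close>. Write \<open>1\<close> as a sum of
terms \<open>\<gamma> x n\<close>, that is, \<open>psi 1 = x \<otimes> n\<close>. The map \<open>Psi\<close>, built from \<open>psi\<close> and the inverse \<open>mu\<close> of the Hopf
map, takes the coaction of \<open>\<gamma> x n\<close> to \<open>x \<otimes> u n\<close> and \<open>1 \<otimes> p\<close> to \<open>1 \<otimes> p\<close>. As \<open>1\<close> is coinvariant, the sum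
of the \<open>x \<otimes> u n\<close> is \<open>1 \<otimes> 1\<close>. Multiplying the first factor from the left by any \<open>y\<close> and the second from the
right by any coinvariant \<open>m\<close> shows that \<open>y \<otimes> m\<close> is in the image.\<close>

locale normal_Galois = colin K B L P \<iota> \<gamma> + hopf K B L
  for K :: "('k, 'x) ring_scheme" and B :: "('k, 'b, 'y) module_scheme"
    and L :: "('k, 'b, 'l, 'z) bialgebroid_scheme"
    and P :: "('k, 'b, 'l, 'p, 'w) comodule_algebra_scheme" and \<iota> :: "'b \<Rightarrow> 'p" and \<gamma> :: "'l \<Rightarrow> 'p" +
  assumes phi_bij: "bij_betw phi (carrier TN) (carrier P)"
    and kappa_bij: "bij_betw kappa (carrier PNP) (carrier D)"
begin

definition "psi = inv_into (carrier TN) phi"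

lemma psi_additive: "psi \<in> additive_maps P TN"
  unfolding psi_def by (rule additive_maps_inv_into[OF TN.group_T phi_additive phi_bij])

lemma psi_closed [simp]: "p \<in> carrier P \<Longrightarrow> psi p \<in> carrier TN"
  by (rule additive_maps_closed[OF psi_additive])

lemma psi_phi: "z \<in> carrier TN \<Longrightarrow> psi (phi z) = z"
  unfolding psi_def by (rule inv_into_f_f[OF bij_betw_imp_inj_on[OF phi_bij]])

lemma phi_psi: "p \<in> carrier P \<Longrightarrow> phi (psi p) = p"
  unfolding psi_def by (rule bij_betw_inv_into_right[OF phi_bij])

lemma psi_gamma_mult: "x \<in> carrier L \<Longrightarrow> n \<in> N \<Longrightarrow> psi (\<gamma> x \<bullet> n) = pN x n"
  using psi_phi[of "pN x n"] by (simp add: phi_pure pN_simps)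

lemma phi_right:
  assumes "z \<in> carrier TN" "m \<in> N"
  shows "phi (tensor_lift TN (\<lambda>x n. pN x (n \<bullet> m)) z) = phi z \<bullet> m"
proof -
  have "(\<lambda>p. p \<bullet> m) \<in> additive_maps P P" using assms by (auto intro!: additive_mapsI simp: A.l_distr N_simps)
  from TN.additive_maps_eqI[OF
      additive_maps_comp[OF TN.tensor_lift_additive[OF TN.group_T bal_TN_right[OF assms(2)]] phi_additive]
      additive_maps_comp[OF phi_additive this] _ assms(1)]
  show ?thesis
    using assms by (simp add: TN.tensor_lift_pure[OF TN.group_T bal_TN_right] phi_pure N_mult N_simps A.m_assoc)
qed

lemma phi_left:
  assumes "z \<in> carrier TN" "b \<in> carrier B"
  shows "phi (tensor_lift TN (\<lambda>x n. pN (s b \<cdot> x) n) z) = \<beta> b \<bullet> phi z"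
proof -
  have "(\<lambda>p. \<beta> b \<bullet> p) \<in> additive_maps P P" using assms by (auto intro!: additive_mapsI simp: A.r_distr)
  from TN.additive_maps_eqI[OF
      additive_maps_comp[OF TN.tensor_lift_additive[OF TN.group_T bal_TN_left[of "s b"]] phi_additive]
      additive_maps_comp[OF phi_additive this] _ assms(1)]
  show ?thesis
    using assms by (simp add: TN.tensor_lift_pure[OF TN.group_T bal_TN_left] phi_pure gamma_s_left N_simps A.m_assoc)
qed

lemma psi_right:
  assumes "p \<in> carrier P" "m \<in> N"
  shows "psi (p \<bullet> m) = tensor_lift TN (\<lambda>x n. pN x (n \<bullet> m)) (psi p)"
proof -
  have "tensor_lift TN (\<lambda>x n. pN x (n \<bullet> m)) (psi p) \<in> carrier TN"
    by (rule TN.tensor_lift_closed[OF TN.group_T bal_TN_right]) (use assms in auto)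
  from psi_phi[OF this] show ?thesis using assms by (simp add: phi_right phi_psi)
qed

lemma psi_left:
  assumes "p \<in> carrier P" "b \<in> carrier B"
  shows "psi (\<beta> b \<bullet> p) = tensor_lift TN (\<lambda>x n. pN (s b \<cdot> x) n) (psi p)"
proof -
  have "tensor_lift TN (\<lambda>x n. pN (s b \<cdot> x) n) (psi p) \<in> carrier TN"
    by (rule TN.tensor_lift_closed[OF TN.group_T bal_TN_left]) (use assms in auto)
  from psi_phi[OF this] show ?thesis using assms by (simp add: phi_left phi_psi)
qed

text \<open>The inverse of \<open>theta\<close> sends \<open>p \<otimes> q\<close> to \<open>x \<otimes> n q\<close>, summed over \<open>psi p = x \<otimes> n\<close>.\<close>

lemma bal_unwind: "q \<in> carrier P \<Longrightarrow> oppbal VN TP (\<lambda>x n. pP x (n \<bullet> q))"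
  by (rule oppbalI) (simp_all add: pP_simps N_simps A.l_distr A.m_assoc)

definition "unwind p q = tensor_lift TP (\<lambda>x n. pP x (n \<bullet> q)) (psi p)"

lemma unwind_balanced: "balanced (P\<lparr>carrier := N\<rparr>) (right_mult P id) (left_mult P id) TP unwind"
proof (rule balancedI)
  fix p p' q q' assume "p \<in> carrier (right_mult P id)" "p' \<in> carrier (right_mult P id)"
    "q \<in> carrier (left_mult P id)" "q' \<in> carrier (left_mult P id)"
  then have h: "p \<in> carrier P" "p' \<in> carrier P" "q \<in> carrier P" "q' \<in> carrier P" by auto
  have ul: "(\<lambda>p. unwind p q) \<in> additive_maps P TP"
    unfolding unwind_def
    by (rule additive_maps_comp[OF psi_additive TN.tensor_lift_additive[OF TP.group_T bal_unwind[OF h(3)]]])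
  have ur: "unwind p \<in> additive_maps P TP"
    unfolding unwind_def
    by (rule TN.tensor_lift_param[OF TP.group_T bal_unwind])
      (use h in \<open>auto intro!: additive_mapsI simp: pP_simps N_simps A.r_distr\<close>)
  show "unwind p q \<in> carrier TP" using additive_maps_closed[OF ul] h by simp
  show "unwind (p \<oplus>\<^bsub>right_mult P id\<^esub> p') q = unwind p q \<oplus>\<^bsub>TP\<^esub> unwind p' q"
    using additive_maps_add[OF ul] h by simp
  show "unwind p (q \<oplus>\<^bsub>left_mult P id\<^esub> q') = unwind p q \<oplus>\<^bsub>TP\<^esub> unwind p q'"
    using additive_maps_add[OF ur] h by simp
next
  fix m p q assume "m \<in> carrier (P\<lparr>carrier := N\<rparr>)" "p \<in> carrier (right_mult P id)" "q \<in> carrier (left_mult P id)"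
  then have h: "m \<in> N" "p \<in> carrier P" "q \<in> carrier P" by auto
  have "unwind (p \<bullet> m) q = unwind p (m \<bullet> q)"
    unfolding unwind_def psi_right[OF h(2,1)]
    by (rule TN.tensor_lift_comp_eq[OF TN.group_T TP.group_T bal_TN_right[OF h(1)]
          TN.tensor_lift_additive[OF TP.group_T bal_unwind[OF h(3)]]])
      (use h in \<open>simp_all add: TN.tensor_lift_pure[OF TP.group_T bal_unwind] N_mult N_simps A.m_assoc\<close>)
  then show "unwind (m \<odot>\<^bsub>right_mult P id\<^esub> p) q = unwind p (m \<odot>\<^bsub>left_mult P id\<^esub> q)" by simp
qed

lemma unwind_theta:
  assumes z: "z \<in> carrier TP"
  shows "tensor_lift TP unwind (theta z) = z"
proof (rule TP.additive_maps_eqI[OF additive_maps_comp[OF theta_additive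
        PNP.tensor_lift_additive[OF TP.group_T unwind_balanced]] _ _ z])
  fix x p assume "x \<in> carrier RM" "p \<in> carrier VP"
  then have h: "x \<in> carrier L" "p \<in> carrier P" by auto
  have "tensor_lift TP unwind (theta (pP x p)) = unwind (\<gamma> x) p"
    using h PNP.tensor_lift_pure[OF TP.group_T unwind_balanced, of "\<gamma> x" p] by (simp add: theta_pure)
  also have "\<dots> = pP x p"
    using h psi_gamma_mult[OF h(1) N_one] TN.tensor_lift_pure[OF TP.group_T bal_unwind, of p x "\<one>\<^bsub>P\<^esub>"] N_one
    by (simp add: unwind_def)
  finally show "tensor_lift TP unwind (theta (pP x p)) = pP x p" .
qed (auto simp: additive_maps_def)

lemma J_bij: "bij_betw J (carrier TP) (carrier D)"
proof -
  have surj: "theta ` carrier TP = carrier PNP"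
  proof
    show "carrier PNP \<subseteq> theta ` carrier TP"
      using theta_surj bij_betw_imp_surj_on[OF phi_bij] by blast
  qed (use additive_maps_closed[OF theta_additive] in blast)
  moreover have "inj_on theta (carrier TP)"
    by (rule inj_on_inverseI) (rule unwind_theta)
  ultimately have "bij_betw theta (carrier TP) (carrier PNP)" by (simp only: bij_betw_def)
  from bij_betw_trans[OF this kappa_bij] have "bij_betw (kappa \<circ> theta) (carrier TP) (carrier D)" .
  then show ?thesis by (rule bij_betw_cong[THEN iffD1, rotated]) (simp add: kappa_theta)
qed

definition "u = \<gamma> \<one>\<^bsub>L\<^esub>"

lemma u_N: "u \<in> N"
  unfolding u_def by (rule N_I) (simp_all add: coact_gamma comult_one LL.lift_dia[OF D.group_T bal_gamma])

lemma u_iota: "b \<in> carrier B \<Longrightarrow> u \<bullet> \<iota> b = \<iota> b \<bullet> u"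
  unfolding u_def using gamma_t_left[of b "\<one>\<^bsub>L\<^esub>"] gamma_t_right[of b "\<one>\<^bsub>L\<^esub>"] by simp

lemma bal_fun_inner: "n \<in> N \<Longrightarrow> oppbal LM TP (\<lambda>u v. pP u (\<gamma> v \<bullet> n))"
  by (rule oppbalI) (simp_all add: pP_simps N_simps A.l_distr gamma_t_left A.m_assoc)

definition "Psi_fun x y n = tensor_lift TP (\<lambda>u v. pP u (\<gamma> v \<bullet> n)) (mu (LL.dia x y))"

lemma Psi_fun_mu_additive:
  "n \<in> N \<Longrightarrow> (\<lambda>w. tensor_lift TP (\<lambda>u v. pP u (\<gamma> v \<bullet> n)) (mu w)) \<in> additive_maps LL.D TP"
  by (rule additive_maps_comp[OF mu_additive TL.tensor_lift_additive[OF TP.group_T bal_fun_inner]])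

lemma Psi_fun_additive_n:
  assumes "x \<in> carrier L" "y \<in> carrier L" "n \<in> N" "n' \<in> N"
  shows "Psi_fun x y (n \<oplus>\<^bsub>P\<^esub> n') = Psi_fun x y n \<oplus>\<^bsub>TP\<^esub> Psi_fun x y n'"
proof -
  have "Psi_fun x y \<in> additive_maps VN TP"
    unfolding Psi_fun_def
    by (rule TL.tensor_lift_param[OF TP.group_T bal_fun_inner])
      (use assms in \<open>auto intro!: additive_mapsI simp: N_simps N_add A.r_distr pP_simps\<close>)
  from additive_maps_add[OF this, of n n'] show ?thesis using assms by simp
qed

lemma bal_Psi_fun:
  assumes x: "x \<in> carrier L"
  shows "oppbal VN TP (Psi_fun x)"
proof (rule oppbalI)
  fix y y' n n' assume h: "y \<in> carrier L" "y' \<in> carrier L" "n \<in> carrier VN" "n' \<in> carrier VN"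
  then have n: "n \<in> N" by simp
  show "Psi_fun x y n \<in> carrier TP"
    unfolding Psi_fun_def by (rule additive_maps_closed[OF Psi_fun_mu_additive]) (use h x in auto)
  show "Psi_fun x (y \<oplus>\<^bsub>L\<^esub> y') n = Psi_fun x y n \<oplus>\<^bsub>TP\<^esub> Psi_fun x y' n"
    using h x by (simp add: Psi_fun_def LL.dia_add_right additive_maps_add[OF Psi_fun_mu_additive])
  show "Psi_fun x y (n \<oplus>\<^bsub>VN\<^esub> n') = Psi_fun x y n \<oplus>\<^bsub>TP\<^esub> Psi_fun x y n'"
    using Psi_fun_additive_n h x by simp
next
  fix b y n assume h: "b \<in> carrier B" "y \<in> carrier L" "n \<in> carrier VN"
  then have n: "n \<in> N" by simp
  have "Psi_fun x (y \<cdot> t b) n = tensor_lift TP (\<lambda>u v. pP u (\<gamma> (v \<cdot> t b) \<bullet> n)) (mu (LL.dia x y))"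
    unfolding Psi_fun_def using lift_mu_right[OF TP.group_T bal_fun_inner[OF n], of "LL.dia x y" "t b"] x h by simp
  also have "\<dots> = Psi_fun x y (\<iota> b \<bullet> n)"
    unfolding Psi_fun_def
    by (rule sym, rule TL.tensor_lift_cong[OF TP.group_T bal_fun_inner])
      (use h n x in \<open>simp_all add: gamma_t_right A.m_assoc N_simps N_mult iota_N\<close>)
  finally show "Psi_fun x (y \<cdot> t b) n = Psi_fun x y (b \<odot>\<^bsub>VN\<^esub> n)" by simp
qed

text \<open>In short \<open>Psi x p = x\<^sub>+ \<otimes> \<gamma> (x\<^sub>- y) n\<close>, summed over \<open>psi p = y \<otimes> n\<close>.\<close>

definition "Psi x p = tensor_lift TP (Psi_fun x) (psi p)"

lemma bal_Psi: "bal TP Psi"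
proof (rule balancedI_additive)
  show "Psi x \<in> additive_maps A' TP" if "x \<in> carrier LM" for x
    using additive_maps_comp[OF psi_additive TN.tensor_lift_additive[OF TP.group_T bal_Psi_fun, of x]] that
    by (simp add: Psi_def[abs_def] additive_maps_def)
  show "(\<lambda>x. Psi x p) \<in> additive_maps LM TP" if "p \<in> carrier A'" for p
    unfolding Psi_def
    by (rule TN.tensor_lift_param[OF TP.group_T bal_Psi_fun])
      (use that bal_Psi_fun in \<open>auto intro!: additive_mapsI
        simp: Psi_fun_def LL.dia_add_left additive_maps_add[OF Psi_fun_mu_additive] additive_maps_closed[OF Psi_fun_mu_additive]\<close>)
  fix b x p assume "b \<in> carrier B" "x \<in> carrier LM" "p \<in> carrier A'"
  then have h: "b \<in> carrier B" "x \<in> carrier L" "p \<in> carrier P" by auto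
  have sb: "s b \<in> carrier L" using h by simp
  have "Psi x (\<beta> b \<bullet> p) = Psi (t b \<cdot> x) p"
    unfolding Psi_def psi_left[OF h(3,1)]
    by (rule TN.tensor_lift_comp_eq[OF TN.group_T TP.group_T bal_TN_left[OF sb]
          TN.tensor_lift_additive[OF TP.group_T bal_Psi_fun[OF h(2)]]])
      (use h in \<open>simp_all add: TN.tensor_lift_pure[OF TP.group_T bal_Psi_fun] Psi_fun_def LL.dia_balanced\<close>)
  then show "Psi (b \<odot>\<^bsub>LM\<^esub> x) p = Psi x (b \<odot>\<^bsub>A'\<^esub> p)" by simp
qed

lemma Psi_lift_additive: "tensor_lift TP Psi \<in> additive_maps D TP"
  by (rule D.tensor_lift_additive[OF TP.group_T bal_Psi])

lemma bal_u: "oppbal VN TP (\<lambda>x n. pP x (u \<bullet> n))"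
  by (rule oppbalI)
    (simp_all add: pP_simps N_simps u_N A.r_distr A.m_assoc[symmetric] u_iota)

lemma Psi_coact_phi:
  assumes z: "z \<in> carrier TN"
  shows "tensor_lift TP Psi (\<rho> (phi z)) = tensor_lift TP (\<lambda>x n. pP x (u \<bullet> n)) z"
proof (rule TN.additive_maps_eqI[OF additive_maps_comp[OF additive_maps_comp[OF phi_additive d_additive]
        Psi_lift_additive] TN.tensor_lift_additive[OF TP.group_T bal_u] _ z])
  fix x n assume xn: "x \<in> carrier RM" "n \<in> carrier VN"
  then have h: "x \<in> carrier L" "n \<in> N" "n \<in> carrier P" by (auto simp: N_simps)
  let ?F = "\<lambda>u v. pP u (\<gamma> v \<bullet> n)"
  have "tensor_lift TP Psi (\<rho> (phi (pN x n))) = tensor_lift TP Psi (mult_right (\<rho> (\<gamma> x)) n)"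
    using h by (simp add: phi_pure coact_mult_N)
  also have "\<dots> = tensor_lift TP (\<lambda>x1 x2. tensor_lift TP ?F (mu (LL.dia x1 (x2 \<cdot> \<one>\<^bsub>L\<^esub>)))) (\<Delta> x)"
  proof (rule additive_coact_gamma[OF TP.group_T Psi_lift_additive h(1,3)])
    fix x1 x2 assume c: "x1 \<in> carrier L" "x2 \<in> carrier L"
    then show "tensor_lift TP Psi (x1 \<diamondop> \<gamma> x2 \<bullet> n) = tensor_lift TP ?F (mu (LL.dia x1 (x2 \<cdot> \<one>\<^bsub>L\<^esub>)))"
      using h TN.tensor_lift_pure[OF TP.group_T bal_Psi_fun[OF c(1)], of x2 n]
      by (simp add: lift_dia[OF TP.group_T bal_Psi] Psi_def psi_gamma_mult Psi_fun_def)
  qed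
  also have "\<dots> = pP x (\<gamma> \<one>\<^bsub>L\<^esub> \<bullet> n)"
    by (rule mu_cancel[OF TP.group_T bal_fun_inner[OF h(2)] h(1) L.one_closed])
  also have "\<dots> = tensor_lift TP (\<lambda>x n. pP x (u \<bullet> n)) (pN x n)"
    using xn TN.tensor_lift_pure[OF TP.group_T bal_u, of x n] by (simp add: u_def)
  finally show "tensor_lift TP Psi (\<rho> (phi (pN x n))) = tensor_lift TP (\<lambda>x n. pP x (u \<bullet> n)) (pN x n)" .
qed

lemma Psi_one:
  assumes p: "p \<in> carrier P"
  shows "tensor_lift TP Psi (\<one>\<^bsub>L\<^esub> \<diamondop> p) = pP \<one>\<^bsub>L\<^esub> p"
proof -
  have a: "pP \<one>\<^bsub>L\<^esub> \<in> additive_maps P TP" by (auto intro!: additive_mapsI simp: pP_simps)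
  have "tensor_lift TP Psi (\<one>\<^bsub>L\<^esub> \<diamondop> p) = tensor_lift TP (Psi_fun \<one>\<^bsub>L\<^esub>) (psi p)"
    using p by (simp add: lift_dia[OF TP.group_T bal_Psi] Psi_def)
  also have "\<dots> = tensor_lift TP (\<lambda>y n. pP \<one>\<^bsub>L\<^esub> (\<gamma> y \<bullet> n)) (psi p)"
    by (rule TN.tensor_lift_cong[OF TP.group_T bal_Psi_fun])
      (use p in \<open>simp_all add: Psi_fun_def mu_one TL.tensor_lift_pure[OF TP.group_T bal_fun_inner]\<close>)
  also have "\<dots> = pP \<one>\<^bsub>L\<^esub> (phi (psi p))"
    unfolding phi_def by (rule TN.tensor_lift_comp[OF group_P TP.group_T bal_phi a, symmetric]) (use p in simp)
  finally show ?thesis using p by (simp add: phi_psi)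
qed

lemma u_resolution: "tensor_lift TP (\<lambda>x n. pP x (u \<bullet> n)) (psi \<one>\<^bsub>P\<^esub>) = pP \<one>\<^bsub>L\<^esub> \<one>\<^bsub>P\<^esub>"
  using Psi_coact_phi[of "psi \<one>\<^bsub>P\<^esub>"] Psi_one[of "\<one>\<^bsub>P\<^esub>"] by (simp add: phi_psi coact_one)

lemma u_linear: "(\<lambda>n. u \<bullet> n) \<in> linear_maps (opp B) VN VN"
  by (rule linear_mapsI)
    (auto intro!: additive_mapsI simp: N_mult u_N N_simps A.r_distr A.m_assoc[symmetric] u_iota)

lemma u_surj: "(\<lambda>n. u \<bullet> n) ` N = N"
proof -
  have "(\<lambda>n. u \<bullet> n) ` carrier VN = carrier VN"
  proof (rule flat_surj[OF flat module_VN module_VN embed_P_inj embed_P_inj u_linear])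
    fix y m assume "y \<in> carrier RM" "m \<in> carrier VN"
    then have h: "y \<in> carrier L" "m \<in> N" "m \<in> carrier P" by (auto simp: N_simps)
    have b1: "oppbal VN TN (\<lambda>x n. pN (y \<cdot> x) (n \<bullet> m))"
      by (rule oppbalI)
        (use h in \<open>simp_all add: pN_simps N_simps L.r_distr A.l_distr L.m_assoc[symmetric] A.m_assoc N_mult iota_N\<close>)
    have b2: "oppbal VP TP (\<lambda>x p. pP (y \<cdot> x) (p \<bullet> m))"
      by (rule oppbalI)
        (use h in \<open>simp_all add: pP_simps L.r_distr A.l_distr L.m_assoc[symmetric] A.m_assoc\<close>)
    let ?z = "tensor_lift TN (\<lambda>x n. pN (y \<cdot> x) (n \<bullet> m)) (psi \<one>\<^bsub>P\<^esub>)"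
    let ?U = "tensor_map (opp B) RM VN (\<lambda>n. u \<bullet> n)"
    note U = tensor_map_additive[OF module_RM module_VN module_VN u_linear]
    have z: "?z \<in> carrier TN" by (rule TN.tensor_lift_closed[OF TN.group_T b1]) simp
    have U_pure: "?U (pN x n) = pN x (u \<bullet> n)" if "x \<in> carrier L" "n \<in> N" for x n
      using that tensor_map_pure[OF module_RM module_VN module_VN u_linear, of x n] by simp
    have "incl (?U (tensor_lift TN (\<lambda>x n. pN (y \<cdot> x) (n \<bullet> m)) w))
        = tensor_lift TP (\<lambda>x p. pP (y \<cdot> x) (p \<bullet> m)) (tensor_lift TP (\<lambda>x n. pP x (u \<bullet> n)) w)"
      if w: "w \<in> carrier TN" for w
      by (rule TN.additive_maps_eqI[OF additive_maps_comp[OF additive_maps_comp[OF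
              TN.tensor_lift_additive[OF TN.group_T b1] U] incl_additive]
            additive_maps_comp[OF TN.tensor_lift_additive[OF TP.group_T bal_u]
              TP.tensor_lift_additive[OF TP.group_T b2]] _ w])
        (use h in \<open>simp add: TN.tensor_lift_pure[OF TN.group_T b1] TN.tensor_lift_pure[OF TP.group_T bal_u]
          TP.tensor_lift_pure[OF TP.group_T b2] U_pure incl_pure N_mult u_N N_simps A.m_assoc\<close>)
    then have "incl (?U ?z) = tensor_lift TP (\<lambda>x p. pP (y \<cdot> x) (p \<bullet> m)) (pP \<one>\<^bsub>L\<^esub> \<one>\<^bsub>P\<^esub>)"
      by (simp add: u_resolution)
    also have "\<dots> = incl (pN y m)"
      using h by (simp add: TP.tensor_lift_pure[OF TP.group_T b2] incl_pure)
    finally have "?U ?z = pN y m"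
      using inj_onD[OF incl_inj] additive_maps_closed[OF U z] h by (simp add: pN_simps)
    then show "pN y m \<in> ?U ` carrier TN" by (rule image_eqI[OF sym z])
  qed
  then show ?thesis by simp
qed

text \<open>If \<open>u n = 0\<close>, then \<open>phi\<close> kills \<open>1 \<otimes> n\<close>, so \<open>x \<otimes> n = 0\<close> for every \<open>x\<close>, and faithful flatness gives \<open>n = 0\<close>.\<close>

lemma u_cancel:
  assumes n: "n \<in> N" and un: "u \<bullet> n = \<zero>\<^bsub>P\<^esub>"
  shows "n = \<zero>\<^bsub>P\<^esub>"
proof -
  interpret TNg: abelian_group TN by (rule TN.group_T)
  have phi0: "phi \<zero>\<^bsub>TN\<^esub> = \<zero>\<^bsub>P\<^esub>" by (rule additive_maps_zero[OF TN.group_T group_P phi_additive])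
  have "phi (pN \<one>\<^bsub>L\<^esub> n) = phi \<zero>\<^bsub>TN\<^esub>" using n un by (simp add: phi_pure phi0 u_def)
  then have one: "pN \<one>\<^bsub>L\<^esub> n = \<zero>\<^bsub>TN\<^esub>"
    using inj_onD[OF bij_betw_imp_inj_on[OF phi_bij]] n by (simp add: pN_simps)
  have "pN x n = \<zero>\<^bsub>TN\<^esub>" if x: "x \<in> carrier L" for x
  proof -
    have "pN x n = tensor_lift TN (\<lambda>y n. pN (x \<cdot> y) n) (pN \<one>\<^bsub>L\<^esub> n)"
      using x n by (simp add: TN.tensor_lift_pure[OF TN.group_T bal_TN_left])
    also have "\<dots> = \<zero>\<^bsub>TN\<^esub>"
      unfolding one
      by (rule additive_maps_zero[OF TN.group_T TN.group_T TN.tensor_lift_additive[OF TN.group_T bal_TN_left[OF x]]])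
    finally show ?thesis .
  qed
  then have "n = \<zero>\<^bsub>VN\<^esub>"
    by (intro flat_zero[OF flat module_VN embed_P_inj]) (use n in auto)
  then show ?thesis by simp
qed

text \<open>Surjectivity of \<open>n \<mapsto> u n\<close> gives a right inverse \<open>v\<close>, and it is a left inverse since \<open>u (v u - 1) = 0\<close>.\<close>

lemma u_unit:
  obtains v where "v \<in> N" "u \<bullet> v = \<one>\<^bsub>P\<^esub>" "v \<bullet> u = \<one>\<^bsub>P\<^esub>" "\<forall>b\<in>carrier B. v \<bullet> \<iota> b = \<iota> b \<bullet> v"
proof -
  have "\<one>\<^bsub>P\<^esub> \<in> (\<lambda>n. u \<bullet> n) ` N" using u_surj N_one by simp
  then obtain v where v: "v \<in> N" "u \<bullet> v = \<one>\<^bsub>P\<^esub>" by (auto simp: image_iff)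
  have c: "u \<in> carrier P" "v \<in> carrier P" using u_N v by (auto simp: N_simps)
  have "u \<bullet> (v \<bullet> u \<ominus>\<^bsub>P\<^esub> \<one>\<^bsub>P\<^esub>) = (u \<bullet> v) \<bullet> u \<ominus>\<^bsub>P\<^esub> u"
    using c by (simp add: a_minus_def A.r_distr A.r_minus A.m_assoc)
  also have "\<dots> = \<zero>\<^bsub>P\<^esub>" using c v by (simp add: a_minus_def A.r_neg)
  finally have uz: "u \<bullet> (v \<bullet> u \<ominus>\<^bsub>P\<^esub> \<one>\<^bsub>P\<^esub>) = \<zero>\<^bsub>P\<^esub>" .
  have "v \<bullet> u \<ominus>\<^bsub>P\<^esub> \<one>\<^bsub>P\<^esub> \<in> N"
    unfolding a_minus_def by (intro N_add N_mult N_uminus N_one u_N v)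
  from u_cancel[OF this uz] have "v \<bullet> u \<ominus>\<^bsub>P\<^esub> \<one>\<^bsub>P\<^esub> = \<zero>\<^bsub>P\<^esub>" .
  moreover have "v \<bullet> u = (v \<bullet> u \<ominus>\<^bsub>P\<^esub> \<one>\<^bsub>P\<^esub>) \<oplus>\<^bsub>P\<^esub> \<one>\<^bsub>P\<^esub>"
    using c by (simp add: a_minus_def A.a_assoc A.l_neg)
  ultimately have vu: "v \<bullet> u = \<one>\<^bsub>P\<^esub>" by simp
  have "v \<bullet> \<iota> b = \<iota> b \<bullet> v" if b: "b \<in> carrier B" for b
  proof -
    have "v \<bullet> \<iota> b = v \<bullet> \<iota> b \<bullet> (u \<bullet> v)" using v c b by simp
    also have "\<dots> = v \<bullet> (\<iota> b \<bullet> u) \<bullet> v" using c b by (simp add: A.m_assoc)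
    also have "\<dots> = (v \<bullet> u) \<bullet> \<iota> b \<bullet> v" using c b by (simp add: u_iota[symmetric] A.m_assoc)
    finally show ?thesis using vu c b by simp
  qed
  with v vu show thesis by (intro that ballI)
qed

end

section \<open>Normal bases and cleaving maps\<close>

context opp_alg begin

abbreviation "NM \<equiv> normal_bimodule B L P \<iota>"
abbreviation "DM \<equiv> diamond B L NM"
abbreviation "pM \<equiv> diamond_pure B L NM"

lemma NM_simps [simp]:
  "carrier NM = carrier TN" "ring.add NM = ring.add TN" "ring.zero NM = ring.zero TN"
  "b \<odot>\<^bsub>NM\<^esub> z = tensor_lift TN (\<lambda>x n. pN (s b \<cdot> x) n) z"
  "rsmult NM z b = tensor_lift TN (\<lambda>x n. pN (x \<cdot> s b) n) z"
  by (simp_all add: normal_bimodule_def Let_def)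

lemma group_NM: "abelian_group NM"
  by (rule abelian_group_cong[OF TN.group_T]) simp_all

lemma additive_maps_NM: "additive_maps NM G = additive_maps TN G" "additive_maps V NM = additive_maps V TN"
  by (simp_all add: additive_maps_def)

lemma lift_NM:
  assumes "oppbal VN TN F" "z \<in> carrier TN"
  shows "tensor_lift NM F z = tensor_lift TN F z"
  by (rule TN.tensor_lift_same_group[OF TN.group_T group_NM _ _ assms, symmetric]) simp_all

lemma bal_TN_s_right: "b \<in> carrier B \<Longrightarrow> oppbal VN TN (\<lambda>x n. pN (x \<cdot> s b) n)"
proof (rule oppbalI)
  fix c x n assume h: "b \<in> carrier B" "c \<in> carrier B" "x \<in> carrier L" "n \<in> carrier VN"
  have "x \<cdot> t c \<cdot> s b = x \<cdot> s b \<cdot> t c" using h by (simp add: L.m_assoc s_t_commute)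
  then show "pN (x \<cdot> t c \<cdot> s b) n = pN (x \<cdot> s b) (c \<odot>\<^bsub>VN\<^esub> n)" using h by (simp add: pN_simps)
qed (simp_all add: pN_simps L.l_distr)

lemma NM_smult_closed: "b \<in> carrier B \<Longrightarrow> z \<in> carrier TN \<Longrightarrow> b \<odot>\<^bsub>NM\<^esub> z \<in> carrier TN"
  by (simp del: carrier_opp add: TN.tensor_lift_closed[OF TN.group_T bal_TN_left])

lemma NM_smult_pure: "b \<in> carrier B \<Longrightarrow> x \<in> carrier L \<Longrightarrow> n \<in> N \<Longrightarrow> b \<odot>\<^bsub>NM\<^esub> pN x n = pN (s b \<cdot> x) n"
  by (simp add: TN.tensor_lift_pure[OF TN.group_T bal_TN_left])

lemma NM_rsmult_pure: "b \<in> carrier B \<Longrightarrow> x \<in> carrier L \<Longrightarrow> n \<in> N \<Longrightarrow> rsmult NM (pN x n) b = pN (x \<cdot> s b) n"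
  by (simp add: TN.tensor_lift_pure[OF TN.group_T bal_TN_s_right])

lemma NM_smult_additive: "b \<in> carrier B \<Longrightarrow> (\<lambda>z. b \<odot>\<^bsub>NM\<^esub> z) \<in> additive_maps TN TN"
  using TN.tensor_lift_additive[OF TN.group_T bal_TN_left[of "s b"]] by simp

lemma NM_rsmult_additive: "b \<in> carrier B \<Longrightarrow> (\<lambda>z. rsmult NM z b) \<in> additive_maps TN TN"
  using TN.tensor_lift_additive[OF TN.group_T bal_TN_s_right[of b]] by simp

sublocale DM: tensor_pair B "left_mult L (tgt L)" "normal_bimodule B L P \<iota>" "diamond B L (normal_bimodule B L P \<iota>)"
  by (rule diamond_pair[OF group_NM]) (use NM_smult_closed in simp)

lemma pM_simps:
  "x \<in> carrier L \<Longrightarrow> z \<in> carrier TN \<Longrightarrow> pM x z \<in> carrier DM"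
  "x \<in> carrier L \<Longrightarrow> x' \<in> carrier L \<Longrightarrow> z \<in> carrier TN \<Longrightarrow> pM (x \<oplus>\<^bsub>L\<^esub> x') z = pM x z \<oplus>\<^bsub>DM\<^esub> pM x' z"
  "x \<in> carrier L \<Longrightarrow> z \<in> carrier TN \<Longrightarrow> z' \<in> carrier TN \<Longrightarrow> pM x (z \<oplus>\<^bsub>TN\<^esub> z') = pM x z \<oplus>\<^bsub>DM\<^esub> pM x z'"
  using DM.pure_in_T[of x z] DM.pure_add_left[of x x' z] DM.pure_add_right[of x z z'] by simp_all

lemma pM_balanced:
  "b \<in> carrier B \<Longrightarrow> x \<in> carrier L \<Longrightarrow> y \<in> carrier L \<Longrightarrow> n \<in> N \<Longrightarrow> pM (t b \<cdot> x) (pN y n) = pM x (pN (s b \<cdot> y) n)"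
  using DM.pure_smult[of b x "pN y n"] by (simp add: pN_simps TN.tensor_lift_pure[OF TN.group_T bal_TN_left])

lemma bal_coact_inner: "n \<in> N \<Longrightarrow> LL.bal DM (\<lambda>x1 x2. pM x1 (pN x2 n))"
  by (rule LL.balI) (simp_all add: pM_simps pN_simps pM_balanced)

lemma bal_normal_coact: "oppbal VN DM (\<lambda>x n. tensor_lift DM (\<lambda>x1 x2. pM x1 (pN x2 n)) (\<Delta> x))"
proof (rule balancedI_additive)
  show "(\<lambda>n. tensor_lift DM (\<lambda>x1 x2. pM x1 (pN x2 n)) (\<Delta> x)) \<in> additive_maps VN DM" if "x \<in> carrier RM" for x
    by (rule LL.D.tensor_lift_param[OF DM.group_T bal_coact_inner])
      (use that in \<open>auto intro!: additive_mapsI simp: pM_simps pN_simps N_add\<close>)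
  show "(\<lambda>x. tensor_lift DM (\<lambda>x1 x2. pM x1 (pN x2 n)) (\<Delta> x)) \<in> additive_maps RM DM" if "n \<in> carrier VN" for n
    using additive_maps_comp[OF comult_additive LL.D.tensor_lift_additive[OF DM.group_T bal_coact_inner[of n]]] that
    by (simp add: additive_maps_def)
  fix b x n assume "b \<in> carrier (opp B)" "x \<in> carrier RM" "n \<in> carrier VN"
  then have h: "b \<in> carrier B" "x \<in> carrier L" "n \<in> N" by auto
  note add = LL.D.tensor_lift_additive[OF DM.group_T bal_coact_inner[OF h(3)]]
  have "tensor_lift DM (\<lambda>x1 x2. pM x1 (pN x2 n)) (\<Delta> (x \<cdot> t b))
      = tensor_lift DM (\<lambda>x1 x2. pM x1 (pN x2 (\<iota> b \<bullet> n))) (\<Delta> x)"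
    unfolding comult_t_right[OF h(2,1)]
    by (rule LL.additive_mult_right[OF DM.group_T add])
      (use h in \<open>simp_all add: LL.lift_dia[OF DM.group_T bal_coact_inner] pN_simps\<close>)
  then show "tensor_lift DM (\<lambda>x1 x2. pM x1 (pN x2 n)) (\<Delta> (b \<odot>\<^bsub>RM\<^esub> x))
      = tensor_lift DM (\<lambda>x1 x2. pM x1 (pN x2 (b \<odot>\<^bsub>VN\<^esub> n))) (\<Delta> x)"
    by simp
qed

lemma normal_coact_eq: "normal_coact B L P \<iota> = tensor_lift DM (\<lambda>x n. tensor_lift DM (\<lambda>x1 x2. pM x1 (pN x2 n)) (\<Delta> x))"
  by (simp add: normal_coact_def Let_def)

lemma normal_coact_additive: "normal_coact B L P \<iota> \<in> additive_maps TN DM"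
  unfolding normal_coact_eq by (rule TN.tensor_lift_additive[OF DM.group_T bal_normal_coact])

lemma bal_NM_map:
  assumes f: "f \<in> additive_maps TN P" and fb: "\<And>b z. b \<in> carrier B \<Longrightarrow> z \<in> carrier TN \<Longrightarrow> f (b \<odot>\<^bsub>NM\<^esub> z) = \<beta> b \<bullet> f z"
  shows "balanced B LM NM D (\<lambda>x z. x \<diamondop> f z)"
  by (rule balancedI)
    (use fb in \<open>simp_all add: additive_maps_closed[OF f] additive_maps_add[OF f] dia_add_left dia_add_right dia_balanced\<close>)

lemma lift_normal_coact_additive:
  assumes f: "f \<in> additive_maps TN P" and fb: "\<And>b z. b \<in> carrier B \<Longrightarrow> z \<in> carrier TN \<Longrightarrow> f (b \<odot>\<^bsub>NM\<^esub> z) = \<beta> b \<bullet> f z"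
  shows "(\<lambda>z. tensor_lift D (\<lambda>x z. x \<diamondop> f z) (normal_coact B L P \<iota> z)) \<in> additive_maps TN D"
  by (rule additive_maps_comp[OF normal_coact_additive DM.tensor_lift_additive[OF D.group_T bal_NM_map[OF f fb]]])

text \<open>For a \<open>B\<close>-linear \<open>f\<close> on \<open>L \<otimes> N\<close> this is the right-hand side of the colinearity condition at \<open>x \<otimes> n\<close>.\<close>

lemma lift_normal_coact_pure:
  assumes f: "f \<in> additive_maps TN P" and fb: "\<And>b z. b \<in> carrier B \<Longrightarrow> z \<in> carrier TN \<Longrightarrow> f (b \<odot>\<^bsub>NM\<^esub> z) = \<beta> b \<bullet> f z"
    and x: "x \<in> carrier L" and n: "n \<in> N"
  shows "tensor_lift D (\<lambda>x z. x \<diamondop> f z) (normal_coact B L P \<iota> (pN x n))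
    = tensor_lift D (\<lambda>x1 x2. x1 \<diamondop> f (pN x2 n)) (\<Delta> x)"
proof -
  note b = bal_NM_map[OF f fb] and add = DM.tensor_lift_additive[OF D.group_T bal_NM_map[OF f fb]]
  have "normal_coact B L P \<iota> (pN x n) = tensor_lift DM (\<lambda>x1 x2. pM x1 (pN x2 n)) (\<Delta> x)"
    using TN.tensor_lift_pure[OF DM.group_T bal_normal_coact, of x n] x n by (simp add: normal_coact_eq)
  then show ?thesis
    using LL.D.tensor_lift_comp_eq[OF DM.group_T D.group_T bal_coact_inner[OF n] add comult_closed[OF x],
        of "\<lambda>x1 x2. x1 \<diamondop> f (pN x2 n)"] n
    by (simp add: DM.tensor_lift_pure[OF D.group_T b] pN_simps)
qed

lemma colinI:
  assumes \<gamma>: "cleaving_map B L P \<iota> \<gamma>"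
  shows "colin K B L P \<iota> \<gamma>" and "\<gamma> \<one>\<^bsub>L\<^esub> = \<one>\<^bsub>P\<^esub>"
    and "bij_betw (tensor_lift D (\<lambda>x p. tensor_lift D (\<lambda>x1 x2. x1 \<diamondop> \<gamma> x2 \<bullet> p) (\<Delta> x))) (carrier TP) (carrier D)"
proof -
  have add: "\<gamma> \<in> additive_maps L P"
    and bim: "\<And>b b' x. b \<in> carrier B \<Longrightarrow> b' \<in> carrier B \<Longrightarrow> x \<in> carrier L \<Longrightarrow> \<gamma> (s b \<cdot> (x \<cdot> s b')) = \<beta> b \<bullet> (\<gamma> x \<bullet> \<beta> b')"
    and col: "\<And>x. x \<in> carrier L \<Longrightarrow> \<rho> (\<gamma> x) = tensor_lift D (\<lambda>x1 x2. x1 \<diamondop> \<gamma> x2) (\<Delta> x)"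
    and opp: "\<And>a b x. a \<in> carrier B \<Longrightarrow> b \<in> carrier B \<Longrightarrow> x \<in> carrier L \<Longrightarrow> \<gamma> (t a \<cdot> x \<cdot> t b) = \<iota> a \<bullet> \<gamma> x \<bullet> \<iota> b"
    using \<gamma> by (simp_all add: cleaving_map_def comodule_maps_def Let_def additive_maps_def)
  have cl: "x \<in> carrier L \<Longrightarrow> \<gamma> x \<in> carrier P" for x by (rule additive_maps_closed[OF add])
  show "colin K B L P \<iota> \<gamma>"
  proof (intro colin.intro opp_alg_axioms colin_axioms.intro add col)
    fix b x assume h: "b \<in> carrier B" "x \<in> carrier L"
    show "\<gamma> (s b \<cdot> x) = \<beta> b \<bullet> \<gamma> x" using bim[of b "\<one>\<^bsub>B\<^esub>" x] h cl by simp
    show "\<gamma> (x \<cdot> s b) = \<gamma> x \<bullet> \<beta> b" using bim[of "\<one>\<^bsub>B\<^esub>" b x] h cl by simp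
    show "\<gamma> (t b \<cdot> x) = \<iota> b \<bullet> \<gamma> x" using opp[of b "\<one>\<^bsub>B\<^esub>" x] h cl by simp
    show "\<gamma> (x \<cdot> t b) = \<gamma> x \<bullet> \<iota> b" using opp[of "\<one>\<^bsub>B\<^esub>" b x] h cl by simp
  qed
  show "\<gamma> \<one>\<^bsub>L\<^esub> = \<one>\<^bsub>P\<^esub>"
    and "bij_betw (tensor_lift D (\<lambda>x p. tensor_lift D (\<lambda>x1 x2. x1 \<diamondop> \<gamma> x2 \<bullet> p) (\<Delta> x))) (carrier TP) (carrier D)"
    using \<gamma> by (simp_all add: cleaving_map_def Let_def)
qed

end

context colin begin

lemma cleaving_mapI:
  assumes "\<gamma> \<one>\<^bsub>L\<^esub> = \<one>\<^bsub>P\<^esub>" and J: "bij_betw J (carrier TP) (carrier D)"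
  shows "cleaving_map B L P \<iota> \<gamma>"
proof -
  have "bij_betw (tensor_lift D (\<lambda>x p. tensor_lift D (\<lambda>x1 x2. x1 \<diamondop> \<gamma> x2 \<bullet> p) (\<Delta> x))) (carrier TP) (carrier D)"
    using J by (rule bij_betw_cong[THEN iffD2, rotated]) (rule J_literal)
  then show ?thesis
    using assms(1) gamma_additive
    by (simp add: cleaving_map_def comodule_maps_def Let_def coact_gamma gamma_s_left gamma_s_right
        gamma_t_left gamma_t_right additive_maps_def)
qed

lemma phi_comodule_map: "phi \<in> comodule_maps B L NM (normal_coact B L P \<iota>) A' \<rho>"
proof -
  have left: "phi (b \<odot>\<^bsub>NM\<^esub> z) = \<beta> b \<bullet> phi z" if b: "b \<in> carrier B" and z: "z \<in> carrier TN" for b z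
  proof (rule TN.additive_maps_eqI[OF additive_maps_comp[OF NM_smult_additive[OF b] phi_additive]
        additive_maps_comp[OF phi_additive] _ z])
    show "(\<lambda>p. \<beta> b \<bullet> p) \<in> additive_maps P P" using b by (auto intro!: additive_mapsI simp: A.r_distr)
    show "phi (b \<odot>\<^bsub>NM\<^esub> pN x n) = \<beta> b \<bullet> phi (pN x n)" if "x \<in> carrier RM" "n \<in> carrier VN" for x n
      using that b by (simp add: NM_smult_pure phi_pure gamma_s_left A.m_assoc N_simps del: NM_simps)
  qed
  have right: "phi (rsmult NM z b) = phi z \<bullet> \<beta> b" if b: "b \<in> carrier B" and z: "z \<in> carrier TN" for b z
  proof (rule TN.additive_maps_eqI[OF additive_maps_comp[OF NM_rsmult_additive[OF b] phi_additive]
        additive_maps_comp[OF phi_additive] _ z])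
    show "(\<lambda>p. p \<bullet> \<beta> b) \<in> additive_maps P P" using b by (auto intro!: additive_mapsI simp: A.l_distr)
    show "phi (rsmult NM (pN x n) b) = phi (pN x n) \<bullet> \<beta> b" if "x \<in> carrier RM" "n \<in> carrier VN" for x n
      using that b N_commute[of n b]
      by (simp add: NM_rsmult_pure phi_pure gamma_s_right A.m_assoc N_simps del: NM_simps)
  qed
  have "\<rho> (phi z) = tensor_lift D (\<lambda>x m. x \<diamondop> phi m) (normal_coact B L P \<iota> z)" if z: "z \<in> carrier TN" for z
  proof (rule TN.additive_maps_eqI[OF additive_maps_comp[OF phi_additive d_additive]
        lift_normal_coact_additive[OF phi_additive left] _ z])
    fix x n assume "x \<in> carrier RM" "n \<in> carrier VN"
    then have h: "x \<in> carrier L" "n \<in> N" "n \<in> carrier P" by (auto simp: N_simps)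
    have add: "(\<lambda>z. z) \<in> additive_maps D D" by (simp add: additive_maps_def)
    have "\<rho> (phi (pN x n)) = mult_right (\<rho> (\<gamma> x)) n"
      using h by (simp add: phi_pure coact_mult_N)
    also have "\<dots> = tensor_lift D (\<lambda>x1 x2. x1 \<diamondop> phi (pN x2 n)) (\<Delta> x)"
      by (rule additive_coact_gamma[OF D.group_T add h(1,3)]) (use h in \<open>simp add: phi_pure\<close>)
    also have "\<dots> = tensor_lift D (\<lambda>x m. x \<diamondop> phi m) (normal_coact B L P \<iota> (pN x n))"
      by (rule lift_normal_coact_pure[OF phi_additive left h(1,2), symmetric])
    finally show "\<rho> (phi (pN x n)) = tensor_lift D (\<lambda>x m. x \<diamondop> phi m) (normal_coact B L P \<iota> (pN x n))" .
  qed
  moreover have "rsmult NM z b \<in> carrier TN" if "b \<in> carrier B" "z \<in> carrier TN" for b z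
    using additive_maps_closed[OF NM_rsmult_additive[OF that(1)] that(2)] .
  ultimately show ?thesis
    using left right phi_additive
    by (simp add: comodule_maps_def additive_maps_NM(1) del: NM_simps(4,5)) (simp add: additive_maps_def)
qed

lemma normal_basis_viaI:
  assumes \<iota>: "opp_inclusion K B L P \<iota>" and bij: "bij_betw phi (carrier TN) (carrier P)"
  shows "normal_basis_via K B L P \<iota>"
proof -
  have 1: "phi (tensor_lift NM (\<lambda>x n. pN (t b \<cdot> x) n) z) = \<iota> b \<bullet> phi z" if b: "b \<in> carrier B" and z: "z \<in> carrier TN" for b z
  proof -
    have tb: "t b \<in> carrier L" using b by simp
    have add: "(\<lambda>p. \<iota> b \<bullet> p) \<in> additive_maps P P" using b by (auto intro!: additive_mapsI simp: A.r_distr)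
    have "phi (tensor_lift TN (\<lambda>x n. pN (t b \<cdot> x) n) z) = \<iota> b \<bullet> phi z"
      by (rule TN.additive_maps_eqI[OF additive_maps_comp[OF TN.tensor_lift_additive[OF TN.group_T bal_TN_left[OF tb]] phi_additive]
            additive_maps_comp[OF phi_additive add] _ z])
        (use b in \<open>simp add: TN.tensor_lift_pure[OF TN.group_T bal_TN_left] phi_pure gamma_t_left A.m_assoc N_simps\<close>)
    then show ?thesis by (simp add: lift_NM[OF bal_TN_left[OF tb] z])
  qed
  have 2: "phi (tensor_lift NM (\<lambda>x n. pN x (n \<bullet> m)) z) = phi z \<bullet> m" if m: "m \<in> N" and z: "z \<in> carrier TN" for m z
  proof -
    have add: "(\<lambda>p. p \<bullet> m) \<in> additive_maps P P" using m by (auto intro!: additive_mapsI simp: A.l_distr N_simps)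
    have "phi (tensor_lift TN (\<lambda>x n. pN x (n \<bullet> m)) z) = phi z \<bullet> m"
      by (rule TN.additive_maps_eqI[OF additive_maps_comp[OF TN.tensor_lift_additive[OF TN.group_T bal_TN_right[OF m]] phi_additive]
            additive_maps_comp[OF phi_additive add] _ z])
        (use m in \<open>simp add: TN.tensor_lift_pure[OF TN.group_T bal_TN_right] phi_pure A.m_assoc N_simps N_mult\<close>)
    then show ?thesis by (simp add: lift_NM[OF bal_TN_right[OF m] z])
  qed
  have "bij_betw phi (carrier NM) (carrier P)" using bij by simp
  then show ?thesis
    unfolding normal_basis_via_def Let_def
    using \<iota> phi_comodule_map 1 2 by (intro conjI exI[of _ phi]) (simp_all add: NM_simps(1))
qed

end

context opp_alg begin

text \<open>Right \<open>N\<close>-linearity gives \<open>\<phi> (x \<otimes> n) = \<phi> (x \<otimes> 1) n\<close>, so \<open>\<phi>\<close> is the map \<open>phi\<close> of \<open>x \<mapsto> \<phi> (x \<otimes> 1)\<close>. The relation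
\<open>x t b \<otimes> 1 = x \<otimes> \<iota> b\<close> then accounts for right linearity over the opposite of \<open>B\<close>.\<close>

lemma colin_of_normal_basis:
  assumes bij: "bij_betw \<phi> (carrier NM) (carrier P)"
    and com: "\<phi> \<in> comodule_maps B L NM (normal_coact B L P \<iota>) A' \<rho>"
    and left: "\<And>b z. b \<in> carrier B \<Longrightarrow> z \<in> carrier NM \<Longrightarrow>
      \<phi> (tensor_lift NM (\<lambda>x n. pN (t b \<cdot> x) n) z) = \<iota> b \<bullet> \<phi> z"
    and right: "\<And>m z. m \<in> N \<Longrightarrow> z \<in> carrier NM \<Longrightarrow>
      \<phi> (tensor_lift NM (\<lambda>x n. pN x (n \<bullet> m)) z) = \<phi> z \<bullet> m"
  shows "colin K B L P \<iota> (\<lambda>x. \<phi> (pN x \<one>\<^bsub>P\<^esub>))"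
    and "bij_betw (colin.phi P (\<lambda>x. \<phi> (pN x \<one>\<^bsub>P\<^esub>))) (carrier TN) (carrier P)"
proof -
  have add: "\<phi> \<in> additive_maps TN P"
    using com by (simp add: comodule_maps_def additive_maps_def)
  have bim: "\<phi> (b \<odot>\<^bsub>NM\<^esub> rsmult NM z b') = \<beta> b \<bullet> (\<phi> z \<bullet> \<beta> b')"
    if "b \<in> carrier B" "b' \<in> carrier B" "z \<in> carrier TN" for b b' z
    using com that by (simp add: comodule_maps_def del: NM_simps(4,5))
  have col: "\<rho> (\<phi> z) = tensor_lift D (\<lambda>x z. x \<diamondop> \<phi> z) (normal_coact B L P \<iota> z)" if "z \<in> carrier TN" for z
    using com that by (simp add: comodule_maps_def del: NM_simps(4,5))
  have cl: "\<phi> z \<in> carrier P" if "z \<in> carrier TN" for z by (rule additive_maps_closed[OF add that])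
  note p1 = pN_simps(1)[OF _ N_one]
  have s_right: "\<phi> (pN (x \<cdot> s b) n) = \<phi> (pN x n) \<bullet> \<beta> b" if "b \<in> carrier B" "x \<in> carrier L" "n \<in> N" for b x n
    using bim[of "\<one>\<^bsub>B\<^esub>" b "pN x n"] that
    by (simp add: pN_simps cl NM_smult_pure NM_rsmult_pure del: NM_simps(4,5))
  have s_left: "\<phi> (b \<odot>\<^bsub>NM\<^esub> z) = \<beta> b \<bullet> \<phi> z" if b: "b \<in> carrier B" and z: "z \<in> carrier TN" for b z
  proof -
    have "rsmult NM z \<one>\<^bsub>B\<^esub> = z"
      by (rule TN.additive_maps_eqI[OF NM_rsmult_additive _ _ z])
        (auto simp: additive_maps_def NM_rsmult_pure simp del: NM_simps(4,5))
    then show ?thesis using bim[of b "\<one>\<^bsub>B\<^esub>" z] b z by (simp add: cl del: NM_simps(4,5))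
  qed
  have mult_n: "\<phi> (pN x n) = \<phi> (pN x \<one>\<^bsub>P\<^esub>) \<bullet> n" if "x \<in> carrier L" "n \<in> N" for x n
    using right[of n "pN x \<one>\<^bsub>P\<^esub>"] that N_one
    by (simp add: p1 lift_NM[OF bal_TN_right] TN.tensor_lift_pure[OF TN.group_T bal_TN_right] N_simps)
  show c: "colin K B L P \<iota> (\<lambda>x. \<phi> (pN x \<one>\<^bsub>P\<^esub>))"
  proof (intro colin.intro opp_alg_axioms colin_axioms.intro)
    show "(\<lambda>x. \<phi> (pN x \<one>\<^bsub>P\<^esub>)) \<in> additive_maps L P"
      by (auto intro!: additive_mapsI simp: pN_simps N_one cl additive_maps_add[OF add])
    fix b x assume h: "b \<in> carrier B" "x \<in> carrier L"
    show "\<phi> (pN (s b \<cdot> x) \<one>\<^bsub>P\<^esub>) = \<beta> b \<bullet> \<phi> (pN x \<one>\<^bsub>P\<^esub>)"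
      using s_left[of b "pN x \<one>\<^bsub>P\<^esub>"] h N_one by (simp add: p1 NM_smult_pure del: NM_simps(4,5))
    show "\<phi> (pN (x \<cdot> s b) \<one>\<^bsub>P\<^esub>) = \<phi> (pN x \<one>\<^bsub>P\<^esub>) \<bullet> \<beta> b"
      using s_right[of b x "\<one>\<^bsub>P\<^esub>"] h N_one by simp
    show "\<phi> (pN (t b \<cdot> x) \<one>\<^bsub>P\<^esub>) = \<iota> b \<bullet> \<phi> (pN x \<one>\<^bsub>P\<^esub>)"
      using left[of b "pN x \<one>\<^bsub>P\<^esub>"] h N_one
      by (simp add: p1 lift_NM[OF bal_TN_left] TN.tensor_lift_pure[OF TN.group_T bal_TN_left])
    show "\<phi> (pN (x \<cdot> t b) \<one>\<^bsub>P\<^esub>) = \<phi> (pN x \<one>\<^bsub>P\<^esub>) \<bullet> \<iota> b"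
      using mult_n[of x "\<iota> b"] h N_one iota_N by (simp add: pN_simps)
  next
    fix x assume "x \<in> carrier L"
    then show "\<rho> (\<phi> (pN x \<one>\<^bsub>P\<^esub>)) = tensor_lift D (\<lambda>x1 x2. x1 \<diamondop> \<phi> (pN x2 \<one>\<^bsub>P\<^esub>)) (\<Delta> x)"
      using col[of "pN x \<one>\<^bsub>P\<^esub>"] lift_normal_coact_pure[OF add s_left _ N_one] by (simp add: p1)
  qed
  interpret c: colin K B L P \<iota> "\<lambda>x. \<phi> (pN x \<one>\<^bsub>P\<^esub>)" by (rule c)
  have "c.phi z = \<phi> z" if "z \<in> carrier TN" for z
    by (rule TN.additive_maps_eqI[OF c.phi_additive add _ that]) (simp add: c.phi_pure mult_n)
  then show "bij_betw c.phi (carrier TN) (carrier P)"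
    using bij_betw_cong[of "carrier TN" c.phi \<phi> "carrier P"] bij by simp
qed

end

text \<open>The map \<open>x \<mapsto> \<gamma> x v\<close>, with \<open>v\<close> the inverse of \<open>\<gamma> 1\<close>, is unital. It is still bilinear because \<open>v\<close> commutes with
the images of \<open>B\<close> and of its opposite, and its \<open>J\<close> is the old one after \<open>x \<otimes> p \<mapsto> x \<otimes> v p\<close>.\<close>

lemma (in normal_Galois) ex_cleaving_map: "\<exists>\<gamma>'. cleaving_map B L P \<iota> \<gamma>'"
proof -
  obtain v where v: "v \<in> N" "u \<bullet> v = \<one>\<^bsub>P\<^esub>" "v \<bullet> u = \<one>\<^bsub>P\<^esub>" "\<forall>b\<in>carrier B. v \<bullet> \<iota> b = \<iota> b \<bullet> v"
    by (rule u_unit)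
  have c: "u \<in> carrier P" "v \<in> carrier P" using u_N v by (auto simp: N_simps)
  let ?\<gamma> = "\<lambda>x. \<gamma> x \<bullet> v"
  have \<gamma>: "colin K B L P \<iota> ?\<gamma>"
  proof (intro colin.intro opp_alg_axioms colin_axioms.intro)
    show "?\<gamma> \<in> additive_maps L P" using c by (auto intro!: additive_mapsI simp: A.l_distr)
    fix b x assume h: "b \<in> carrier B" "x \<in> carrier L"
    show "?\<gamma> (s b \<cdot> x) = \<beta> b \<bullet> ?\<gamma> x" "?\<gamma> (t b \<cdot> x) = \<iota> b \<bullet> ?\<gamma> x"
      using h c by (simp_all add: gamma_s_left gamma_t_left A.m_assoc)
    show "?\<gamma> (x \<cdot> s b) = ?\<gamma> x \<bullet> \<beta> b"
      using h c N_commute[OF v(1) h(1)] by (simp add: gamma_s_right A.m_assoc)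
    show "?\<gamma> (x \<cdot> t b) = ?\<gamma> x \<bullet> \<iota> b"
      using h c v(4) by (simp add: gamma_t_right A.m_assoc)
  next
    fix x assume x: "x \<in> carrier L"
    have add: "(\<lambda>z. z) \<in> additive_maps D D" by (simp add: additive_maps_def)
    show "\<rho> (?\<gamma> x) = tensor_lift D (\<lambda>x1 x2. x1 \<diamondop> ?\<gamma> x2) (\<Delta> x)"
      using x v(1) additive_coact_gamma[OF D.group_T add x c(2) refl] by (simp add: coact_mult_N)
  qed
  interpret v: colin K B L P \<iota> ?\<gamma> by (rule \<gamma>)
  have bal: "oppbal VP TP (\<lambda>x p. pP x (w \<bullet> p))"
    if "w \<in> carrier P" "\<And>b. b \<in> carrier B \<Longrightarrow> w \<bullet> \<iota> b = \<iota> b \<bullet> w" for w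
  proof (rule oppbalI)
    fix b x p assume h: "b \<in> carrier B" "x \<in> carrier L" "p \<in> carrier VP"
    have "w \<bullet> (\<iota> b \<bullet> p) = \<iota> b \<bullet> (w \<bullet> p)"
      using that(1) that(2)[OF h(1)] h by (simp add: A.m_assoc[symmetric])
    then show "pP (x \<cdot> t b) (w \<bullet> p) = pP x (w \<bullet> (b \<odot>\<^bsub>VP\<^esub> p))" using h that(1) by (simp add: pP_simps)
  qed (use that in \<open>simp_all add: pP_simps A.r_distr\<close>)
  have bu: "oppbal VP TP (\<lambda>x p. pP x (u \<bullet> p))" by (rule bal[OF c(1)]) (rule u_iota)
  have bv: "oppbal VP TP (\<lambda>x p. pP x (v \<bullet> p))" by (rule bal[OF c(2)]) (use v(4) in blast)
  let ?U = "tensor_lift TP (\<lambda>x p. pP x (u \<bullet> p))" and ?V = "tensor_lift TP (\<lambda>x p. pP x (v \<bullet> p))"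
  note Ua = TP.tensor_lift_additive[OF TP.group_T bu] and Va = TP.tensor_lift_additive[OF TP.group_T bv]
  have id: "(\<lambda>z. z) \<in> additive_maps TP TP" by (simp add: additive_maps_def)
  have UV: "?U (?V z) = z" if "z \<in> carrier TP" for z
    by (rule TP.additive_maps_eqI[OF additive_maps_comp[OF Va Ua] id _ that])
      (use c v(2) in \<open>simp add: TP.tensor_lift_pure[OF TP.group_T bu] TP.tensor_lift_pure[OF TP.group_T bv] A.m_assoc[symmetric]\<close>)
  have VU: "?V (?U z) = z" if "z \<in> carrier TP" for z
    by (rule TP.additive_maps_eqI[OF additive_maps_comp[OF Ua Va] id _ that])
      (use c v(3) in \<open>simp add: TP.tensor_lift_pure[OF TP.group_T bu] TP.tensor_lift_pure[OF TP.group_T bv] A.m_assoc[symmetric]\<close>)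
  have "bij_betw ?V (carrier TP) (carrier TP)"
    by (rule bij_betw_byWitness[where f' = ?U])
      (use UV VU additive_maps_closed[OF Ua] additive_maps_closed[OF Va] in auto)
  from bij_betw_trans[OF this J_bij] have JV: "bij_betw (J \<circ> ?V) (carrier TP) (carrier D)" .
  have "v.J z = J (?V z)" if "z \<in> carrier TP" for z
    by (rule TP.additive_maps_eqI[OF v.J_additive additive_maps_comp[OF Va J_additive] _ that])
      (use c v(1) in \<open>simp add: v.J_pure J_pure TP.tensor_lift_pure[OF TP.group_T bv] coact_mult_N mult_right_assoc\<close>)
  then have "bij_betw v.J (carrier TP) (carrier D)"
    using bij_betw_cong[of "carrier TP" v.J "J \<circ> ?V" "carrier D"] JV by simp
  then show ?thesis using v.cleaving_mapI v(2) by (auto simp: u_def)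
qed

lemma hopfI:
  assumes "left_Hopf_algebroid K B L"
  shows "hopf K B L"
proof -
  interpret bialg K B L by (rule bialg.intro) (use assms in \<open>simp add: left_Hopf_algebroid_def\<close>)
  have "Lam = tensor_lift LL.D (\<lambda>x y. tensor_lift LL.D (\<lambda>x1 x2. LL.dia x1 (x2 \<cdot> y)) (\<Delta> x))"
    by (simp add: Lam_def lam_def[abs_def] LL.mult_right_def)
  then show ?thesis
    using assms by (intro hopf.intro bialg_axioms hopf_axioms.intro) (simp add: left_Hopf_algebroid_def Let_def)
qed

lemma cleft_via_iff:
  fixes K :: "('k, 'x) ring_scheme"
    and B :: "('k, 'b, 'y) module_scheme"
    and L :: "('k, 'b, 'l, 'z) bialgebroid_scheme"
    and P :: "('k, 'b, 'l, 'p, 'w) comodule_algebra_scheme"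
  assumes L: "left_Hopf_algebroid K B L" and P: "left_comodule_algebra K B L P"
    and flat: "standing_flatness B L P"
  shows "cleft_via K B L P \<iota> \<longleftrightarrow> left_Galois_extension B L P \<and> normal_basis_via K B L P \<iota>"
proof (cases "opp_inclusion K B L P \<iota>")
  case False
  then show ?thesis by (simp add: cleft_via_def normal_basis_via_def)
next
  case True
  interpret hopf K B L by (rule hopfI[OF L])
  interpret comod_alg K B L P by (rule comod_algI[OF bialgebroid P])
  interpret opp_alg K B L P \<iota>
  proof (intro opp_alg.intro comod_alg_axioms opp_alg_axioms.intro)
    show "\<iota> \<in> ring_hom (opp B) P"
      using True by (simp add: opp_inclusion_def Let_def alg_hom_def)
    show "\<iota> b \<in> N" if "b \<in> carrier B" for b
      using True that by (auto simp: opp_inclusion_def Let_def)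
    show "right_faithfully_flat TYPE(('b, 'l, 'p) test_type) (opp B) RM"
      using flat by (simp add: standing_flatness_def Let_def)
  qed
  show ?thesis
  proof
    assume "cleft_via K B L P \<iota>"
    then obtain \<gamma> where \<gamma>: "cleaving_map B L P \<iota> \<gamma>" by (auto simp: cleft_via_def)
    interpret colin K B L P \<iota> \<gamma> by (rule colinI(1)[OF \<gamma>])
    interpret cleft K B L P \<iota> \<gamma>
    proof (intro cleft.intro colin_axioms hopf_axioms cleft_axioms.intro)
      show "bij_betw J (carrier TP) (carrier D)"
        using colinI(3)[OF \<gamma>] by (rule bij_betw_cong[THEN iffD1, rotated]) (rule J_literal)
    qed
    show "left_Galois_extension B L P \<and> normal_basis_via K B L P \<iota>"
      using kappa_bij normal_basis_viaI[OF True phi_bij] by (simp add: Galois_iff)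
  next
    assume *: "left_Galois_extension B L P \<and> normal_basis_via K B L P \<iota>"
    then obtain \<phi> where \<phi>: "bij_betw \<phi> (carrier NM) (carrier P)"
      "\<phi> \<in> comodule_maps B L NM (normal_coact B L P \<iota>) A' \<rho>"
      "\<And>b z. b \<in> carrier B \<Longrightarrow> z \<in> carrier NM \<Longrightarrow> \<phi> (tensor_lift NM (\<lambda>x n. pN (t b \<cdot> x) n) z) = \<iota> b \<bullet> \<phi> z"
      "\<And>m z. m \<in> N \<Longrightarrow> z \<in> carrier NM \<Longrightarrow> \<phi> (tensor_lift NM (\<lambda>x n. pN x (n \<bullet> m)) z) = \<phi> z \<bullet> m"
      unfolding normal_basis_via_def Let_def by blast
    interpret colin K B L P \<iota> "\<lambda>x. \<phi> (pN x \<one>\<^bsub>P\<^esub>)" by (rule colin_of_normal_basis(1)[OF \<phi>])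
    interpret normal_Galois K B L P \<iota> "\<lambda>x. \<phi> (pN x \<one>\<^bsub>P\<^esub>)"
    proof (intro normal_Galois.intro colin_axioms hopf_axioms normal_Galois_axioms.intro)
      show "bij_betw phi (carrier TN) (carrier P)" by (rule colin_of_normal_basis(2)[OF \<phi>])
      show "bij_betw kappa (carrier PNP) (carrier D)" using * by (simp add: Galois_iff)
    qed
    show "cleft_via K B L P \<iota>"
      using True ex_cleaving_map by (simp add: cleft_via_def)
  qed
qed

theorem theorem6p9:
  fixes K :: "('k, 'x) ring_scheme"
    and B :: "('k, 'b, 'y) module_scheme"
    and L :: "('k, 'b, 'l, 'z) bialgebroid_scheme"
    and P :: "('k, 'b, 'l, 'p, 'w) comodule_algebra_scheme"
  assumes "left_Hopf_algebroid K B L"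
    and "left_comodule_algebra K B L P"
    and "standing_flatness B L P"
  shows "(cleft_extension K B L P \<longleftrightarrow>
            left_Galois_extension B L P \<and> left_normal_basis_property K B L P) \<and>
         (\<forall>\<iota>. cleft_via K B L P \<iota> \<longleftrightarrow> left_Galois_extension B L P \<and> normal_basis_via K B L P \<iota>)"
  using cleft_via_iff[OF assms] by (auto simp: cleft_extension_def left_normal_basis_property_def)

end
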